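(* Let $r$ be an odd integer with $0<r<24$ and let $s$ be a non-negative even integer. Then the space $$\mathcal S_{r,s}:=\left\{\eta(24\tau)^r f(24\tau): f(\tau)\in M_s(\mathrm{SL}(2,\mathbb Z))\right\}$$ is an invariant subspace of $S_{s+r/2}(\Gamma_0(576),\chi_{12})$ under the action of the Hecke algebra. That is, $\mathcal S_{r,s}$ is a subspace of $S_{s+r/2}(\Gamma_0(576),\chi_{12})$, and for all primes $\ell\neq 2,3$ and all $f\in\mathcal S_{r,s}$ we have $f\big|T_{\ell^2}\in\mathcal S_{r,s}$.
   Context: $\eta(\tau)=q^{1/24}\prod_{n\ge1}(1-q^n)$, $q=e^{2\pi i\tau}$, is the Dedekind eta function. $M_s(\mathrm{SL}(2,\mathbb Z))$ is the space of holomorphic modular forms of weight $s$ on $\mathrm{SL}(2,\mathbb Z)$. $\chi_{12}=\left(\frac{12}{\cdot}\right)$. $S_{\lambda+1/2}(\Gamma_0(4N),\psi)$ denotes the space of cusp forms of half-integral weight $\lambda+1/2$ and level $4N$ with character $\psi$ (in Shimura's sense). For $f(\tau)=\sum_{n\ge1}a_f(n)q^n\in S_{\lambda+1/2}(\Gamma_0(4N),\psi)$ and a prime $\ell\nmid 4N$, the Hecke operator is $$f\big|T_{\ell^2}=\sum_{n=1}^\infty\left(a_f(\ell^2n)+\psi(\ell)\left(\frac{(-1)^\lambda n}{\ell}\right)\ell^{\lambda-1}a_f(n)+\psi(\ell^2)\ell^{2\lambda-1}a_f(n/\ell^2)\right)q^n,$$ where $a_f(n/\ell^2)=0$ if $\ell^2\nmid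 n$. Here $\lambda=s+(r-1)/2$, $4N=576$, $\psi=\chi_{12}$. *)

theory Defs
  imports
    "HOL-Complex_Analysis.Complex_Analysis"
    "HOL-Number_Theory.Number_Theory"
    "HOL-Library.Function_Algebras"
begin

text \<open>
  A function on the upper half plane is represented by a function of type
  \<open>complex \<Rightarrow> complex\<close> which is zero off the upper half plane, so that equality of
  representatives is equality of functions on the upper half plane.
\<close>

definition upper_half :: "complex set" where
  "upper_half = {\<tau>. Im \<tau> > 0}"

definition mobius :: "int \<Rightarrow> int \<Rightarrow> int \<Rightarrow> int \<Rightarrow> complex \<Rightarrow> complex" where
  "mobius a b c d \<tau> = (of_int a * \<tau> + of_int b) / (of_int c * \<tau> + of_int d)"

definition nome :: "complex \<Rightarrow> complex" where
  "nome \<tau> = exp (2 * of_real pi * \<i> * \<tau>)"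

text \<open>The filter \<open>Im \<tau> \<rightarrow> \<infinity>\<close>, uniform in \<open>Re \<tau>\<close>.\<close>

definition at_im_infty :: "complex filter" where
  "at_im_infty = filtercomap Im at_top"

definition holomorphic_upper_half :: "(complex \<Rightarrow> complex) \<Rightarrow> bool" where
  "holomorphic_upper_half f \<longleftrightarrow>
     f holomorphic_on upper_half \<and> (\<forall>\<tau>. \<tau> \<notin> upper_half \<longrightarrow> f \<tau> = 0)"

definition modular_forms :: "nat \<Rightarrow> (complex \<Rightarrow> complex) set" where
  "modular_forms s = {f. holomorphic_upper_half f \<and>
     (\<forall>a b c d. a * d - b * c = 1 \<longrightarrow>
        (\<forall>\<tau>\<in>upper_half. f (mobius a b c d \<tau>) = (of_int c * \<tau> + of_int d) ^ s * f \<tau>)) \<and>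
     Bfun f at_im_infty}"

definition dedekind_eta :: "complex \<Rightarrow> complex" where
  "dedekind_eta \<tau> = exp (2 * of_real pi * \<i> * \<tau> / 24) * (\<Prod>n. 1 - nome \<tau> ^ Suc n)"

definition theta :: "complex \<Rightarrow> complex" where
  "theta \<tau> = (\<Sum>\<^sub>\<infinity>n\<in>(UNIV :: int set). exp (2 * of_real pi * \<i> * of_int (n ^ 2) * \<tau>))"

text \<open>
  Shimura's automorphy factor of weight \<open>1/2\<close> on \<open>\<Gamma>\<^sub>0(4)\<close>, namely
  \<open>j(\<gamma>,\<tau>) = \<theta>(\<gamma>\<tau>)/\<theta>(\<tau>)\<close>. It satisfies
  \<open>j(\<gamma>,\<tau>) = \<epsilon>\<^sub>d\<^sup>-\<^sup>1 (c/d) (c\<tau>+d)\<^sup>1\<^sup>/\<^sup>2\<close>.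
\<close>

definition theta_factor :: "int \<Rightarrow> int \<Rightarrow> int \<Rightarrow> int \<Rightarrow> complex \<Rightarrow> complex" where
  "theta_factor a b c d \<tau> = theta (mobius a b c d \<tau>) / theta \<tau>"

text \<open>
  Cusp forms of weight \<open>k + 1/2\<close>, level \<open>M\<close> (with \<open>4\<close> dividing \<open>M\<close>) and character \<open>\<psi>\<close>.
  The last condition is vanishing at the cusp \<open>a/c\<close>, for every element of \<open>SL(2,\<int>)\<close>. Any
  other branch of the square root differs by a sign where \<open>Im \<tau> > 0\<close>, so the choice is immaterial.
\<close>

definition half_integral_cusp_forms ::
    "nat \<Rightarrow> nat \<Rightarrow> (int \<Rightarrow> complex) \<Rightarrow> (complex \<Rightarrow> complex) set" where
  "half_integral_cusp_forms k M \<psi> = {f. holomorphic_upper_half f \<and>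
     (\<forall>a b c d. a * d - b * c = 1 \<and> int M dvd c \<longrightarrow>
        (\<forall>\<tau>\<in>upper_half.
           f (mobius a b c d \<tau>) = \<psi> d * theta_factor a b c d \<tau> ^ (2 * k + 1) * f \<tau>)) \<and>
     (\<forall>a b c d. a * d - b * c = 1 \<longrightarrow>
        ((\<lambda>\<tau>. f (mobius a b c d \<tau>) / csqrt (of_int c * \<tau> + of_int d) ^ (2 * k + 1))
           \<longlongrightarrow> 0) at_im_infty)}"

definition kronecker_prime :: "int \<Rightarrow> nat \<Rightarrow> int" where
  "kronecker_prime a p =
     (if p = 2 then (if even a then 0 else if a mod 8 \<in> {1, 7} then 1 else - 1)
      else Legendre a (int p))"

definition kronecker :: "int \<Rightarrow> int \<Rightarrow> int" where
  "kronecker a n =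
     (if n = 0 then (if \<bar>a\<bar> = 1 then 1 else 0)
      else (if n < 0 \<and> a < 0 then - 1 else 1) *
        (\<Prod>p\<in>prime_factors (nat \<bar>n\<bar>). kronecker_prime a p ^ multiplicity p (nat \<bar>n\<bar>)))"

definition chi12 :: "int \<Rightarrow> complex" where
  "chi12 n = of_int (kronecker 12 n)"

definition fourier_coeffs :: "(complex \<Rightarrow> complex) \<Rightarrow> nat \<Rightarrow> complex" where
  "fourier_coeffs f = (THE a. \<forall>\<tau>\<in>upper_half. (\<lambda>n. a n * nome \<tau> ^ n) sums f \<tau>)"

text \<open>
  The exponents \<open>k - 1\<close> and \<open>2k - 1\<close> are integers, and equal \<open>-1\<close> when \<open>k = 0\<close>.
\<close>

definition hecke_coeff ::
    "nat \<Rightarrow> (int \<Rightarrow> complex) \<Rightarrow> nat \<Rightarrow> (nat \<Rightarrow> complex) \<Rightarrow> nat \<Rightarrow> complex" where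
  "hecke_coeff k \<psi> l a n =
     a (l ^ 2 * n)
     + \<psi> (int l) * of_int (Legendre ((- 1) ^ k * int n) (int l))
         * of_nat l powi (int k - 1) * a n
     + \<psi> (int l ^ 2) * of_nat l powi (2 * int k - 1)
         * (if l ^ 2 dvd n then a (n div l ^ 2) else 0)"

definition hecke_operator ::
    "nat \<Rightarrow> (int \<Rightarrow> complex) \<Rightarrow> nat \<Rightarrow> (complex \<Rightarrow> complex) \<Rightarrow> complex \<Rightarrow> complex" where
  "hecke_operator k \<psi> l f \<tau> =
     (if \<tau> \<in> upper_half
      then \<Sum>n. hecke_coeff k \<psi> l (fourier_coeffs f) (Suc n) * nome \<tau> ^ Suc n
      else 0)"

text \<open>The factor \<open>f (24 * \<tau>)\<close> makes the product vanish off the upper half plane.\<close>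

definition eta_space :: "nat \<Rightarrow> nat \<Rightarrow> (complex \<Rightarrow> complex) set" where
  "eta_space r s = {\<lambda>\<tau>. dedekind_eta (24 * \<tau>) ^ r * f (24 * \<tau>) | f. f \<in> modular_forms s}"

interpretation cfun: vector_space "\<lambda>(c :: complex) (f :: complex \<Rightarrow> complex) \<tau>. c * f \<tau>"
  by unfold_locales (auto simp: fun_eq_iff algebra_simps)

end

theory Submission
  imports Defs "HOL-Real_Asymp.Real_Asymp"
begin

text \<open>
  The analytic input is the inversion formula \<open>theta_series_inversion\<close> for theta series with periodic
  coefficients. The shifted Gaussian sum and the theta function in the dual variable are entire functions
  with the same period and the same quasi-period. Quasi-periodicity is a first-order recursion for the
  Fourier coefficients, so such functions form a space of dimension one. The factor of proportionality is
  found at squares of rationals by summing over division points, and analytic continuation does the rest.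

  Euler's pentagonal number theorem says that twice the eta function is the theta series of the character
  \<open>chi12\<close> (\<open>eta_eq_theta_series\<close>). Inverting at a rational point therefore expresses the action of a
  matrix on \<open>\<eta>\<close> and on \<open>\<theta>\<close> by quadratic exponential sums. At level 576 the sums for
  \<open>\<eta> (24 \<tau>)\<close> and \<open>\<theta>\<close> differ only by \<open>chi12 d\<close> (\<open>eta_theta_ratio_576\<close>); since \<open>\<theta>\<close> has no zero and
  \<open>\<theta>\<^sup>4\<close> has weight two, the multiples of \<open>\<eta> (24 \<tau>)\<^sup>r\<close> transform as required. They vanish at all cusps
  because they do at infinity and their absolute values are controlled by the full modular group.

  For the Hecke operator put \<open>h = \<eta>\<^sup>r f\<close>. Because \<open>l\<^sup>2\<close> is \<open>1\<close> modulo 24 and the Legendre symbol is its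
  own finite Fourier transform, the operator is a sum of \<open>h\<close> over the maps \<open>\<tau> \<mapsto> (\<tau> + 24 b) / l\<^sup>2\<close>,
  \<open>\<tau> \<mapsto> \<tau> + 24 b / l\<close> (weighted by the Legendre symbol of \<open>b\<close>) and \<open>\<tau> \<mapsto> l\<^sup>2 \<tau>\<close>. Composing with
  \<open>\<tau> \<mapsto> -1 / \<tau>\<close> permutes these maps up to matrices with diagonal entries divisible by 24. By
  \<open>dedekind_eta_mobius\<close> the multiplier of such a matrix is a Gauss sum modulo its lower left entry. It is
  trivial for \<open>l\<^sup>2\<close>, and for \<open>l\<close> it is a Legendre symbol times a constant, which is exactly what the weights
  absorb. So the image satisfies the same two transformation laws as \<open>h\<close> (\<open>hecke_h_S\<close>, \<open>hecke_h_T\<close>).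
  Its quotient by \<open>\<eta>\<^sup>r\<close> has weight \<open>s\<close> for the full modular group, and as \<open>r < 24\<close> there is no room for
  a pole at infinity (\<open>quotient_bounded\<close>). Hence the quotient is a modular form.
\<close>

section \<open>Locally uniformly convergent sums of holomorphic functions\<close>

text \<open>Weierstrass' \<open>M\<close>-test, with a majorant that may depend on the point.\<close>

lemma holomorphic_on_infsum:
  fixes f :: "'i \<Rightarrow> complex \<Rightarrow> complex"
  assumes maj: "\<And>z. z \<in> S \<Longrightarrow> \<exists>r>0. \<exists>M. cball z r \<subseteq> S \<and> M summable_on I \<and>
                  (\<forall>n\<in>I. \<forall>w\<in>cball z r. norm (f n w) \<le> M n)"
    and hol: "\<And>n. n \<in> I \<Longrightarrow> f n holomorphic_on S"
  shows "(\<lambda>z. \<Sum>\<^sub>\<infinity>n\<in>I. f n z) holomorphic_on S"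
proof -
  have "(\<lambda>z. \<Sum>\<^sub>\<infinity>n\<in>I. f n z) field_differentiable at z" if "z \<in> S" for z
  proof -
    obtain r M where r: "r > 0" "cball z r \<subseteq> S" and M: "M summable_on I"
      and bd: "\<And>n w. n \<in> I \<Longrightarrow> w \<in> cball z r \<Longrightarrow> norm (f n w) \<le> M n"
      using maj[OF \<open>z \<in> S\<close>] by blast
    have ul: "uniform_limit (cball z r) (\<lambda>X w. \<Sum>n\<in>X. f n w) (\<lambda>w. \<Sum>\<^sub>\<infinity>n\<in>I. f n w)
                (finite_subsets_at_top I)"
      by (rule Weierstrass_m_test_general[OF bd M])
    have "(\<lambda>w. \<Sum>n\<in>X. f n w) holomorphic_on cball z r" if "X \<subseteq> I" for X
      by (intro holomorphic_on_sum) (use hol r that in \<open>auto intro: holomorphic_on_subset\<close>)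
    hence "\<forall>\<^sub>F X in finite_subsets_at_top I.
             continuous_on (cball z r) (\<lambda>w. \<Sum>n\<in>X. f n w) \<and>
             (\<lambda>w. \<Sum>n\<in>X. f n w) holomorphic_on ball z r"
      by (intro eventually_finite_subsets_at_top_weakI)
         (meson ball_subset_cball holomorphic_on_imp_continuous_on holomorphic_on_subset)
    then have "(\<lambda>w. \<Sum>\<^sub>\<infinity>n\<in>I. f n w) holomorphic_on ball z r"
      using holomorphic_uniform_limit[OF _ ul] by (metis finite_subsets_at_top_neq_bot)
    thus ?thesis
      using r(1) by (meson centre_in_ball holomorphic_on_imp_differentiable_at open_ball)
  qed
  thus ?thesis
    by (meson field_differentiable_at_within holomorphic_onI)
qed

lemma summable_exp_minus_abs_int: "(\<lambda>n::int. exp (- real_of_int \<bar>n\<bar>)) summable_on UNIV"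
proof -
  have g: "(\<lambda>n. exp (- real n)) summable_on UNIV"
  proof -
    have "summable (\<lambda>n. exp (-1::real) ^ n)"
      by (rule summable_geometric) simp
    also have "(\<lambda>n. exp (-1::real) ^ n) = (\<lambda>n. exp (- real n))"
      by (simp add: exp_of_nat_mult[symmetric] fun_eq_iff)
    finally show ?thesis
      by (intro norm_summable_imp_summable_on) simp
  qed
  have 1: "(\<lambda>n::int. exp (- real_of_int \<bar>n\<bar>)) summable_on (range int)"
    using g by (subst summable_on_reindex) (auto simp: o_def inj_on_def)
  have 2: "(\<lambda>n::int. exp (- real_of_int \<bar>n\<bar>)) summable_on (range (\<lambda>n. - int n))"
    using g by (subst summable_on_reindex) (auto simp: o_def inj_on_def)
  have "range int \<union> range (\<lambda>n. - int n) = UNIV"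
    by (auto, metis int_cases2 rangeI)
  with summable_on_union[OF 1 2] show ?thesis by simp
qed

text \<open>Completing the square bounds the Gaussian by a multiple of \<open>exp (-\<bar>n\<bar>)\<close>.\<close>

lemma summable_gaussian_int:
  assumes "\<alpha> > 0"
  shows "(\<lambda>n::int. exp (- \<alpha> * of_int n ^ 2 + \<beta> * of_int \<bar>n\<bar>) :: real) summable_on UNIV"
proof (rule summable_on_comparison_test)
  show "(\<lambda>n::int. exp ((\<beta> + 1) ^ 2 / (4 * \<alpha>)) * exp (- real_of_int \<bar>n\<bar>)) summable_on UNIV"
    by (intro summable_on_cmult_right summable_exp_minus_abs_int)
next
  fix n :: int
  have "0 \<le> (2 * \<alpha> * of_int \<bar>n\<bar> - (\<beta> + 1)) ^ 2 / (4 * \<alpha>)"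
    using assms by simp
  also have "\<dots> = \<alpha> * of_int \<bar>n\<bar> ^ 2 - (\<beta> + 1) * of_int \<bar>n\<bar> + (\<beta> + 1) ^ 2 / (4 * \<alpha>)"
    using assms by (simp add: field_simps power2_eq_square)
  finally have "- \<alpha> * of_int n ^ 2 + \<beta> * of_int \<bar>n\<bar> \<le> (\<beta> + 1) ^ 2 / (4 * \<alpha>) + - real_of_int \<bar>n\<bar>"
    by (simp add: algebra_simps power2_eq_square abs_mult_self_eq flip: of_int_mult)
  thus "exp (- \<alpha> * of_int n ^ 2 + \<beta> * of_int \<bar>n\<bar>)
          \<le> exp ((\<beta> + 1) ^ 2 / (4 * \<alpha>)) * exp (- real_of_int \<bar>n\<bar>)"
    by (subst exp_add[symmetric]) simp
qed auto

section \<open>The exponential of period one\<close>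

lemma nome_add: "nome (x + y) = nome x * nome y"
  by (simp add: nome_def ring_distribs exp_add)

lemma nome_0 [simp]: "nome 0 = 1"
  by (simp add: nome_def)

lemma nome_minus: "nome (- x) = inverse (nome x)"
  by (simp add: nome_def exp_minus)

lemma nome_diff: "nome (x - y) = nome x / nome y"
  by (simp add: nome_def ring_distribs exp_diff)

lemma nome_nonzero [simp]: "nome x \<noteq> 0"
  by (simp add: nome_def)

lemma nome_of_int [simp]: "nome (of_int n) = 1"
  unfolding nome_def using exp_integer_2pi[of "of_int n"] by (simp add: mult_ac)

lemma nome_1 [simp]: "nome 1 = 1"
  using nome_of_int[of 1] by simp

lemma nome_of_nat [simp]: "nome (of_nat n) = 1"
  using nome_of_int[of "int n"] by simp

lemma nome_add_of_int [simp]: "nome (z + of_int n) = nome z"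
  by (simp add: nome_add)

lemma nome_add_1 [simp]: "nome (z + 1) = nome z"
  by (simp add: nome_add)

lemma nome_power: "nome z ^ n = nome (of_nat n * z)"
  by (simp add: nome_def exp_of_nat_mult[symmetric] mult_ac)

lemma norm_nome: "norm (nome z) = exp (- 2 * pi * Im z)"
  by (simp add: nome_def)

lemma nome_holomorphic [holomorphic_intros]:
  "f holomorphic_on S \<Longrightarrow> (\<lambda>z. nome (f z)) holomorphic_on S"
  unfolding nome_def by (intro holomorphic_intros)

lemma nome_eq_1_iff: "nome z = 1 \<longleftrightarrow> (\<exists>n::int. z = of_int n)"
proof
  assume "nome z = 1"
  hence "exp (2 * of_real pi * \<i> * z) = exp 0"
    by (simp add: nome_def)
  then obtain n :: int where "2 * of_real pi * \<i> * z = of_real (of_int (2 * n) * pi) * \<i>"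
    unfolding exp_eq by auto
  hence "z = of_int n" by (simp add: field_simps)
  thus "\<exists>n::int. z = of_int n" ..
qed auto

lemma nome_has_derivative [derivative_intros]:
  "(nome has_field_derivative (2 * of_real pi * \<i> * nome z)) (at z within S)"
  unfolding nome_def by (auto intro!: derivative_eq_intros)

section \<open>Fourier coefficients of entire functions of period one\<close>

definition period_mean :: "(complex \<Rightarrow> complex) \<Rightarrow> complex" where
  "period_mean G = contour_integral (linepath 0 1) G"

definition fourier :: "int \<Rightarrow> (complex \<Rightarrow> complex) \<Rightarrow> complex" where
  "fourier m G = period_mean (\<lambda>z. G z * nome (- of_int m * z))"

lemma period_integrable:
  "G holomorphic_on UNIV \<Longrightarrow> G contour_integrable_on linepath 0 1"
  by (metis contour_integrable_continuous_linepath continuous_on_subset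
      holomorphic_on_imp_continuous_on top_greatest)

lemma fourier_integrable:
  assumes "G holomorphic_on UNIV"
  shows "(\<lambda>z. G z * nome (- of_int m * z)) contour_integrable_on linepath 0 1"
  by (intro period_integrable holomorphic_intros assms)

lemma fourier_diff:
  assumes "F holomorphic_on UNIV" "G holomorphic_on UNIV"
  shows "fourier m (\<lambda>z. F z - G z) = fourier m F - fourier m G"
  unfolding fourier_def period_mean_def left_diff_distrib
  by (intro contour_integral_diff fourier_integrable assms)

lemma fourier_cmult:
  assumes "G holomorphic_on UNIV"
  shows "fourier m (\<lambda>z. c * G z) = c * fourier m G"
  unfolding fourier_def period_mean_def mult.assoc
  by (intro contour_integral_lmul fourier_integrable assms)

text \<open>The integral of a periodic function over a period does not depend on where the period starts:
  the derivative of \<open>P (w + 1) - P w\<close> vanishes for a primitive \<open>P\<close>. Complex \<open>w\<close> are allowed, so this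
  replaces shifting a contour.\<close>

lemma period_mean_shift:
  assumes hol: "G holomorphic_on UNIV" and per: "\<And>z. G (z + 1) = G z"
  shows "period_mean (\<lambda>z. G (z + w)) = period_mean G"
proof -
  obtain P where P: "\<And>z. (P has_field_derivative G z) (at z)"
    using holomorphic_convex_primitive'[of UNIV G] hol by auto
  have "((\<lambda>w. P (w + 1) - P w) has_field_derivative 0) (at x)" for x
  proof -
    have "((\<lambda>w. P (w + 1) - P w) has_field_derivative (G (x + 1) * (1 + 0) - G x)) (at x)"
      by (rule DERIV_diff[OF DERIV_chain2[OF P] P])
         (intro derivative_intros)
    thus ?thesis
      by (simp add: per)
  qed
  then have const: "P (w + 1) - P w = P (0 + 1) - P 0" for w
    using has_field_derivative_zero_constant[of UNIV "\<lambda>w. P (w + 1) - P w"]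
    by (metis UNIV_I convex_UNIV)
  have "((\<lambda>z. G (z + w)) has_contour_integral (P (1 + w) - P (0 + w))) (linepath 0 1)"
  proof -
    have "((\<lambda>z. P (z + w)) has_field_derivative G (z + w)) (at z)" for z
      using P[of "z + w"] by (simp add: DERIV_shift)
    from contour_integral_primitive[of UNIV _ _ "linepath 0 1", OF this] show ?thesis by simp
  qed
  moreover have "(G has_contour_integral (P 1 - P 0)) (linepath 0 1)"
    using contour_integral_primitive[of UNIV P G "linepath 0 1"] P by simp
  ultimately show ?thesis
    using const[of w] unfolding period_mean_def
    by (metis add.commute add.right_neutral contour_integral_unique)
qed

lemma fourier_shift:
  assumes hol: "G holomorphic_on UNIV" and per: "\<And>z. G (z + 1) = G z"
  shows "fourier m (\<lambda>z. G (z + w)) = nome (of_int m * w) * fourier m G"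
proof -
  have "period_mean (\<lambda>z. G (z + w) * nome (- of_int m * (z + w))) = fourier m G"
    unfolding fourier_def
    by (rule period_mean_shift)
       (intro holomorphic_intros hol, simp add: per nome_add ring_distribs nome_diff nome_minus)
  also have "(\<lambda>z. G (z + w) * nome (- of_int m * (z + w)))
               = (\<lambda>z. nome (- of_int m * w) * (G (z + w) * nome (- of_int m * z)))"
    by (simp add: nome_add ring_distribs mult_ac nome_minus nome_diff divide_inverse)
  also have "period_mean \<dots> = nome (- of_int m * w) * fourier m (\<lambda>z. G (z + w))"
    unfolding fourier_def period_mean_def
  proof (intro contour_integral_lmul fourier_integrable)
    have "(G \<circ> (\<lambda>z. z + w)) holomorphic_on UNIV"
      by (rule holomorphic_on_compose_gen[OF _ hol]) (auto intro: holomorphic_intros)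
    thus "(\<lambda>z. G (z + w)) holomorphic_on UNIV" by (simp add: o_def)
  qed
  finally show ?thesis by (simp add: nome_minus field_simps)
qed

lemma period_mean_bound:
  assumes "G holomorphic_on UNIV" "\<And>x. x \<in> closed_segment 0 1 \<Longrightarrow> norm (G x) \<le> B" "B \<ge> 0"
  shows "norm (period_mean G) \<le> B"
  using contour_integral_bound_linepath[OF period_integrable[OF assms(1)] assms(3,2)]
  by (simp add: period_mean_def)

text \<open>Moving the path of integration by \<open>\<mp>\<i>\<close> makes the coefficients decay exponentially.\<close>

lemma fourier_decay:
  assumes hol: "G holomorphic_on UNIV" and per: "\<And>z. G (z + 1) = G z"
  obtains B where "B \<ge> 0" "\<And>m. norm (fourier m G) \<le> B * exp (- 2 * pi * \<bar>of_int m\<bar>)"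
proof -
  have B: "\<exists>B\<ge>0. \<forall>m. norm (fourier m G) \<le> B * exp (2 * pi * (of_int m * Im w))" for w
  proof -
    have "continuous_on (closed_segment (0 + w) (1 + w)) G"
      by (meson continuous_on_subset hol holomorphic_on_imp_continuous_on top_greatest)
    then obtain B where B: "\<And>z. z \<in> closed_segment (0 + w) (1 + w) \<Longrightarrow> norm (G z) \<le> B"
      using compact_continuous_image[of "closed_segment (0 + w) (1 + w)" G]
      by (metis compact_imp_bounded bounded_iff compact_segment imageI)
    have B0: "B \<ge> 0"
      using B[of "0 + w"] norm_ge_zero by (meson ends_in_segment(1) order_trans)
    have hw: "(\<lambda>z. G (z + w)) holomorphic_on UNIV"
      using holomorphic_on_compose_gen[OF _ hol, of "\<lambda>z. z + w" UNIV]
      by (simp add: o_def holomorphic_intros)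
    have "norm (fourier m G) \<le> B * exp (2 * pi * (of_int m * Im w))" for m
    proof -
      have "norm (fourier m (\<lambda>z. G (z + w))) \<le> B"
        unfolding fourier_def
      proof (rule period_mean_bound[OF _ _ B0])
        show "(\<lambda>z. G (z + w) * nome (- of_int m * z)) holomorphic_on UNIV"
          by (intro holomorphic_intros hw)
        fix x :: complex assume x: "x \<in> closed_segment 0 1"
        hence "x + w \<in> closed_segment (0 + w) (1 + w)"
          by (metis add.commute closed_segment_translation_eq)
        moreover have "Im x = 0"
          using x by (auto simp: in_segment)
        ultimately show "norm (G (x + w) * nome (- of_int m * x)) \<le> B"
          using B by (simp add: norm_mult norm_nome)
      qed
      also have "norm (fourier m (\<lambda>z. G (z + w))) = exp (- 2 * pi * (of_int m * Im w)) * norm (fourier m G)"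
        by (simp add: fourier_shift[OF hol per] norm_mult norm_nome)
      finally show ?thesis
        by (simp add: exp_minus field_simps)
    qed
    with B0 show ?thesis by blast
  qed
  obtain B1 where B1: "B1 \<ge> 0" "\<And>m. norm (fourier m G) \<le> B1 * exp (2 * pi * (of_int m * Im \<i>))"
    using B[of \<i>] by auto
  obtain B2 where B2: "B2 \<ge> 0" "\<And>m. norm (fourier m G) \<le> B2 * exp (2 * pi * (of_int m * Im (-\<i>)))"
    using B[of "-\<i>"] by auto
  show ?thesis
  proof
    show "max B1 B2 \<ge> 0" using B1(1) by simp
    show "norm (fourier m G) \<le> max B1 B2 * exp (- 2 * pi * \<bar>of_int m\<bar>)" for m
    proof (cases "m \<ge> 0")
      case True
      have "norm (fourier m G) \<le> B2 * exp (2 * pi * (of_int m * Im (-\<i>)))" by (rule B2)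
      also have "\<dots> \<le> max B1 B2 * exp (- 2 * pi * \<bar>of_int m\<bar>)"
        using True by (intro mult_mono) (use B1 in auto)
      finally show ?thesis .
    next
      case False
      have "norm (fourier m G) \<le> B1 * exp (2 * pi * (of_int m * Im \<i>))" by (rule B1)
      also have "\<dots> \<le> max B1 B2 * exp (- 2 * pi * \<bar>of_int m\<bar>)"
        using False by (intro mult_mono) (use B1 in auto)
      finally show ?thesis .
    qed
  qed
qed

text \<open>A quotient of entire functions extends over the simple zeros of the denominator at which
  the numerator vanishes.\<close>

lemma entire_quotient:
  assumes hf: "f holomorphic_on UNIV" and hg: "g holomorphic_on UNIV"
    and zeros: "\<And>z. g z = 0 \<Longrightarrow> f z = 0 \<and> deriv g z \<noteq> 0"
  defines "q \<equiv> \<lambda>z. if g z = 0 then deriv f z / deriv g z else f z / g z"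
  shows "q holomorphic_on UNIV" and "q z * g z = f z"
proof -
  show "q z * g z = f z" using zeros by (auto simp: q_def)
  have df: "(f has_field_derivative deriv f z) (at z)" for z
    using hf by (metis UNIV_I holomorphic_derivI open_UNIV)
  have dg: "(g has_field_derivative deriv g z) (at z)" for z
    using hg by (metis UNIV_I holomorphic_derivI open_UNIV)
  have quot: "(\<lambda>z. f z / g z) holomorphic_on S" if "\<And>z. z \<in> S \<Longrightarrow> g z \<noteq> 0" for S
    by (intro holomorphic_on_divide) (use hf hg that in \<open>auto intro: holomorphic_on_subset\<close>)
  have "q field_differentiable at z0" for z0
  proof (cases "g z0 = 0")
    case False
    define U where "U = {z. g z \<noteq> 0}"
    have "open U"
      unfolding U_def
      by (intro open_Collect_neq holomorphic_on_imp_continuous_on hg continuous_on_const)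
    hence U: "open U" "z0 \<in> U" "\<And>z. z \<in> U \<Longrightarrow> g z \<noteq> 0"
      using False by (auto simp: U_def)
    have "q holomorphic_on U"
      using quot[OF U(3)] by (rule holomorphic_transform) (use U in \<open>auto simp: q_def\<close>)
    thus ?thesis using U by (simp add: holomorphic_on_imp_differentiable_at)
  next
    case True
    have g0: "((\<lambda>z. g z / (z - z0)) \<longlongrightarrow> deriv g z0) (at z0)"
      and f0: "((\<lambda>z. f z / (z - z0)) \<longlongrightarrow> deriv f z0) (at z0)"
      using df[of z0] dg[of z0] zeros[OF True] True by (simp_all add: has_field_derivative_iff)
    have ev: "eventually (\<lambda>z. g z \<noteq> 0) (at z0)"
      using tendsto_imp_eventually_ne[OF g0, of 0] zeros[OF True] by (auto elim: eventually_mono)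
    then obtain r where r: "r > 0" "\<And>z. z \<noteq> z0 \<Longrightarrow> dist z z0 < r \<Longrightarrow> g z \<noteq> 0"
      by (auto simp: eventually_at)
    have "q holomorphic_on ball z0 r"
    proof (rule no_isolated_singularity'[of "{z0}"])
      have "((\<lambda>z. (f z / (z - z0)) / (g z / (z - z0))) \<longlongrightarrow> deriv f z0 / deriv g z0) (at z0)"
        by (intro tendsto_divide f0 g0) (use zeros[OF True] in auto)
      moreover have "eventually (\<lambda>z. (f z / (z - z0)) / (g z / (z - z0)) = q z) (at z0)"
        using ev eventually_neq_at_within[of z0 z0 UNIV] by eventually_elim (simp add: q_def)
      ultimately have "(q \<longlongrightarrow> q z0) (at z0)"
        using True by (simp add: q_def filterlim_cong)
      thus "(q \<longlongrightarrow> q z) (at z within ball z0 r)" if "z \<in> {z0}" for z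
        using that by (auto intro: filterlim_mono at_le)
      show "q holomorphic_on ball z0 r - {z0}"
        by (rule holomorphic_transform[OF quot]) (use r in \<open>auto simp: q_def dist_commute\<close>)
    qed auto
    thus ?thesis using r(1) by (simp add: holomorphic_on_imp_differentiable_at[of _ "ball z0 r"])
  qed
  thus "q holomorphic_on UNIV"
    by (simp add: holomorphic_on_open field_differentiable_def[symmetric])
qed

lemma fourier_const: "fourier m (\<lambda>_. c) = (if m = 0 then c else 0)"
proof (cases "m = 0")
  case True
  thus ?thesis by (simp add: fourier_def period_mean_def)
next
  case False
  have "nome (of_int m * (1 / (2 * of_int m))) = -1"
    using False by (simp add: nome_def)
  with fourier_shift[of "\<lambda>_. c" m "1 / (2 * of_int m)"] False show ?thesis by simp
qed

text \<open>Write \<open>D z - D 0 = Q z * (nome z - 1)\<close>. The Fourier coefficients of the left-hand side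
  become differences of consecutive coefficients of \<open>Q\<close>, and those decay in both directions;
  so \<open>D 0\<close>, the sum of all the differences, is zero.\<close>

lemma fourier_eq_0_imp_eq_0_at_0:
  assumes hol: "D holomorphic_on UNIV" and per: "\<And>z. D (z + 1) = D z"
    and zero: "\<And>m. fourier m D = 0"
  shows "D 0 = 0"
proof -
  define f where "f = (\<lambda>z. D z - D 0)"
  define g where "g = (\<lambda>z. nome z - 1)"
  define q where "q = (\<lambda>z. if g z = 0 then deriv f z / deriv g z else f z / g z)"
  have dg: "deriv g z = 2 * of_real pi * \<i> * nome z" for z
    unfolding g_def by (rule DERIV_imp_deriv) (auto intro!: derivative_eq_intros)
  have hf: "f holomorphic_on UNIV" and hg: "g holomorphic_on UNIV"
    unfolding f_def g_def by (intro holomorphic_intros hol)+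
  have D_int: "D (z + of_int n) = D z" for z n
  proof (induction n rule: int_induct[of _ 0])
    case (step1 i) thus ?case using per[of "z + of_int i"] by (simp add: add.assoc)
  next
    case (step2 i) thus ?case using per[of "z + of_int (i - 1)"] by (simp add: add.assoc)
  qed simp
  have zeros: "f z = 0 \<and> deriv g z \<noteq> 0" if "g z = 0" for z
  proof -
    have "nome z = 1"
      using that by (simp add: g_def)
    then obtain n :: int where "z = of_int n"
      by (auto simp: nome_eq_1_iff)
    hence "D z = D 0" using D_int[of 0 n] by simp
    thus ?thesis by (simp add: dg f_def)
  qed
  have hq: "q holomorphic_on UNIV"
    unfolding q_def by (rule entire_quotient(1)[OF hf hg zeros])
  have qg: "q z * g z = f z" for z
    unfolding q_def by (rule entire_quotient(2)[OF hf hg zeros])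
  have "deriv f (z + 1) = deriv f z" for z
  proof -
    have "(f has_field_derivative deriv f (z + 1)) (at (z + 1))"
      using hf by (metis UNIV_I holomorphic_derivI open_UNIV)
    hence "((\<lambda>x. f (x + 1)) has_field_derivative deriv f (z + 1)) (at z)"
      by (simp add: DERIV_shift)
    thus ?thesis by (simp add: f_def per DERIV_imp_deriv)
  qed
  hence qper: "q (z + 1) = q z" for z
    by (simp add: q_def f_def g_def per dg[unfolded g_def])
  have diff: "fourier (m - 1) q - fourier m q = - (if m = 0 then D 0 else 0)" for m
  proof -
    have "fourier m f = - (if m = 0 then D 0 else 0)"
      unfolding f_def using fourier_diff[OF hol, of "\<lambda>_. D 0" m] zero by (simp add: fourier_const)
    moreover have "fourier m f = fourier m (\<lambda>z. q z * nome z) - fourier m q"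
    proof -
      have "f = (\<lambda>z. q z * nome z - q z)"
        by (simp add: fun_eq_iff g_def right_diff_distrib flip: qg)
      moreover have "(\<lambda>z. q z * nome z) holomorphic_on UNIV"
        by (intro holomorphic_intros hq)
      ultimately show ?thesis using fourier_diff[OF _ hq] by metis
    qed
    moreover have "fourier m (\<lambda>z. q z * nome z) = fourier (m - 1) q"
      by (simp add: fourier_def mult.assoc flip: nome_add) (simp add: algebra_simps)
    ultimately show ?thesis by simp
  qed
  obtain B where B: "B \<ge> 0" "\<And>m. norm (fourier m q) \<le> B * exp (- 2 * pi * \<bar>of_int m\<bar>)"
    using fourier_decay[OF hq qper] by blast
  have lim: "(\<lambda>n. B * exp (- 2 * pi * real (n + k))) \<longlonglongrightarrow> 0" for k by real_asymp
  have pos: "fourier (int n) q = fourier 0 q" for n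
  proof (induction n)
    case (Suc n) thus ?case using diff[of "int (Suc n)"] by simp
  qed simp
  have neg: "fourier (- 1 - int n) q = fourier (- 1) q" for n
  proof (induction n)
    case (Suc n) thus ?case using diff[of "- 1 - int n"] by (simp add: algebra_simps)
  qed simp
  have "norm (fourier 0 q) \<le> 0"
  proof (rule LIMSEQ_le_const[OF lim[of 0]], intro exI allI impI)
    show "norm (fourier 0 q) \<le> B * exp (- 2 * pi * real (n + 0))" for n
      using B(2)[of "int n"] by (simp add: pos)
  qed
  moreover have "norm (fourier (-1) q) \<le> 0"
  proof (rule LIMSEQ_le_const[OF lim[of 1]], intro exI allI impI)
    show "norm (fourier (- 1) q) \<le> B * exp (- 2 * pi * real (n + 1))" for n
      using B(2)[of "- 1 - int n"] by (simp add: neg add.commute)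
  qed
  ultimately show ?thesis using diff[of 0] by simp
qed

lemma entire_eq_0_if_fourier_eq_0:
  assumes hol: "D holomorphic_on UNIV" and per: "\<And>z. D (z + 1) = D z"
    and zero: "\<And>m. fourier m D = 0"
  shows "D w = 0"
proof -
  have "(\<lambda>z. D (z + w)) holomorphic_on UNIV"
    using holomorphic_on_compose_gen[OF _ hol, of "\<lambda>z. z + w" UNIV]
    by (simp add: o_def holomorphic_intros)
  moreover have "D (z + 1 + w) = D (z + w)" for z
    using per[of "z + w"] by (simp add: algebra_simps)
  moreover have "fourier m (\<lambda>z. D (z + w)) = 0" for m
    by (simp add: fourier_shift[OF hol per] zero)
  ultimately show ?thesis
    using fourier_eq_0_imp_eq_0_at_0[of "\<lambda>z. D (z + w)"] by simp
qed

section \<open>The inversion formula for theta series\<close>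

definition jacobi_term :: "complex \<Rightarrow> complex \<Rightarrow> int \<Rightarrow> complex" where
  "jacobi_term u z n = exp (- of_real pi * u * of_int n ^ 2) * nome (of_int n * z)"

definition jacobi :: "complex \<Rightarrow> complex \<Rightarrow> complex" where
  "jacobi u z = (\<Sum>\<^sub>\<infinity>n\<in>UNIV. jacobi_term u z n)"

lemma norm_exp_mult_square: "norm (exp (- of_real pi * u * of_int n ^ 2)) = exp (- pi * Re u * of_int n ^ 2)"
  by (simp flip: of_int_power)

lemma jacobi_term_bound:
  assumes "\<delta> \<le> Re u" "\<bar>Im z\<bar> \<le> R"
  shows "norm (jacobi_term u z n) \<le> exp (- (pi * \<delta>) * of_int n ^ 2 + 2 * pi * R * of_int \<bar>n\<bar>)"
proof -
  have "norm (jacobi_term u z n) = exp (- pi * Re u * of_int n ^ 2 + - 2 * pi * (of_int n * Im z))"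
    by (simp only: jacobi_term_def norm_mult norm_exp_mult_square norm_nome exp_add) simp
  also have "\<dots> \<le> exp (- (pi * \<delta>) * of_int n ^ 2 + 2 * pi * R * of_int \<bar>n\<bar>)"
  proof -
    have "pi * \<delta> * of_int n ^ 2 \<le> pi * Re u * of_int n ^ 2"
      using assms(1) by (intro mult_right_mono mult_left_mono) auto
    moreover have "- (of_int n * Im z) \<le> R * of_int \<bar>n\<bar>"
    proof -
      have "- (of_int n * Im z) \<le> of_int \<bar>n\<bar> * \<bar>Im z\<bar>"
        by (metis abs_ge_minus_self abs_mult of_int_abs)
      also have "\<dots> \<le> of_int \<bar>n\<bar> * R" by (intro mult_left_mono assms) auto
      finally show ?thesis by (simp add: mult.commute)
    qed
    hence "2 * pi * (- (of_int n * Im z)) \<le> 2 * pi * (R * of_int \<bar>n\<bar>)"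
      by (intro mult_left_mono) auto
    ultimately have "- (pi * Re u * of_int n ^ 2) + 2 * pi * (- (of_int n * Im z))
        \<le> - (pi * \<delta> * of_int n ^ 2) + 2 * pi * (R * of_int \<bar>n\<bar>)"
      by linarith
    thus ?thesis by (simp add: mult.assoc)
  qed
  finally show ?thesis .
qed

lemma jacobi_summable:
  assumes "Re u > 0"
  shows "jacobi_term u z summable_on UNIV"
proof -
  have "(\<lambda>n. norm (jacobi_term u z n)) summable_on UNIV"
  proof (rule Infinite_Sum.abs_summable_on_comparison_test')
    show "(\<lambda>n::int. exp (- (pi * Re u) * of_int n ^ 2 + 2 * pi * \<bar>Im z\<bar> * of_int \<bar>n\<bar>)) summable_on UNIV"
      by (rule summable_gaussian_int) (use assms in auto)
  qed (rule jacobi_term_bound, auto)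
  thus ?thesis by (rule abs_summable_summable)
qed

lemma jacobi_entire:
  assumes "Re u > 0"
  shows "jacobi u holomorphic_on UNIV"
  unfolding jacobi_def
proof (rule holomorphic_on_infsum)
  fix z
  have "\<bar>Im w\<bar> \<le> \<bar>Im z\<bar> + 1" if "w \<in> cball z 1" for w
    using that abs_Im_le_cmod[of "z - w"] by (simp add: dist_norm)
  hence "norm (jacobi_term u w n) \<le> exp (- (pi * Re u) * of_int n ^ 2 + 2 * pi * (\<bar>Im z\<bar> + 1) * of_int \<bar>n\<bar>)"
    if "w \<in> cball z 1" for w n
    using that by (intro jacobi_term_bound) auto
  moreover have "(\<lambda>n::int. exp (- (pi * Re u) * of_int n ^ 2 + 2 * pi * (\<bar>Im z\<bar> + 1) * of_int \<bar>n\<bar>))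
                   summable_on UNIV"
    by (rule summable_gaussian_int) (use assms in auto)
  ultimately show "\<exists>r>0. \<exists>M. cball z r \<subseteq> UNIV \<and> M summable_on UNIV \<and>
      (\<forall>n\<in>UNIV. \<forall>w\<in>cball z r. norm (jacobi_term u w n) \<le> M n)"
    by (intro exI[of _ 1] conjI exI) auto
qed (auto simp: jacobi_term_def intro!: holomorphic_intros)

lemma jacobi_holomorphic_left: "(\<lambda>u. jacobi u z) holomorphic_on {u. Re u > 0}"
  unfolding jacobi_def
proof (rule holomorphic_on_infsum)
  fix u assume "u \<in> {u. Re u > 0}"
  hence u: "Re u > 0" by simp
  have sub: "Re u / 2 \<le> Re w" if "w \<in> cball u (Re u / 2)" for w
    using that abs_Re_le_cmod[of "u - w"] by (simp add: dist_norm)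
  hence "norm (jacobi_term w z n) \<le> exp (- (pi * (Re u / 2)) * of_int n ^ 2 + 2 * pi * \<bar>Im z\<bar> * of_int \<bar>n\<bar>)"
    if "w \<in> cball u (Re u / 2)" for w n
    using that by (intro jacobi_term_bound) auto
  moreover have "(\<lambda>n::int. exp (- (pi * (Re u / 2)) * of_int n ^ 2 + 2 * pi * \<bar>Im z\<bar> * of_int \<bar>n\<bar>))
                   summable_on UNIV"
    by (rule summable_gaussian_int) (use u in auto)
  moreover have "cball u (Re u / 2) \<subseteq> {u. Re u > 0}"
    using sub u by force
  ultimately show "\<exists>r>0. \<exists>M. cball u r \<subseteq> {u. Re u > 0} \<and> M summable_on UNIV \<and>
      (\<forall>n\<in>UNIV. \<forall>w\<in>cball u r. norm (jacobi_term w z n) \<le> M n)"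
    using u by (intro exI[of _ "Re u / 2"] conjI exI) auto
qed (auto simp: jacobi_term_def intro!: holomorphic_intros)

lemma infsum_int_shift: "(\<Sum>\<^sub>\<infinity>n\<in>UNIV. f (n + k :: int)) = (\<Sum>\<^sub>\<infinity>n\<in>UNIV. f n)"
  by (rule infsum_reindex_bij_witness[of _ "\<lambda>n. n - k" "\<lambda>n. n + k"]) auto

lemma jacobi_add_of_int: "jacobi u (z + of_int k) = jacobi u z"
proof -
  have "jacobi_term u (z + of_int k) n = jacobi_term u z n" for n
    using nome_of_int[of "n * k"] by (simp add: jacobi_term_def ring_distribs nome_add)
  thus ?thesis by (simp add: jacobi_def)
qed

lemma jacobi_quasiperiodic: "jacobi u (z + \<i> * u) = exp (of_real pi * u) * nome (- z) * jacobi u z"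
proof -
  have "jacobi_term u (z + \<i> * u) n = exp (of_real pi * u) * nome (- z) * jacobi_term u z (n + 1)" for n
    by (simp add: jacobi_term_def nome_def power2_eq_square algebra_simps flip: exp_add)
  hence "jacobi u (z + \<i> * u) = (\<Sum>\<^sub>\<infinity>n\<in>UNIV. exp (of_real pi * u) * nome (- z) * jacobi_term u z (n + 1))"
    by (simp add: jacobi_def)
  also have "\<dots> = exp (of_real pi * u) * nome (- z) * jacobi u z"
    unfolding infsum_cmult_right' jacobi_def infsum_int_shift[of "jacobi_term u z" 1] ..
  finally show ?thesis .
qed

text \<open>The functional equation links consecutive Fourier coefficients, so these functions form a
  space of dimension one.\<close>

lemma quasiperiodic_fourier:
  assumes hol: "G holomorphic_on UNIV" and per: "\<And>z. G (z + 1) = G z"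
    and quasi: "\<And>z. G (z + \<i> * u) = exp (of_real pi * u) * nome (- z) * G z"
  shows "fourier m G = exp (- of_real pi * u * of_int m ^ 2) * fourier 0 G"
proof -
  have step: "fourier (m + 1) G = exp (- of_real pi * u * (2 * of_int m + 1)) * fourier m G" for m
  proof -
    have "nome (of_int m * (\<i> * u)) * fourier m G = fourier m (\<lambda>z. G (z + \<i> * u))"
      by (rule fourier_shift[OF hol per, symmetric])
    also have "\<dots> = fourier m (\<lambda>z. exp (of_real pi * u) * (nome (- z) * G z))"
      by (simp add: quasi mult.assoc)
    also have "\<dots> = exp (of_real pi * u) * fourier m (\<lambda>z. nome (- z) * G z)"
      by (intro fourier_cmult holomorphic_intros hol)
    also have "fourier m (\<lambda>z. nome (- z) * G z) = fourier (m + 1) G"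
      unfolding fourier_def
        by (intro arg_cong[of _ _ period_mean] ext) (simp add: mult_ac algebra_simps flip: nome_add)
    finally have "fourier (m + 1) G = nome (of_int m * (\<i> * u)) * exp (- of_real pi * u) * fourier m G"
      by (simp add: exp_minus field_simps)
    thus ?thesis
      by (simp add: nome_def exp_add[symmetric] algebra_simps)
  qed
  show ?thesis
  proof (induction m rule: int_induct[of _ 0])
    case (step1 i)
    thus ?case using step[of i]
      by (simp add: power2_eq_square algebra_simps flip: exp_add)
  next
    case (step2 i)
    have "fourier i G = exp (- of_real pi * u * (2 * of_int (i - 1) + 1)) * fourier (i - 1) G"
      using step[of "i - 1"] by simp
    hence "fourier (i - 1) G = exp (of_real pi * u * (2 * of_int (i - 1) + 1)) * fourier i G"
      by (simp flip: exp_add mult.assoc)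
    also have "\<dots> = exp (- of_real pi * u * of_int (i - 1) ^ 2) * fourier 0 G"
      unfolding step2.IH by (simp add: power2_eq_square algebra_simps flip: exp_add)
    finally show ?case .
  qed simp
qed

lemma quasiperiodic_unique:
  assumes F: "F holomorphic_on UNIV" "\<And>z. F (z + 1) = F z"
             "\<And>z. F (z + \<i> * u) = exp (of_real pi * u) * nome (- z) * F z"
      and G: "G holomorphic_on UNIV" "\<And>z. G (z + 1) = G z"
             "\<And>z. G (z + \<i> * u) = exp (of_real pi * u) * nome (- z) * G z"
  shows "fourier 0 F * G z = fourier 0 G * F z"
proof -
  define D where "D = (\<lambda>z. fourier 0 F * G z - fourier 0 G * F z)"
  have "D z = 0"
  proof (rule entire_eq_0_if_fourier_eq_0[of D])
    show "D holomorphic_on UNIV" unfolding D_def by (intro holomorphic_intros F G)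
    show "D (z + 1) = D z" for z by (simp add: D_def F G)
    show "fourier m D = 0" for m
    proof -
      have "fourier m D = fourier 0 F * fourier m G - fourier 0 G * fourier m F"
        unfolding D_def
        by (subst fourier_diff) (auto intro!: holomorphic_intros F G simp: fourier_cmult F G)
      thus ?thesis
        unfolding quasiperiodic_fourier[OF F, of m] quasiperiodic_fourier[OF G, of m] by simp
    qed
  qed
  thus ?thesis by (simp add: D_def)
qed

definition gaussian_sum :: "complex \<Rightarrow> complex \<Rightarrow> complex" where
  "gaussian_sum t z = (\<Sum>\<^sub>\<infinity>n\<in>UNIV. exp (- of_real pi * t * (of_int n + z) ^ 2))"

lemma norm_gaussian_term:
  "norm (exp (- of_real pi * w * (of_int n + of_real x) ^ 2)) = exp (- pi * Re w * (of_int n + x) ^ 2)"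
proof -
  have "(of_int n + of_real x :: complex) ^ 2 = of_real ((of_int n + x) ^ 2)" by simp
  hence "Re (- of_real pi * w * (of_int n + of_real x) ^ 2) = - pi * Re w * (of_int n + x) ^ 2"
    by (simp only:) simp
  thus ?thesis by (simp only: norm_exp_eq_Re)
qed

lemma gaussian_term_conv_jacobi_term:
  "exp (- of_real pi * t * (of_int n + z) ^ 2)
     = exp (- of_real pi * t * z ^ 2) * jacobi_term t (\<i> * t * z) n"
  by (simp add: jacobi_term_def nome_def power2_eq_square algebra_simps flip: exp_add)

lemma gaussian_sum_conv_jacobi:
  "gaussian_sum t z = exp (- of_real pi * t * z ^ 2) * jacobi t (\<i> * t * z)"
  unfolding gaussian_sum_def jacobi_def gaussian_term_conv_jacobi_term
  by (simp add: infsum_cmult_right')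

lemma gaussian_summable:
  "Re t > 0 \<Longrightarrow> (\<lambda>n. exp (- of_real pi * t * (of_int n + z) ^ 2)) summable_on (UNIV :: int set)"
  unfolding gaussian_term_conv_jacobi_term by (intro summable_on_cmult_right jacobi_summable)

lemma jacobi_real_pos:
  assumes "t > 0"
  obtains x where "x > 0" "jacobi (of_real t) 0 = of_real x"
proof -
  define f :: "int \<Rightarrow> real" where "f = (\<lambda>n. exp (- pi * t * of_int n ^ 2))"
  have f: "jacobi_term (of_real t) 0 n = of_real (f n)" for n
    by (simp add: jacobi_term_def f_def exp_of_real[symmetric])
  have "f summable_on UNIV"
    using summable_gaussian_int[of "pi * t" 0] assms by (simp add: f_def)
  then have fs: "(f has_sum infsum f UNIV) UNIV" by (rule has_sum_infsum)
  have "jacobi (of_real t) 0 = of_real (infsum f UNIV)"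
    unfolding jacobi_def f using has_sum_of_real[OF fs] by (rule infsumI)
  moreover have "infsum f UNIV \<ge> sum f {0}"
    by (rule finite_sum_le_infsum) (use fs in \<open>auto simp: f_def summable_on_def\<close>)
  hence "infsum f UNIV > 0" by (simp add: f_def)
  ultimately show ?thesis using that by blast
qed

text \<open>For real \<open>t\<close> both sides of the inversion formula lie in the same one-dimensional space, so
  they agree up to a factor that is determined by their values at \<open>0\<close>.\<close>

lemma gaussian_sum_proportional:
  assumes "t > 0"
  shows "gaussian_sum (of_real t) z
           = jacobi (of_real t) 0 / jacobi (of_real (1 / t)) 0 * jacobi (of_real (1 / t)) z"
proof -
  define u :: complex where "u = of_real (1 / t)"
  define F where "F = gaussian_sum (of_real t)"
  have tu: "of_real t * u = 1" and u: "Re u > 0" using assms by (auto simp: u_def)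
  have Fdef: "F z = exp (- of_real pi * of_real t * z ^ 2) * jacobi (of_real t) (\<i> * of_real t * z)" for z
    by (simp add: F_def gaussian_sum_conv_jacobi)
  have "jacobi (of_real t) \<circ> (\<lambda>z. \<i> * of_real t * z) holomorphic_on UNIV"
    by (rule holomorphic_on_compose_gen[OF _ jacobi_entire])
       (use assms in \<open>auto intro!: holomorphic_intros\<close>)
  hence F1: "F holomorphic_on UNIV"
    unfolding Fdef[abs_def] by (intro holomorphic_intros) (auto simp: o_def)
  have F2: "F (z + 1) = F z" for z
    unfolding F_def gaussian_sum_def
    using infsum_int_shift[of "\<lambda>n. exp (- of_real pi * of_real t * (of_int n + z) ^ 2)" 1]
    by (simp add: algebra_simps)
  have F3: "F (z + \<i> * u) = exp (of_real pi * u) * nome (- z) * F z" for z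
  proof -
    have "\<i> * of_real t * (z + \<i> * u) = \<i> * of_real t * z + of_int (-1)"
      using tu by (simp add: algebra_simps)
    moreover have "exp (- of_real pi * of_real t * (z + \<i> * u) ^ 2)
                     = exp (of_real pi * u) * nome (- z) * exp (- of_real pi * of_real t * z ^ 2)"
    proof -
      have "of_real t * (z + \<i> * u) ^ 2 = of_real t * z ^ 2 + 2 * \<i> * z * (of_real t * u) - u * (of_real t * u)"
        by (simp add: power2_eq_square algebra_simps)
      also have "\<dots> = of_real t * z ^ 2 + 2 * \<i> * z - u" by (simp add: tu)
      finally have e: "of_real t * (z + \<i> * u) ^ 2 = of_real t * z ^ 2 + 2 * \<i> * z - u" .
      have "- of_real pi * of_real t * (z + \<i> * u) ^ 2
          = of_real pi * u + 2 * of_real pi * \<i> * (- z) + - of_real pi * of_real t * z ^ 2"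
        unfolding mult.assoc[of "- of_real pi" "of_real t"] e by (simp add: algebra_simps)
      thus ?thesis unfolding nome_def by (simp only: exp_add)
    qed
    ultimately show ?thesis unfolding Fdef by (simp only: jacobi_add_of_int mult.assoc)
  qed
  have J: "jacobi u holomorphic_on UNIV" "\<And>z. jacobi u (z + 1) = jacobi u z"
    using jacobi_entire[OF u] jacobi_add_of_int[of u _ 1] by auto
  obtain x where x: "x > 0" "jacobi u 0 = of_real x"
    using jacobi_real_pos[of "1 / t"] assms by (auto simp: u_def)
  have "fourier 0 (jacobi u) \<noteq> 0"
  proof
    assume "fourier 0 (jacobi u) = 0"
    hence "fourier m (jacobi u) = 0" for m
      using quasiperiodic_fourier[OF J jacobi_quasiperiodic, of m] by simp
    from entire_eq_0_if_fourier_eq_0[OF J this, of 0] x show False by simp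
  qed
  moreover have eq: "fourier 0 F * jacobi u z = fourier 0 (jacobi u) * F z" for z
    by (rule quasiperiodic_unique[OF F1 F2 F3 J jacobi_quasiperiodic])
  ultimately have F: "F z = fourier 0 F / fourier 0 (jacobi u) * jacobi u z" for z
    by (simp add: field_simps)
  have "F 0 = jacobi (of_real t) 0" by (simp add: Fdef)
  with F[of 0] x have "fourier 0 F / fourier 0 (jacobi u) = jacobi (of_real t) 0 / jacobi u 0"
    by (simp add: field_simps)
  with F[of z] show ?thesis unfolding F_def u_def by metis
qed

lemma infsum_int_residue_classes:
  fixes f :: "int \<Rightarrow> complex"
  assumes "f summable_on UNIV" "N > 0"
  shows "(\<Sum>j<N. \<Sum>\<^sub>\<infinity>k\<in>UNIV. f (k * int N + int j)) = (\<Sum>\<^sub>\<infinity>n\<in>UNIV. f n)"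
proof -
  have bij: "bij_betw (\<lambda>(j, k). k * int N + int j) ({..<N} \<times> UNIV) UNIV"
    by (rule bij_betwI[where g = "\<lambda>n. (nat (n mod int N), n div int N)"])
       (use assms(2) in \<open>auto simp: nat_less_iff\<close>)
  have s: "(\<lambda>(j, k). f (k * int N + int j)) summable_on ({..<N} \<times> UNIV)"
    using summable_on_reindex_bij_betw[OF bij, of f] assms(1) by (simp add: case_prod_unfold)
  have "(\<Sum>j<N. \<Sum>\<^sub>\<infinity>k\<in>UNIV. f (k * int N + int j))
          = infsum (\<lambda>j. \<Sum>\<^sub>\<infinity>k\<in>UNIV. f (k * int N + int j)) {..<N}"
    by simp
  also have "\<dots> = infsum (\<lambda>(j, k). f (k * int N + int j)) ({..<N} \<times> UNIV)"
    by (rule infsum_Sigma'_banach[OF s])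
  also have "\<dots> = (\<Sum>\<^sub>\<infinity>n\<in>UNIV. f n)"
    using infsum_reindex_bij_betw[OF bij, of f] by (simp add: case_prod_unfold)
  finally show ?thesis .
qed

lemma infsum_sum_swap:
  fixes f :: "'a \<Rightarrow> 'b \<Rightarrow> complex"
  assumes "finite A" "\<And>a. a \<in> A \<Longrightarrow> f a summable_on B"
  shows "(\<Sum>a\<in>A. \<Sum>\<^sub>\<infinity>b\<in>B. f a b) = (\<Sum>\<^sub>\<infinity>b\<in>B. \<Sum>a\<in>A. f a b)"
proof -
  have "((\<lambda>b. \<Sum>a\<in>A. f a b) has_sum (\<Sum>a\<in>A. \<Sum>\<^sub>\<infinity>b\<in>B. f a b)) B"
    using assms
  proof (induction A rule: finite_induct)
    case (insert x F)
    thus ?case by (simp add: has_sum_add)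
  qed simp
  thus ?thesis by (rule infsumI[symmetric])
qed

lemma sum_nome_root_of_unity:
  assumes "N > 0"
  shows "(\<Sum>j<N. nome (of_int m * of_nat j / of_nat N)) = (if int N dvd m then of_nat N else 0)"
proof -
  define x where "x = nome (of_int m / of_nat N)"
  have x: "nome (of_int m * of_nat j / of_nat N) = x ^ j" for j
    by (simp add: x_def nome_power field_simps)
  have "x ^ N = 1" using assms by (simp add: x_def nome_power)
  have "x = 1 \<longleftrightarrow> (\<exists>n::int. (of_int m :: complex) = of_int (int N * n))"
    unfolding x_def nome_eq_1_iff using assms by (intro ex_cong1) (simp add: field_simps)
  hence x1: "x = 1 \<longleftrightarrow> int N dvd m"
    by (simp only: of_int_eq_iff dvd_def)
  show ?thesis
  proof (cases "x = 1")
    case True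
    thus ?thesis using x1 by (simp add: x)
  next
    case False
    hence "(\<Sum>j<N. x ^ j) = 0"
      using \<open>x ^ N = 1\<close> by (simp add: geometric_sum)
    thus ?thesis using False x1 by (simp add: x)
  qed
qed

text \<open>Adding up the proportionality over \<open>z = j / N\<close> compares the factors for \<open>t\<close> and
  \<open>t / N\<^sup>2\<close>; this pins down the factor for all squares of rationals without evaluating a Gaussian
  integral.\<close>

lemma inversion_factor_scale:
  assumes t: "t > 0" and N: "N > 0"
  defines "\<kappa> \<equiv> \<lambda>t. jacobi (of_real t) 0 / jacobi (of_real (1 / t)) 0"
  shows "\<kappa> (t / of_nat N ^ 2) = of_nat N * \<kappa> t"
proof -
  let ?u = "of_real (1 / t) :: complex" and ?s = "t / of_nat N ^ 2"
  have s: "?s > 0" using t N by simp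
  have "(\<Sum>j<N. gaussian_sum (of_real t) (of_nat j / of_nat N))
          = (\<Sum>j<N. \<Sum>\<^sub>\<infinity>k\<in>UNIV. jacobi_term (of_real ?s) 0 (k * int N + int j))"
  proof (intro sum.cong refl)
    fix j
    have "exp (- of_real pi * of_real t * (of_int k + of_nat j / of_nat N) ^ 2)
            = jacobi_term (of_real ?s) 0 (k * int N + int j)" for k
      using N by (simp add: jacobi_term_def field_simps)
    thus "gaussian_sum (of_real t) (of_nat j / of_nat N)
            = (\<Sum>\<^sub>\<infinity>k\<in>UNIV. jacobi_term (of_real ?s) 0 (k * int N + int j))"
      by (simp add: gaussian_sum_def)
  qed
  also have "\<dots> = jacobi (of_real ?s) 0"
    unfolding jacobi_def
    by (rule infsum_int_residue_classes[OF jacobi_summable N]) (use s in simp)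
  finally have lhs: "(\<Sum>j<N. gaussian_sum (of_real t) (of_nat j / of_nat N)) = jacobi (of_real ?s) 0" .
  have "(\<Sum>j<N. jacobi ?u (of_nat j / of_nat N))
          = (\<Sum>\<^sub>\<infinity>m\<in>UNIV. \<Sum>j<N. jacobi_term ?u (of_nat j / of_nat N) m)"
    unfolding jacobi_def by (rule infsum_sum_swap) (use t in \<open>auto intro: jacobi_summable\<close>)
  also have "\<dots> = (\<Sum>\<^sub>\<infinity>m\<in>UNIV. exp (- of_real pi * ?u * of_int m ^ 2) *
                     (if int N dvd m then of_nat N else 0))"
    using sum_nome_root_of_unity[OF N]
    by (simp add: jacobi_term_def sum_distrib_left[symmetric])
  also have "\<dots> = (\<Sum>\<^sub>\<infinity>m\<in>range (\<lambda>k. int N * k). of_nat N * exp (- of_real pi * ?u * of_int m ^ 2))"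
    by (rule infsum_cong_neutral) (auto simp: dvd_def)
  also have "\<dots> = (\<Sum>\<^sub>\<infinity>k\<in>UNIV. of_nat N * exp (- of_real pi * ?u * of_int (int N * k) ^ 2))"
    by (subst infsum_reindex) (use N in \<open>auto simp: inj_on_def o_def\<close>)
  also have "\<dots> = (\<Sum>\<^sub>\<infinity>k\<in>UNIV. of_nat N * jacobi_term (of_real (1 / ?s)) 0 k)"
    by (intro infsum_cong) (simp add: jacobi_term_def field_simps)
  also have "\<dots> = of_nat N * jacobi (of_real (1 / ?s)) 0"
    by (simp add: jacobi_def infsum_cmult_right')
  finally have rhs: "(\<Sum>j<N. jacobi ?u (of_nat j / of_nat N)) = of_nat N * jacobi (of_real (1 / ?s)) 0" .
  have "jacobi (of_real ?s) 0 = \<kappa> t * (of_nat N * jacobi (of_real (1 / ?s)) 0)"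
    unfolding lhs[symmetric] rhs[symmetric] gaussian_sum_proportional[OF t] \<kappa>_def
    by (simp add: sum_distrib_left)
  moreover have "jacobi (of_real (1 / ?s)) 0 \<noteq> 0"
    using jacobi_real_pos[of "1 / ?s"] s by (metis less_irrefl of_real_eq_0_iff zero_less_divide_1_iff)
  ultimately show ?thesis
    by (simp add: \<kappa>_def field_simps)
qed

lemma inversion_factor_rational_square:
  assumes p: "p > 0" and q: "q > 0"
  defines "t \<equiv> (real p / real q) ^ 2"
  shows "jacobi (of_real t) 0 / jacobi (of_real (1 / t)) 0 = of_nat q / of_nat p"
proof -
  define \<kappa> where "\<kappa> = (\<lambda>t. jacobi (of_real t) 0 / jacobi (of_real (1 / t)) 0)"
  have t: "t > 0" using p q by (simp add: t_def)
  have scale: "\<kappa> (t / of_nat N ^ 2) = of_nat N * \<kappa> t" if "t > 0" "N > 0" for t N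
    using inversion_factor_scale[OF that] by (simp add: \<kappa>_def)
  have "\<kappa> 1 = 1"
  proof -
    obtain x where "x > 0" "jacobi (of_real 1) 0 = of_real x"
      using jacobi_real_pos[of 1] zero_less_one by blast
    thus ?thesis by (simp add: \<kappa>_def)
  qed
  have "\<kappa> (t / of_nat p ^ 2) = of_nat p * \<kappa> t" by (rule scale[OF t p])
  moreover have "t / of_nat p ^ 2 = 1 / of_nat q ^ 2"
    using p by (simp add: t_def power_divide)
  moreover have "\<kappa> (1 / of_nat q ^ 2) = of_nat q"
    using scale[of 1 q] q \<open>\<kappa> 1 = 1\<close> by simp
  ultimately show ?thesis using p by (simp add: \<kappa>_def field_simps)
qed

text \<open>Both sides are holomorphic in \<open>t\<close> and agree at the squares of the rationals \<open>1 + 1 / n\<close>,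
  which accumulate at \<open>1\<close>.\<close>

theorem gaussian_sum_inversion:
  assumes "Re t > 0"
  shows "gaussian_sum t (of_real x) = jacobi (1 / t) (of_real x) / csqrt t"
proof -
  define S where "S = {t. Re t > 0}"
  define f where "f = (\<lambda>t. gaussian_sum t (of_real x) - jacobi (1 / t) (of_real x) / csqrt t)"
  define U where "U = range (\<lambda>n. of_real ((1 + 1 / real (Suc n)) ^ 2) :: complex)"
  have "f t = 0"
  proof (rule analytic_continuation[of f S U 1])
    show "open S" unfolding S_def by (rule open_halfspace_Re_gt)
    show "connected S" unfolding S_def
      by (intro convex_connected convex_halfspace_Re_gt)
    show "t \<in> S" using assms by (simp add: S_def)
    show "(1 :: complex) \<in> S" by (simp add: S_def)
    show "U \<subseteq> S"
    proof -
      have "(1 + 1 / real (Suc n)) ^ 2 > 0" for n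
        by (intro zero_less_power add_pos_nonneg) auto
      thus ?thesis by (auto simp: U_def S_def simp del: of_real_power)
    qed
    show "1 islimpt U"
      unfolding islimpt_sequential
    proof (intro exI conjI allI)
      show "of_real ((1 + 1 / real (Suc n)) ^ 2) \<in> U - {1}" for n
      proof -
        have "(1 + 1 / real (Suc n)) ^ 2 > 1" by (intro one_less_power) auto
        hence "(of_real ((1 + 1 / real (Suc n)) ^ 2) :: complex) \<noteq> of_real 1"
          unfolding of_real_eq_iff by linarith
        thus ?thesis unfolding U_def of_real_1 by blast
      qed
      have "(\<lambda>n. (1 + 1 / real (Suc n)) ^ 2) \<longlonglongrightarrow> 1" by real_asymp
      from tendsto_of_real[OF this, where 'a = complex]
      show "(\<lambda>n. of_real ((1 + 1 / real (Suc n)) ^ 2)) \<longlonglongrightarrow> (1 :: complex)"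
        unfolding of_real_1 .
    qed
    show "f z = 0" if zU: "z \<in> U" for z
    proof -
      obtain n where n: "z = of_real ((1 + 1 / real (Suc n)) ^ 2)"
        using zU unfolding U_def by blast
      define y where "y = real (Suc (Suc n)) / real (Suc n)"
      have y: "1 + 1 / real (Suc n) = y" "y > 0" by (simp_all add: y_def field_simps)
      have z: "z = of_real (y ^ 2)" by (simp only: n y)
      have "gaussian_sum (of_real (y ^ 2)) (of_real x)
              = of_nat (Suc n) / of_nat (Suc (Suc n)) * jacobi (of_real (1 / y ^ 2)) (of_real x)"
      proof -
        have "jacobi (of_real (y ^ 2)) 0 / jacobi (of_real (1 / y ^ 2)) 0
                = of_nat (Suc n) / of_nat (Suc (Suc n))"
          unfolding y_def by (rule inversion_factor_rational_square) auto
        thus ?thesis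
          using gaussian_sum_proportional[of "y ^ 2" "of_real x"] y(2) by (metis zero_less_power)
      qed
      moreover have "csqrt z = of_real y"
        unfolding z using y(2) by (simp add: of_real_sqrt[symmetric] csqrt_of_real_nonneg del: of_real_power)
      moreover have "of_nat (Suc n) / of_nat (Suc (Suc n)) = 1 / (of_real y :: complex)"
        by (simp add: y_def del: of_nat_Suc)
      moreover have "1 / z = of_real (1 / y ^ 2)" by (simp add: z)
      ultimately have "gaussian_sum z (of_real x) = 1 / of_real y * jacobi (1 / z) (of_real x)"
        "csqrt z = of_real y"
        by (simp_all only: z)
      thus ?thesis by (simp add: f_def)
    qed
    have h1: "(\<lambda>t. gaussian_sum t (of_real x)) holomorphic_on S"
      unfolding gaussian_sum_def
    proof (rule holomorphic_on_infsum)
      fix u assume "u \<in> S"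
      hence u: "Re u > 0" by (simp add: S_def)
      have sub: "Re u / 2 \<le> Re w" if "w \<in> cball u (Re u / 2)" for w
        using that abs_Re_le_cmod[of "u - w"] by (simp add: dist_norm)
      have "norm (exp (- of_real pi * w * (of_int n + of_real x) ^ 2))
              \<le> exp (- pi * (Re u / 2) * (of_int n + x) ^ 2)"
        if "w \<in> cball u (Re u / 2)" for w n
      proof -
        have "pi * (Re u / 2) * (of_int n + x) ^ 2 \<le> pi * Re w * (of_int n + x) ^ 2"
          by (intro mult_right_mono mult_left_mono sub[OF that]) auto
        thus ?thesis unfolding norm_gaussian_term by simp
      qed
      moreover have "(\<lambda>n. exp (- pi * (Re u / 2) * (of_int n + x) ^ 2)) summable_on (UNIV :: int set)"
      proof -
        have "(\<lambda>n. norm (exp (- of_real pi * of_real (Re u / 2) * (of_int n + of_real x) ^ 2) :: complex))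
                summable_on (UNIV :: int set)"
          using gaussian_summable[of "of_real (Re u / 2)" "of_real x"] u
          by (subst summable_on_iff_abs_summable_on_complex[symmetric]) simp
        thus ?thesis unfolding norm_gaussian_term by simp
      qed
      moreover have "cball u (Re u / 2) \<subseteq> S"
        using sub u by (force simp: S_def)
      ultimately show "\<exists>r>0. \<exists>M. cball u r \<subseteq> S \<and> M summable_on UNIV \<and>
          (\<forall>n\<in>UNIV. \<forall>w\<in>cball u r. norm (exp (- of_real pi * w * (of_int n + of_real x) ^ 2)) \<le> M n)"
        using u by (intro exI[of _ "Re u / 2"] conjI exI) auto
    qed (auto intro!: holomorphic_intros)
    have "(\<lambda>u. jacobi u (of_real x)) \<circ> (\<lambda>t. 1 / t) holomorphic_on S"
      by (rule holomorphic_on_compose_gen[OF _ jacobi_holomorphic_left])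
         (auto simp: S_def Re_divide intro!: holomorphic_intros divide_pos_pos add_pos_nonneg)
    hence h2: "(\<lambda>t. jacobi (1 / t) (of_real x)) holomorphic_on S" by (simp add: o_def)
    show "f holomorphic_on S"
      unfolding f_def
      by (intro holomorphic_intros h1 h2)
         (auto simp: S_def complex_nonpos_Reals_iff)
  qed
  thus ?thesis by (simp add: f_def)
qed

text \<open>For \<open>\<phi> = 1\<close> this becomes \<open>theta\<close>, and for \<open>\<phi> = chi12\<close> twice the eta function.\<close>

definition theta_series :: "(int \<Rightarrow> complex) \<Rightarrow> complex \<Rightarrow> complex" where
  "theta_series \<phi> t = (\<Sum>\<^sub>\<infinity>n\<in>UNIV. \<phi> n * exp (- of_real pi * of_int n ^ 2 * t))"

lemma theta_series_summable:
  assumes "Re t > 0" "\<And>n. norm (\<phi> n) \<le> B"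
  shows "(\<lambda>n. \<phi> n * exp (- of_real pi * of_int n ^ 2 * t)) summable_on UNIV"
proof -
  have "(\<lambda>n. norm (\<phi> n * exp (- of_real pi * of_int n ^ 2 * t))) summable_on UNIV"
  proof (rule Infinite_Sum.abs_summable_on_comparison_test')
    show "(\<lambda>n. B * exp (- (pi * Re t) * of_int n ^ 2 + 0 * of_int \<bar>n\<bar>)) summable_on (UNIV :: int set)"
      by (intro summable_on_cmult_right summable_gaussian_int) (use assms in auto)
    show "norm (\<phi> n * exp (- of_real pi * of_int n ^ 2 * t))
            \<le> B * exp (- (pi * Re t) * of_int n ^ 2 + 0 * of_int \<bar>n\<bar>)" for n
      using assms(2)[of n] norm_exp_mult_square[of t n]
      by (simp add: norm_mult mult_ac mult_left_mono)
  qed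
  thus ?thesis by (rule abs_summable_summable)
qed

lemma periodic_mod:
  fixes \<phi> :: "int \<Rightarrow> 'a"
  assumes "\<And>n. \<phi> (n + M) = \<phi> n"
  shows "\<phi> (n + k * M) = \<phi> n" and "\<phi> (n mod M) = \<phi> n"
proof -
  show *: "\<phi> (n + k * M) = \<phi> n" for n k
  proof (induction k rule: int_induct[of _ 0])
    case (step1 i)
    thus ?case using assms[of "n + i * M"] by (simp add: algebra_simps)
  next
    case (step2 i)
    thus ?case using assms[of "n + (i - 1) * M"] by (simp add: algebra_simps)
  qed simp
  show "\<phi> (n mod M) = \<phi> n"
    using *[of "n mod M" "n div M"] by (simp add: mult.commute)
qed

lemma periodic_bounded:
  fixes \<phi> :: "int \<Rightarrow> complex"
  assumes "M > 0" "\<And>n. \<phi> (n + M) = \<phi> n"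
  obtains B where "\<And>n. norm (\<phi> n) \<le> B"
proof -
  have "norm (\<phi> n) \<le> (\<Sum>r\<in>{0..<M}. norm (\<phi> r))" for n
  proof -
    have "norm (\<phi> (n mod M)) \<le> (\<Sum>r\<in>{0..<M}. norm (\<phi> r))"
      using assms(1) by (intro member_le_sum) auto
    thus ?thesis by (simp add: periodic_mod(2)[of \<phi>, OF assms(2)])
  qed
  thus ?thesis using that by blast
qed

lemma csqrt_scale:
  assumes "r > 0"
  shows "csqrt (of_real r * z) = of_real (sqrt r) * csqrt z"
  using assms csqrt_principal[of z]
  by (intro csqrt_unique) (auto simp: power_mult_distrib simp flip: of_real_power)

lemma Re_one_over_pos: "Re z > 0 \<Longrightarrow> Re (1 / z) > 0"
  by (simp add: Re_divide) (intro divide_pos_pos add_pos_nonneg, auto)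

definition finite_fourier :: "nat \<Rightarrow> (int \<Rightarrow> complex) \<Rightarrow> int \<Rightarrow> complex" where
  "finite_fourier M \<phi> m = (\<Sum>r<M. \<phi> (int r) * nome (of_int m * of_nat r / of_nat M))"

text \<open>Split the series by the residue of the summation index modulo the period and apply the
  inversion formula to every shifted Gaussian sum.\<close>

theorem theta_series_inversion:
  assumes M: "M > 0" and per: "\<And>n. \<phi> (n + int M) = \<phi> n" and t: "Re t > 0"
  shows "theta_series \<phi> t
           = theta_series (finite_fourier M \<phi>) (1 / (of_nat M ^ 2 * t)) / (of_nat M * csqrt t)"
proof -
  let ?s = "of_nat M ^ 2 * t"
  have Re_s: "Re ?s > 0" using M t by (simp flip: of_nat_power)
  have Re_inv: "Re (1 / ?s) > 0"
    by (rule Re_one_over_pos[OF Re_s])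
  obtain B where B: "\<And>n. norm (\<phi> n) \<le> B"
    using periodic_bounded[of "int M" \<phi>] M per by auto
  have sqrt: "csqrt ?s = of_nat M * csqrt t"
    using csqrt_scale[of "real M ^ 2" t] M by simp
  have "theta_series \<phi> t
          = (\<Sum>j<M. \<Sum>\<^sub>\<infinity>k\<in>UNIV. \<phi> (k * int M + int j) * exp (- of_real pi * of_int (k * int M + int j) ^ 2 * t))"
    unfolding theta_series_def
    by (rule infsum_int_residue_classes[OF theta_series_summable M, symmetric]) (fact t B)+
  also have "\<dots> = (\<Sum>j<M. \<phi> (int j) * gaussian_sum ?s (of_real (real j / real M)))"
  proof (intro sum.cong refl)
    fix j
    have "\<phi> (k * int M + int j) = \<phi> (int j)" for k
      using periodic_mod(1)[of \<phi> "int M", OF per, of "int j" k] by (simp add: add.commute)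
    moreover have "exp (- of_real pi * of_int (k * int M + int j) ^ 2 * t)
            = exp (- of_real pi * ?s * (of_int k + of_real (real j / real M)) ^ 2)" for k
      using M by (simp add: field_simps)
    ultimately show "(\<Sum>\<^sub>\<infinity>k\<in>UNIV. \<phi> (k * int M + int j) * exp (- of_real pi * of_int (k * int M + int j) ^ 2 * t))
        = \<phi> (int j) * gaussian_sum ?s (of_real (real j / real M))"
      by (simp only: gaussian_sum_def infsum_cmult_right')
  qed
  also have "\<dots> = (\<Sum>j<M. \<phi> (int j) * (jacobi (1 / ?s) (of_real (real j / real M)) / (of_nat M * csqrt t)))"
    by (simp only: gaussian_sum_inversion[OF Re_s] sqrt)
  also have "\<dots> = (\<Sum>j<M. \<Sum>\<^sub>\<infinity>m\<in>UNIV. \<phi> (int j) * jacobi_term (1 / ?s) (of_real (real j / real M)) m) / (of_nat M * csqrt t)"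
    by (simp add: jacobi_def infsum_cmult_right' sum_divide_distrib)
  also have "(\<Sum>j<M. \<Sum>\<^sub>\<infinity>m\<in>UNIV. \<phi> (int j) * jacobi_term (1 / ?s) (of_real (real j / real M)) m)
      = (\<Sum>\<^sub>\<infinity>m\<in>UNIV. \<Sum>j<M. \<phi> (int j) * jacobi_term (1 / ?s) (of_real (real j / real M)) m)"
    by (rule infsum_sum_swap) (auto intro!: summable_on_cmult_right jacobi_summable Re_inv simp del: of_nat_power)
  also have "\<dots> = theta_series (finite_fourier M \<phi>) (1 / ?s)"
    unfolding theta_series_def
  proof (rule infsum_cong)
    fix m :: int
    have "(\<Sum>j<M. \<phi> (int j) * jacobi_term (1 / ?s) (of_real (real j / real M)) m)
       = exp (- of_real pi * (1 / ?s) * of_int m ^ 2) * finite_fourier M \<phi> m"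
      unfolding jacobi_term_def finite_fourier_def sum_distrib_left
      by (intro sum.cong refl) simp
    also have "\<dots> = finite_fourier M \<phi> m * exp (- of_real pi * of_int m ^ 2 * (1 / ?s))"
      by (simp add: mult_ac)
    finally show "(\<Sum>j<M. \<phi> (int j) * jacobi_term (1 / ?s) (of_real (real j / real M)) m)
       = finite_fourier M \<phi> m * exp (- of_real pi * of_int m ^ 2 * (1 / ?s))" .
  qed
  finally show ?thesis .
qed

text \<open>A real shift of the argument multiplies the coefficients by roots of unity.\<close>

lemma theta_series_shift:
  "theta_series \<phi> (t - 2 * \<i> * of_real x)
     = theta_series (\<lambda>n. \<phi> n * nome (of_int n ^ 2 * of_real x)) t"
  unfolding theta_series_def
  by (intro infsum_cong) (simp add: nome_def algebra_simps flip: exp_add)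

section \<open>The quadratic character modulo 12\<close>

lemma Legendre_cong: "[a = b] (mod p) \<Longrightarrow> Legendre a p = Legendre b p"
  by (simp add: Legendre_def QuadRes_def cong_def)

lemma Legendre_values: "Legendre a p \<in> {-1, 0, 1}"
  by (simp add: Legendre_def)

lemma Legendre_mult:
  assumes "prime l" "2 < l"
  shows "Legendre (a * b) (int l) = Legendre a (int l) * Legendre b (int l)"
proof -
  have "[Legendre (a * b) (int l) = (a * b) ^ ((l - 1) div 2)] (mod int l)"
    using euler_criterion[OF assms] by simp
  also have "[(a * b) ^ ((l - 1) div 2) = Legendre a (int l) * Legendre b (int l)] (mod int l)"
    unfolding power_mult_distrib
    using euler_criterion[OF assms] by (intro cong_mult) (auto intro: cong_sym)
  finally have "int l dvd Legendre (a * b) (int l) - Legendre a (int l) * Legendre b (int l)"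
    by (simp add: cong_iff_dvd_diff)
  moreover have "\<bar>Legendre (a * b) (int l) - Legendre a (int l) * Legendre b (int l)\<bar> \<le> 2"
    using Legendre_values[of "a * b" "int l"] Legendre_values[of a "int l"] Legendre_values[of b "int l"]
    by auto
  ultimately show ?thesis
    using assms(2) dvd_imp_le_int[of "Legendre (a * b) (int l) - Legendre a (int l) * Legendre b (int l)" "int l"]
    by fastforce
qed

lemma Legendre_self_square:
  assumes "\<not> int l dvd a"
  shows "Legendre a (int l) * Legendre a (int l) = 1"
  using assms by (simp add: Legendre_def cong_0_iff)

lemma Legendre_square:
  assumes "prime l" "2 < l" "\<not> int l dvd a"
  shows "Legendre (a ^ 2) (int l) = 1"
  using Legendre_mult[OF assms(1,2), of a a] Legendre_self_square[OF assms(3)]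
  by (simp add: power2_eq_square)

lemma Legendre_power:
  assumes "prime l" "2 < l"
  shows "Legendre (a ^ n) (int l) = Legendre a (int l) ^ n"
proof (induction n)
  case 0
  thus ?case using assms Legendre_square[OF assms, of 1] by (auto simp: zdvd1_eq)
next
  case (Suc n)
  thus ?case by (simp add: Legendre_mult[OF assms])
qed

definition mod12_char :: "int \<Rightarrow> int" where
  "mod12_char n = (if n mod 12 \<in> {1, 11} then 1 else if n mod 12 \<in> {5, 7} then - 1 else 0)"

lemma mod12_char_mod: "mod12_char (n mod 12) = mod12_char n"
  by (simp add: mod12_char_def)

lemma mod12_char_cases:
  fixes n :: int
  obtains "n mod 12 = 0" | "n mod 12 = 1" | "n mod 12 = 2" | "n mod 12 = 3" | "n mod 12 = 4"
    | "n mod 12 = 5" | "n mod 12 = 6" | "n mod 12 = 7" | "n mod 12 = 8" | "n mod 12 = 9"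
    | "n mod 12 = 10" | "n mod 12 = 11"
proof -
  have "n mod 12 = 0 \<or> n mod 12 = 1 \<or> n mod 12 = 2 \<or> n mod 12 = 3 \<or> n mod 12 = 4 \<or> n mod 12 = 5 \<or>
        n mod 12 = 6 \<or> n mod 12 = 7 \<or> n mod 12 = 8 \<or> n mod 12 = 9 \<or> n mod 12 = 10 \<or> n mod 12 = 11"
    by presburger
  thus ?thesis by (elim disjE) (fact that)+
qed

lemma coprime_12_cases:
  fixes n :: int
  assumes "\<not> 2 dvd n" "\<not> 3 dvd n"
  obtains "n mod 12 = 1" | "n mod 12 = 5" | "n mod 12 = 7" | "n mod 12 = 11"
  using assms by (cases rule: mod12_char_cases[of n]) presburger+

lemma mod12_char_mult: "mod12_char (m * n) = mod12_char m * mod12_char n"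
proof -
  have table: "mod12_char (a * b) = mod12_char a * mod12_char b"
    if "a \<in> {0,1,2,3,4,5,6,7,8,9,10,11}" "b \<in> {0,1,2,3,4,5,6,7,8,9,10,11}" for a b
    using that by (elim insertE emptyE; simp add: mod12_char_def)
  have mem: "k mod 12 \<in> {0,1,2,3,4,5,6,7,8,9,10,11}" for k :: int
    by (rule mod12_char_cases[of k]) simp_all
  have "mod12_char (m * n) = mod12_char ((m mod 12) * (n mod 12))"
    by (metis mod12_char_mod mod_mult_eq)
  also have "\<dots> = mod12_char (m mod 12) * mod12_char (n mod 12)"
    by (rule table[OF mem mem])
  finally show ?thesis by (simp only: mod12_char_mod)
qed

lemma mod12_char_minus: "mod12_char (- n) = mod12_char n"
  using mod12_char_mult[of "-1" n] by (simp add: mod12_char_def)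

text \<open>Quadratic reciprocity for the pair \<open>3, p\<close> turns \<open>(12/p) = (3/p)\<close> into a
  condition on \<open>p\<close> modulo \<open>12\<close>.\<close>

lemma kronecker_prime_12:
  assumes p: "prime p"
  shows "kronecker_prime 12 p = mod12_char (int p)"
proof (cases "p = 2 \<or> p = 3")
  case True
  thus ?thesis by (auto simp: kronecker_prime_def mod12_char_def Legendre_def cong_def)
next
  case False
  have p5: "p > 3" using False prime_ge_2_nat[OF p] by auto
  have n3: "\<not> 3 dvd p" "\<not> 2 dvd p"
    using p False primes_dvd_imp_eq[of 3 p] primes_dvd_imp_eq[of 2 p] by auto
  have n2: "\<not> int p dvd 2"
    using p5 zdvd_imp_le[of "int p" 2] by auto
  have "Legendre 12 (int p) = Legendre (2 ^ 2) (int p) * Legendre 3 (int p)"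
    using Legendre_mult[OF p, of "2 ^ 2" 3] p5 by simp
  also have "Legendre (2 ^ 2) (int p) = 1"
    using p p5 n2 by (intro Legendre_square) auto
  finally have L12: "Legendre 12 (int p) = Legendre 3 (int p)" by simp
  have QR: "Legendre (int 3) (int p) * Legendre (int p) (int 3) = (-1) ^ ((3 - 1) div 2 * ((p - 1) div 2))"
    using p p5 by (intro Quadratic_Reciprocity) auto
  have sq: "[y ^ 2 = 0] (mod 3) \<or> [y ^ 2 = 1] (mod 3)" for y :: int
  proof -
    have "y mod 3 = 0 \<or> y mod 3 = 1 \<or> y mod 3 = 2" by auto
    thus ?thesis
      by (elim disjE) (simp_all add: cong_def power2_eq_square mod_mult_eq[of y 3 y, symmetric])
  qed
  have L3: "Legendre (int p) (int 3) = (if p mod 3 = 1 then 1 else - 1)"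
  proof -
    have "int p mod 3 = 1 \<or> int p mod 3 = 2"
      using n3(1) by presburger
    thus ?thesis
    proof
      assume *: "int p mod 3 = 1"
      hence "[1 ^ 2 = int p] (mod 3)" by (simp add: cong_def)
      hence "QuadRes 3 (int p)" unfolding QuadRes_def by blast
      moreover have "p mod 3 = 1" using * by presburger
      ultimately show ?thesis using * by (simp add: Legendre_def cong_def)
    next
      assume *: "int p mod 3 = 2"
      have "\<not> QuadRes 3 (int p)"
      proof
        assume "QuadRes 3 (int p)"
        then obtain y where "[y ^ 2 = int p] (mod 3)" by (auto simp: QuadRes_def)
        with sq[of y] * show False by (auto simp: cong_def)
      qed
      moreover have "p mod 3 \<noteq> 1" using * by presburger
      ultimately show ?thesis using * by (simp add: Legendre_def cong_def)
    qed
  qed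
  have par: "(-1 :: int) ^ ((p - 1) div 2) = (if p mod 4 = 1 then 1 else - 1)"
  proof (cases "p mod 4 = 1")
    case True
    hence "even ((p - 1) div 2)" by presburger
    thus ?thesis using True by simp
  next
    case F: False
    hence "odd ((p - 1) div 2)" using n3(2) by presburger
    thus ?thesis using F by simp
  qed
  have "Legendre 3 (int p) = (-1) ^ ((p - 1) div 2) * Legendre (int p) (int 3)"
    using QR L3 by (auto split: if_splits)
  hence "Legendre 12 (int p) = (if p mod 4 = 1 then 1 else - 1) * (if p mod 3 = 1 then 1 else - 1)"
    unfolding L12 par L3 .
  also have "\<dots> = mod12_char (int p)"
  proof -
    have m: "p mod 4 = (p mod 12) mod 4" "p mod 3 = (p mod 12) mod 3"
      by (simp_all add: mod_mod_cancel)
    have e: "int p mod 12 = int (p mod 12)" by (simp add: zmod_int)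
    have "\<not> 2 dvd int p" "\<not> 3 dvd int p" using n3 by presburger+
    hence "p mod 12 = 1 \<or> p mod 12 = 5 \<or> p mod 12 = 7 \<or> p mod 12 = 11"
      by (rule coprime_12_cases) (simp_all add: e)
    thus ?thesis
      unfolding m mod12_char_def e by (elim disjE) simp_all
  qed
  finally show ?thesis using False by (simp add: kronecker_prime_def)
qed

lemma chi12_eq: "chi12 n = of_int (mod12_char n)"
proof (cases "n = 0")
  case True
  thus ?thesis by (simp add: chi12_def kronecker_def mod12_char_def)
next
  case False
  define N where "N = nat \<bar>n\<bar>"
  have N: "N > 0" using False by (simp add: N_def)
  have pow: "mod12_char (a ^ k) = mod12_char a ^ k" for a k
    by (induction k) (simp_all add: mod12_char_mult, simp add: mod12_char_def)
  have prod: "mod12_char (\<Prod>p\<in>A. f p) = (\<Prod>p\<in>A. mod12_char (f p))" if "finite A" for A :: "nat set" and f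
    using that by (induction A rule: finite_induct) (simp_all add: mod12_char_mult, simp add: mod12_char_def)
  have "kronecker 12 n = (\<Prod>p\<in>prime_factors N. kronecker_prime 12 p ^ multiplicity p N)"
    using False by (simp add: kronecker_def N_def)
  also have "\<dots> = (\<Prod>p\<in>prime_factors N. mod12_char (int p ^ multiplicity p N))"
    by (intro prod.cong refl) (auto simp: kronecker_prime_12 pow in_prime_factors_iff)
  also have "\<dots> = mod12_char (\<Prod>p\<in>prime_factors N. int p ^ multiplicity p N)"
    by (simp add: prod)
  also have "(\<Prod>p\<in>prime_factors N. int p ^ multiplicity p N) = int N"
  proof -
    have "int N = int (\<Prod>p\<in>prime_factors N. p ^ multiplicity p N)"
      using N by (subst prime_factorization_nat[symmetric]) auto
    thus ?thesis by simp
  qed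
  also have "mod12_char (int N) = mod12_char n"
    by (cases "n \<ge> 0") (simp_all add: N_def mod12_char_minus)
  finally show ?thesis by (simp add: chi12_def)
qed

lemma chi12_mult: "chi12 (m * n) = chi12 m * chi12 n"
  by (simp add: chi12_eq mod12_char_mult)

lemma chi12_minus [simp]: "chi12 (- n) = chi12 n"
  by (simp add: chi12_eq mod12_char_minus)

lemma chi12_add_12 [simp]: "chi12 (n + 12) = chi12 n"
  by (simp add: chi12_eq mod12_char_def)

lemma chi12_add_mult_12: "12 dvd k \<Longrightarrow> chi12 (n + k) = chi12 n"
  by (auto simp: chi12_eq mod12_char_def dvd_def)

lemma chi12_0 [simp]: "chi12 0 = 0" and chi12_1 [simp]: "chi12 1 = 1"
  by (simp_all add: chi12_eq mod12_char_def)

lemma norm_chi12_le: "norm (chi12 n) \<le> 1"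
  by (simp add: chi12_eq mod12_char_def)

lemma chi12_self_square:
  assumes "\<not> 2 dvd n" "\<not> 3 dvd n"
  shows "chi12 n * chi12 n = 1"
  by (rule coprime_12_cases[OF assms]) (simp_all add: chi12_eq mod12_char_def)

section \<open>Exponential sums over residues\<close>

lemma sum_periodic_reindex:
  fixes F :: "int \<Rightarrow> complex"
  assumes c: "c > 0" and per: "\<And>n. F (n + int c) = F n"
    and inj: "\<And>x y. [\<pi> x = \<pi> y] (mod int c) \<Longrightarrow> [x = y] (mod int c)"
  shows "(\<Sum>x<c. F (\<pi> (int x))) = (\<Sum>x<c. F (int x))"
proof -
  define g where "g = (\<lambda>x. nat (\<pi> (int x) mod int c))"
  have g: "int (g x) = \<pi> (int x) mod int c" for x using c by (simp add: g_def)
  have "inj_on g {..<c}"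
  proof (rule inj_onI)
    fix x y assume xy: "x \<in> {..<c}" "y \<in> {..<c}" "g x = g y"
    hence "[\<pi> (int x) = \<pi> (int y)] (mod int c)"
      using g[of x] g[of y] by (simp add: cong_def)
    from inj[OF this] xy(1,2) show "x = y"
      by (simp add: cong_def flip: of_nat_mod)
  qed
  moreover have "g ` {..<c} \<subseteq> {..<c}"
    using c by (auto simp: g_def nat_less_iff)
  ultimately have bij: "bij_betw g {..<c} {..<c}"
    by (simp add: bij_betw_def endo_inj_surj)
  have "F (\<pi> (int x)) = F (int (g x))" for x
    using periodic_mod(2)[of F "int c", OF per] by (simp add: g)
  hence "(\<Sum>x<c. F (\<pi> (int x))) = (\<Sum>x<c. F (int (g x)))" by simp
  also have "\<dots> = (\<Sum>x<c. F (int x))" by (rule sum.reindex_bij_betw[OF bij])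
  finally show ?thesis .
qed

lemma sum_periodic_shift:
  fixes F :: "int \<Rightarrow> complex"
  assumes "c > 0" "\<And>n. F (n + int c) = F n"
  shows "(\<Sum>x<c. F (int x + k)) = (\<Sum>x<c. F (int x))"
  by (rule sum_periodic_reindex[where F = F and \<pi> = "\<lambda>x. x + k"])
     (use assms in \<open>auto simp: cong_add_rcancel\<close>)

lemma sum_periodic_dilate:
  fixes F :: "int \<Rightarrow> complex"
  assumes "c > 0" "\<And>n. F (n + int c) = F n" "coprime k (int c)"
  shows "(\<Sum>x<c. F (k * int x)) = (\<Sum>x<c. F (int x))"
  by (rule sum_periodic_reindex[where F = F and \<pi> = "\<lambda>x. k * x"])
     (use assms in \<open>auto simp: cong_mult_lcancel\<close>)

lemma sum_periodic_CRT:
  fixes F :: "int \<Rightarrow> complex"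
  assumes M: "M > 0" and c: "c > 0" and per: "\<And>n. F (n + int (M * c)) = F n"
    and cop: "coprime (int M) (int c)"
  shows "(\<Sum>r<M * c. F (int r)) = (\<Sum>u<M. \<Sum>v<c. F (int c * int u + int M * int v))"
proof -
  define g where "g = (\<lambda>(u, v). nat ((int c * int u + int M * int v) mod int (M * c)))"
  have Mc: "int (M * c) > 0" using M c by (simp del: of_nat_mult)
  have g: "int (g (u, v)) = (int c * int u + int M * int v) mod int (M * c)" for u v
    using Mc by (simp add: g_def)
  have "inj_on g ({..<M} \<times> {..<c})"
  proof (rule inj_onI, clarsimp)
    fix u v u' v' assume uv: "u < M" "v < c" "u' < M" "v' < c" "g (u, v) = g (u', v')"
    have *: "[int c * int u + int M * int v = int c * int u' + int M * int v'] (mod int (M * c))"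
      using g[of u v] g[of u' v'] uv(5) by (simp add: cong_def)
    have "[int c * int u + int M * int v = int c * int u' + int M * int v'] (mod int M)"
      by (rule cong_dvd_modulus[OF *]) simp
    hence "[int c * int u = int c * int u'] (mod int M)"
      by (simp add: cong_def)
    hence "[int u = int u'] (mod int M)"
      using cop by (simp add: cong_mult_lcancel coprime_commute)
    hence "u = u'" using uv by (simp add: cong_def flip: of_nat_mod)
    have "[int c * int u + int M * int v = int c * int u' + int M * int v'] (mod int c)"
      by (rule cong_dvd_modulus[OF *]) simp
    hence "[int M * int v = int M * int v'] (mod int c)"
      by (simp add: cong_def)
    hence "[int v = int v'] (mod int c)"
      using cop by (simp add: cong_mult_lcancel coprime_commute)
    hence "v = v'" using uv by (simp add: cong_def flip: of_nat_mod)
    with \<open>u = u'\<close> show "u = u' \<and> v = v'" by simp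
  qed
  moreover have "g ` ({..<M} \<times> {..<c}) \<subseteq> {..<M * c}"
    using Mc by (auto simp: g_def nat_less_iff simp del: of_nat_mult)
  ultimately have bij: "bij_betw g ({..<M} \<times> {..<c}) {..<M * c}"
    unfolding bij_betw_def by (simp add: card_subset_eq card_image card_cartesian_product)
  have "(\<Sum>r<M * c. F (int r)) = (\<Sum>p\<in>{..<M} \<times> {..<c}. F (int (g p)))"
    by (rule sum.reindex_bij_betw[OF bij, symmetric])
  also have "\<dots> = (\<Sum>(u, v)\<in>{..<M} \<times> {..<c}. F (int c * int u + int M * int v))"
    using periodic_mod(2)[of F "int (M * c)", OF per]
    by (intro sum.cong refl) (auto simp: g simp del: of_nat_mult)
  also have "\<dots> = (\<Sum>u<M. \<Sum>v<c. F (int c * int u + int M * int v))"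
    by (simp add: sum.cartesian_product)
  finally show ?thesis .
qed

definition gauss_sum :: "int \<Rightarrow> nat \<Rightarrow> complex" where
  "gauss_sum b c = (\<Sum>x<c. nome (of_int (b * int x ^ 2) / of_nat c))"

lemma nome_cong:
  assumes "c > 0" "[x = y] (mod int c)"
  shows "nome (of_int x / of_nat c) = nome (of_int y / of_nat c)"
proof -
  obtain k where k: "x = y + int c * k"
    using assms(2) by (auto simp: cong_iff_dvd_diff dvd_def algebra_simps)
  have "(of_int x / of_nat c :: complex) = of_int y / of_nat c + of_int k"
    using assms(1) by (simp add: k field_simps)
  thus ?thesis by simp
qed

lemma nome_quadratic_periodic:
  assumes "c > 0"
  shows "nome (of_int (b * (n + int c) ^ 2) / of_nat c) = nome (of_int (b * n ^ 2) / of_nat c)"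
proof (intro nome_cong assms)
  have "b * (n + int c) ^ 2 - b * n ^ 2 = int c * (b * (2 * n + int c))"
    by (simp add: power2_eq_square algebra_simps)
  thus "[b * (n + int c) ^ 2 = b * n ^ 2] (mod int c)"
    by (simp add: cong_iff_dvd_diff)
qed

lemma gauss_sum_square_factor:
  assumes c: "c > 0" and k: "coprime k (int c)"
  shows "gauss_sum (b * k ^ 2) c = gauss_sum b c"
proof -
  let ?F = "\<lambda>n. nome (of_int (b * n ^ 2) / of_nat c)"
  have "b * k ^ 2 * int x ^ 2 = b * (k * int x) ^ 2" for x
    by (simp add: power_mult_distrib)
  hence "gauss_sum (b * k ^ 2) c = (\<Sum>x<c. ?F (k * int x))"
    by (simp only: gauss_sum_def)
  also have "\<dots> = (\<Sum>x<c. ?F (int x))"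
    by (rule sum_periodic_dilate[where F = ?F]) (use c k nome_quadratic_periodic in auto)
  finally show ?thesis by (simp only: gauss_sum_def)
qed

section \<open>Gauss sums for a prime and its square\<close>

definition legendre_gauss_sum :: "nat \<Rightarrow> complex" where
  "legendre_gauss_sum l = (\<Sum>y<l. of_int (Legendre (int y) (int l)) * nome (of_nat y / of_nat l))"

locale odd_prime =
  fixes l :: nat
  assumes prime_l: "prime l" and l_gt_2: "2 < l"
begin

lemma l_pos: "l > 0" using l_gt_2 by simp

lemma coprime_l_iff: "coprime k (int l) \<longleftrightarrow> \<not> int l dvd k"
proof
  assume "coprime k (int l)"
  thus "\<not> int l dvd k"
    using coprime_common_divisor[of k "int l" "int l"] l_gt_2 by auto
next
  assume "\<not> int l dvd k"
  thus "coprime k (int l)"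
    using prime_imp_coprime[of "int l" k] prime_l by (simp add: coprime_commute)
qed

lemma Legendre_periodic: "Legendre (a + int l) (int l) = Legendre a (int l)"
  by (rule Legendre_cong) (simp add: cong_def)

lemma card_square_roots:
  assumes "y < l"
  shows "int (card {x\<in>{..<l}. [int x ^ 2 = int y] (mod int l)}) = 1 + Legendre (int y) (int l)"
proof -
  let ?S = "{x\<in>{..<l}. [int x ^ 2 = int y] (mod int l)}"
  have pI: "prime (int l)" using prime_l by simp
  show ?thesis
  proof (cases "y = 0")
    case True
    have "?S = {0}"
      using True l_pos prime_dvd_power_int_iff[OF pI, of 2]
      by (auto simp: cong_0_iff dest: nat_dvd_not_less)
    thus ?thesis using True by (simp add: Legendre_def)
  next
    case False
    hence ny: "\<not> [int y = 0] (mod int l)"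
      using assms by (simp add: cong_0_iff nat_dvd_not_less)
    show ?thesis
    proof (cases "QuadRes (int l) (int y)")
      case False
      hence "?S = {}" by (auto simp: QuadRes_def)
      thus ?thesis using False ny by (simp only: Legendre_def) simp
    next
      case True
      then obtain z where z: "[z ^ 2 = int y] (mod int l)" by (auto simp: QuadRes_def)
      define x where "x = nat (z mod int l)"
      have x: "int x = z mod int l" "x < l" using l_pos by (auto simp: x_def nat_less_iff)
      have xz: "[int x = z] (mod int l)" by (simp add: x)
      have xy: "[int x ^ 2 = int y] (mod int l)"
        using cong_pow[OF xz, of 2] z cong_trans by blast
      have x0: "x \<noteq> 0"
      proof
        assume "x = 0"
        with xy ny show False by (simp add: cong_sym_eq)
      qed
      have "?S = {x, l - x}"
      proof (intro equalityI subsetI)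
        fix w assume "w \<in> ?S"
        hence w: "w < l" "[int w ^ 2 = int y] (mod int l)" by auto
        have "[int w ^ 2 = int x ^ 2] (mod int l)"
          using w(2) xy cong_sym cong_trans by blast
        hence "int l dvd (int w - int x) * (int w + int x)"
          by (simp add: cong_iff_dvd_diff power2_eq_square algebra_simps)
        hence "int l dvd int w - int x \<or> int l dvd int w + int x"
          using pI by (simp add: prime_dvd_mult_iff)
        thus "w \<in> {x, l - x}"
        proof
          assume "int l dvd int w - int x"
          hence "w = x" using w x by (simp add: cong_iff_dvd_diff[symmetric] cong_def)
          thus ?thesis by simp
        next
          assume "int l dvd int w + int x"
          then obtain k where k: "w + x = l * k"
            by (metis dvd_def of_nat_add of_nat_dvd_iff)
          have "k < 2" using w x k l_pos by (metis add_strict_mono mult.commute mult_2 mult_less_cancel2)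
          moreover have "k \<noteq> 0" using k x0 by (metis add_is_0 mult_0_right)
          ultimately have "k = 1" by simp
          hence "w = l - x" using k by simp
          thus ?thesis by simp
        qed
      next
        fix w assume "w \<in> {x, l - x}"
        moreover have "[int (l - x) ^ 2 = int x ^ 2] (mod int l)"
          using x(2) by (simp add: of_nat_diff cong_iff_dvd_diff power2_eq_square algebra_simps)
        ultimately show "w \<in> ?S" using x x0 xy cong_trans by auto
      qed
      moreover have "x \<noteq> l - x"
      proof
        assume "x = l - x"
        hence "even l" using x(2) by presburger
        thus False using prime_l l_gt_2 by (simp add: prime_odd_nat)
      qed
      ultimately show ?thesis using True ny by (simp add: Legendre_def)
    qed
  qed
qed

lemma sum_nome_l: "(\<Sum>y<l. nome (of_int (b * int y) / of_nat l)) = (if int l dvd b then of_nat l else 0)"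
  using sum_nome_root_of_unity[OF l_pos, of b] by simp

text \<open>Every \<open>y\<close> is hit by \<open>x \<mapsto> x\<^sup>2\<close> exactly \<open>1 + (y/l)\<close> times, and the constant part sums
  to zero.\<close>

lemma gauss_sum_eq_Legendre_sum:
  assumes "\<not> int l dvd b"
  shows "gauss_sum b l = (\<Sum>y<l. of_int (Legendre (int y) (int l)) * nome (of_int (b * int y) / of_nat l))"
proof -
  have "gauss_sum b l = (\<Sum>x<l. nome (of_int (b * int (x ^ 2 mod l)) / of_nat l))"
    unfolding gauss_sum_def
    by (intro sum.cong refl nome_cong l_pos cong_mult) (simp_all add: cong_def zmod_int)
  also have "\<dots> = (\<Sum>y<l. \<Sum>x\<in>{x\<in>{..<l}. x ^ 2 mod l = y}. nome (of_int (b * int (x ^ 2 mod l)) / of_nat l))"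
    by (rule sum.group[symmetric]) (use l_pos in auto)
  also have "\<dots> = (\<Sum>y<l. (1 + of_int (Legendre (int y) (int l))) * nome (of_int (b * int y) / of_nat l))"
  proof (intro sum.cong refl)
    fix y assume y: "y \<in> {..<l}"
    have set: "{x\<in>{..<l}. x ^ 2 mod l = y} = {x\<in>{..<l}. [int x ^ 2 = int y] (mod int l)}"
      using y by (auto simp: cong_def simp flip: of_nat_power of_nat_mod)
    have "of_nat (card {x\<in>{..<l}. x ^ 2 mod l = y}) = (1 + of_int (Legendre (int y) (int l)) :: complex)"
    proof -
      have "of_int (int (card {x\<in>{..<l}. x ^ 2 mod l = y})) = (of_int (1 + Legendre (int y) (int l)) :: complex)"
        using card_square_roots[of y] y unfolding set by simp
      thus ?thesis by simp
    qed
    thus "(\<Sum>x\<in>{x\<in>{..<l}. x ^ 2 mod l = y}. nome (of_int (b * int (x ^ 2 mod l)) / of_nat l))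
            = (1 + of_int (Legendre (int y) (int l))) * nome (of_int (b * int y) / of_nat l)"
      by simp
  qed
  also have "\<dots> = (\<Sum>y<l. nome (of_int (b * int y) / of_nat l))
      + (\<Sum>y<l. of_int (Legendre (int y) (int l)) * nome (of_int (b * int y) / of_nat l))"
    by (simp only: ring_distribs sum.distrib mult_1)
  finally show ?thesis using assms unfolding sum_nome_l by simp
qed

lemma Legendre_sum_coprime:
  assumes "\<not> int l dvd b"
  shows "(\<Sum>y<l. of_int (Legendre (int y) (int l)) * nome (of_int (b * int y) / of_nat l))
           = of_int (Legendre b (int l)) * legendre_gauss_sum l"
proof -
  let ?F = "\<lambda>y. of_int (Legendre y (int l)) * nome (of_int y / of_nat l)"
  have per: "?F (n + int l) = ?F n" for n
    by (simp only: Legendre_periodic) (metis nome_cong[OF l_pos] cong_add_rcancel_0 cong_def mod_add_self2)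
  have "legendre_gauss_sum l = (\<Sum>y<l. ?F (int y))" by (simp add: legendre_gauss_sum_def)
  also have "\<dots> = (\<Sum>y<l. ?F (b * int y))"
    by (rule sum_periodic_dilate[where F = ?F, symmetric])
       (use assms per in \<open>simp_all only: coprime_l_iff l_pos not_False_eq_True\<close>)
  also have "\<dots> = of_int (Legendre b (int l)) *
      (\<Sum>y<l. of_int (Legendre (int y) (int l)) * nome (of_int (b * int y) / of_nat l))"
    unfolding sum_distrib_left by (simp add: Legendre_mult[OF prime_l l_gt_2] mult_ac)
  finally have "of_int (Legendre b (int l)) * legendre_gauss_sum l
    = of_int (Legendre b (int l) * Legendre b (int l)) *
      (\<Sum>y<l. of_int (Legendre (int y) (int l)) * nome (of_int (b * int y) / of_nat l))"
    by (simp add: mult.assoc)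
  thus ?thesis by (simp only: Legendre_self_square[OF assms]) simp
qed

lemma gauss_sum_prime:
  assumes "\<not> int l dvd b"
  shows "gauss_sum b l = of_int (Legendre b (int l)) * legendre_gauss_sum l"
  using gauss_sum_eq_Legendre_sum[OF assms] Legendre_sum_coprime[OF assms] by simp

lemma sum_Legendre: "(\<Sum>y<l. Legendre (int y) (int l)) = 0"
proof -
  have "(\<Sum>y<l. 1 + Legendre (int y) (int l)) = (\<Sum>y<l. int (card {x\<in>{..<l}. x ^ 2 mod l = y}))"
  proof (intro sum.cong refl)
    fix y assume y: "y \<in> {..<l}"
    have set: "{x\<in>{..<l}. x ^ 2 mod l = y} = {x\<in>{..<l}. [int x ^ 2 = int y] (mod int l)}"
      using y by (auto simp: cong_def simp flip: of_nat_power of_nat_mod)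
    show "1 + Legendre (int y) (int l) = int (card {x\<in>{..<l}. x ^ 2 mod l = y})"
      unfolding set using card_square_roots[of y] y by simp
  qed
  also have "\<dots> = int (\<Sum>y<l. \<Sum>x\<in>{x\<in>{..<l}. x ^ 2 mod l = y}. 1)" by simp
  also have "(\<Sum>y<l. \<Sum>x\<in>{x\<in>{..<l}. x ^ 2 mod l = y}. 1) = (\<Sum>x<l. 1 :: nat)"
    by (rule sum.group) (use l_pos in auto)
  finally show ?thesis by (simp add: sum.distrib)
qed

text \<open>The Legendre symbol is its own finite Fourier transform up to a constant. For \<open>b\<close> divisible by
  \<open>l\<close> this says that the symbols sum to zero.\<close>

lemma Legendre_fourier:
  "(\<Sum>y<l. of_int (Legendre (int y) (int l)) * nome (of_int (b * int y) / of_nat l))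
     = of_int (Legendre b (int l)) * legendre_gauss_sum l"
proof (cases "int l dvd b")
  case False
  thus ?thesis by (rule Legendre_sum_coprime)
next
  case True
  have "nome (of_int (b * int y) / of_nat l) = 1" for y
    using nome_cong[OF l_pos, of "b * int y" 0] True by (simp add: cong_0_iff)
  hence "(\<Sum>y<l. of_int (Legendre (int y) (int l)) * nome (of_int (b * int y) / of_nat l))
    = of_int (\<Sum>y<l. Legendre (int y) (int l))" by simp
  also have "\<dots> = 0" by (simp only: sum_Legendre of_int_0)
  finally show ?thesis using True by (simp add: Legendre_def cong_0_iff)
qed

text \<open>The Gauss sum times its conjugate is \<open>l\<close> by orthogonality, and the conjugate is the
  Gauss sum for \<open>-1\<close>.\<close>

lemma legendre_gauss_sum_square:
  "legendre_gauss_sum l ^ 2 = of_int (Legendre (-1) (int l)) * of_nat l"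
proof -
  have n1: "\<not> int l dvd 1" "\<not> int l dvd -1" using l_gt_2 by auto
  have nl2: "\<not> int l dvd 2" using l_gt_2 zdvd_imp_le[of "int l" 2] by auto
  have L1: "Legendre 1 (int l) = 1" using Legendre_power[OF prime_l l_gt_2, of 1 0] by simp
  have g: "gauss_sum 1 l = legendre_gauss_sum l" using gauss_sum_prime[OF n1(1)] L1 by simp
  have g': "gauss_sum (-1) l = of_int (Legendre (-1) (int l)) * legendre_gauss_sum l"
    by (rule gauss_sum_prime[OF n1(2)])
  have "gauss_sum (-1) l * gauss_sum 1 l
      = (\<Sum>y<l. \<Sum>x<l. nome (of_int ((int x) ^ 2 - int y ^ 2) / of_nat l))"
    unfolding gauss_sum_def sum_product
    by (intro sum.cong refl) (simp add: nome_add[symmetric] field_simps)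
  also have "\<dots> = (\<Sum>y<l. \<Sum>x<l. nome (of_int ((int x + int y) ^ 2 - int y ^ 2) / of_nat l))"
    by (intro sum.cong refl sum_periodic_shift[symmetric, OF l_pos, of "\<lambda>x. nome (of_int (x ^ 2 - int _ ^ 2) / of_nat l)"]
          nome_cong l_pos) (simp add: cong_iff_dvd_diff power2_eq_square algebra_simps)
  also have "\<dots> = (\<Sum>x<l. \<Sum>y<l. nome (of_int ((int x + int y) ^ 2 - int y ^ 2) / of_nat l))"
    by (rule sum.swap)
  also have "\<dots> = (\<Sum>x<l. nome (of_int (int x ^ 2) / of_nat l) * (\<Sum>y<l. nome (of_int (2 * int x * int y) / of_nat l)))"
    unfolding sum_distrib_left
    by (intro sum.cong refl) (simp add: nome_add[symmetric] field_simps power2_eq_square)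
  also have "\<dots> = (\<Sum>x<l. if x = 0 then of_nat l else 0)"
  proof (intro sum.cong refl)
    fix x assume x: "x \<in> {..<l}"
    have "int l dvd 2 * int x \<longleftrightarrow> x = 0"
      using x nl2 prime_l by (auto simp: prime_dvd_mult_iff dest: nat_dvd_not_less)
    thus "nome (of_int (int x ^ 2) / of_nat l) * (\<Sum>y<l. nome (of_int (2 * int x * int y) / of_nat l))
        = (if x = 0 then of_nat l else 0)"
      unfolding sum_nome_l by auto
  qed
  also have "\<dots> = of_nat l" using l_pos by simp
  finally have "of_int (Legendre (-1) (int l)) * legendre_gauss_sum l ^ 2 = of_nat l"
    by (simp add: g g' power2_eq_square mult.assoc)
  hence "of_int (Legendre (-1) (int l) * Legendre (-1) (int l)) * legendre_gauss_sum l ^ 2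
           = of_int (Legendre (-1) (int l)) * of_nat l"
    by (simp add: mult.assoc)
  thus ?thesis by (simp only: Legendre_self_square[OF n1(2)]) simp
qed

text \<open>Write \<open>x = y + l z\<close>. The exponent is linear in \<open>z\<close> modulo \<open>l\<^sup>2\<close>, so the sum over \<open>z\<close> vanishes
  unless \<open>y = 0\<close>.\<close>

lemma gauss_sum_prime_square:
  assumes "\<not> int l dvd b"
  shows "gauss_sum b (l ^ 2) = of_nat l"
proof -
  have nl2: "\<not> int l dvd 2" using l_gt_2 zdvd_imp_le[of "int l" 2] by auto
  have "bij_betw (\<lambda>(y, z). y + l * z) ({..<l} \<times> {..<l}) {..<l ^ 2}"
  proof (rule bij_betwI[where g = "\<lambda>x. (x mod l, x div l)"])
    show "(\<lambda>(y, z). y + l * z) \<in> {..<l} \<times> {..<l} \<rightarrow> {..<l ^ 2}"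
    proof clarsimp
      fix y z assume yz: "y < l" "z < l"
      have "y + l * z < l * Suc z" using yz by simp
      also have "\<dots> \<le> l * l" using yz by (intro mult_left_mono) auto
      finally show "y + l * z < l\<^sup>2" by (simp add: power2_eq_square)
    qed
  qed (use l_pos in \<open>auto simp: power2_eq_square div_less_iff_less_mult\<close>)
  hence "gauss_sum b (l ^ 2) = (\<Sum>p\<in>{..<l} \<times> {..<l}. nome (of_int (b * int ((\<lambda>(y, z). y + l * z) p) ^ 2) / of_nat (l ^ 2)))"
    unfolding gauss_sum_def by (rule sum.reindex_bij_betw[symmetric])
  also have "\<dots> = (\<Sum>y<l. \<Sum>z<l. nome (of_int (b * int (y + l * z) ^ 2) / of_nat (l ^ 2)))"
    by (simp add: sum.cartesian_product case_prod_unfold)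
  also have "\<dots> = (\<Sum>y<l. nome (of_int (b * int y ^ 2) / of_nat (l ^ 2)) * (\<Sum>z<l. nome (of_int (2 * b * int y * int z) / of_nat l)))"
    unfolding sum_distrib_left
  proof (intro sum.cong refl)
    fix y z :: nat
    have "(of_int (b * int (y + l * z) ^ 2) / of_nat (l ^ 2) :: complex)
        = of_int (b * int y ^ 2) / of_nat (l ^ 2) + of_int (2 * b * int y * int z) / of_nat l + of_int (b * int z ^ 2)"
      using l_pos by (simp add: field_simps power2_eq_square)
    thus "nome (of_int (b * int (y + l * z) ^ 2) / of_nat (l ^ 2))
        = nome (of_int (b * int y ^ 2) / of_nat (l ^ 2)) * nome (of_int (2 * b * int y * int z) / of_nat l)"
      by (simp only: nome_add nome_of_int) simp
  qed
  also have "\<dots> = (\<Sum>y<l. if y = 0 then of_nat l else 0)"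
  proof (intro sum.cong refl)
    fix y assume y: "y \<in> {..<l}"
    have "int l dvd 2 * b * int y \<longleftrightarrow> y = 0"
      using y nl2 prime_l assms by (auto simp: prime_dvd_mult_iff dest: nat_dvd_not_less)
    thus "nome (of_int (b * int y ^ 2) / of_nat (l ^ 2)) * (\<Sum>z<l. nome (of_int (2 * b * int y * int z) / of_nat l))
        = (if y = 0 then of_nat l else 0)"
      unfolding sum_nome_l by auto
  qed
  also have "\<dots> = of_nat l" using l_pos by simp
  finally show ?thesis .
qed

end

section \<open>Infinite products for the eta and theta functions\<close>

text \<open>Pairing \<open>j\<close> with \<open>-1 - j\<close> suits both applications: the terms of a sum over triangular exponents
  coincide in pairs, and partial sums of the pentagonal series become those of a finite identity.\<close>

lemma infsum_int_sums:
  fixes h :: "int \<Rightarrow> complex"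
  assumes "h summable_on UNIV"
  shows "(\<lambda>j. h (int j) + h (- 1 - int j)) sums infsum h UNIV"
proof -
  let ?p = "\<lambda>j. int j" and ?m = "\<lambda>j. - 1 - int j"
  have dec: "range ?p \<union> range ?m = UNIV" "range ?p \<inter> range ?m = {}"
  proof -
    have "n \<in> range ?p \<union> range ?m" for n :: int
    proof (cases "n \<ge> 0")
      case True thus ?thesis by (auto intro!: image_eqI[of _ _ "nat n"])
    next
      case False thus ?thesis by (auto intro!: image_eqI[of _ ?m "nat (- 1 - n)"])
    qed
    thus "range ?p \<union> range ?m = UNIV" by blast
  qed auto
  have s: "h summable_on range ?p" "h summable_on range ?m"
    using assms summable_on_subset_banach by blast+
  have inj: "inj ?p" "inj ?m" by (auto simp: inj_on_def)
  have "infsum h UNIV = infsum h (range ?p) + infsum h (range ?m)"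
    using infsum_Un_disjoint[OF s dec(2)] by (simp add: dec(1))
  moreover have "(\<lambda>j. h (int j)) sums infsum h (range ?p)"
    by (rule has_sum_imp_sums)
       (use has_sum_infsum[OF s(1)] in \<open>subst (asm) has_sum_reindex[OF inj(1)], simp add: o_def\<close>)
  moreover have "(\<lambda>j. h (- 1 - int j)) sums infsum h (range ?m)"
    by (rule has_sum_imp_sums)
       (use has_sum_infsum[OF s(2)] in \<open>subst (asm) has_sum_reindex[OF inj(2)], simp add: o_def\<close>)
  ultimately show ?thesis by (simp add: sums_add)
qed

text \<open>Shanks' finite form of Euler's pentagonal number theorem. The exponents \<open>j\<^sup>2 + j (j + 1) / 2\<close> and
  \<open>j (j + 1) + (j + 1) (j + 2) / 2\<close> are the generalised pentagonal numbers.\<close>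

lemma shanks_pentagonal:
  fixes q :: complex
  assumes q: "\<And>k. q ^ Suc k \<noteq> 1"
  defines "P \<equiv> \<lambda>n. \<Prod>k<n. 1 - q ^ Suc k"
  defines "T \<equiv> \<lambda>j. \<Sum>{..j}"
  shows "(\<Sum>s\<le>n. (-1) ^ s * (P n / P s) * q ^ (s * n + T s))
           = (\<Sum>j<n. (-1) ^ j * q ^ (j * j + T j) + (-1) ^ Suc j * q ^ (j * Suc j + T (Suc j)))
             + (-1) ^ n * q ^ (n * n + T n)"
proof (induction n)
  case 0
  show ?case by (simp add: P_def)
next
  case (Suc n)
  have P: "P k \<noteq> 0" for k using q by (auto simp: P_def)
  have T: "T (Suc j) = T j + Suc j" for j by (simp add: T_def)
  \<comment> \<open>a telescoping certificate for the difference of consecutive left-hand sides\<close>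
  define C where "C = (\<lambda>s. (-1) ^ s * (P n / P s) * (1 - q ^ s) * q ^ (s * n + T s))"
  have step: "(-1) ^ s * (P (Suc n) / P s) * q ^ (s * Suc n + T s)
                - (-1) ^ s * (P n / P s) * q ^ (s * n + T s) = C (Suc s) - C s" for s
  proof -
    define X where "X = (-1) ^ s * (P n / P s) * q ^ (s * n + T s)"
    have PS: "P (Suc k) = P k * (1 - q ^ Suc k)" for k by (simp add: P_def)
    have 1: "(-1) ^ s * (P (Suc n) / P s) * q ^ (s * Suc n + T s) = X * ((1 - q ^ Suc n) * q ^ s)"
      by (simp add: X_def PS power_add mult_ac)
    have "1 - q ^ Suc s \<noteq> 0" using q[of s] by simp
    hence "P n / P (Suc s) * (1 - q ^ Suc s) = P n / P s"
      using P[of s] by (simp add: PS del: power_Suc)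
    moreover have "C (Suc s) = (-1) ^ Suc s * (P n / P (Suc s) * (1 - q ^ Suc s)) * q ^ (Suc s * n + T (Suc s))"
      by (simp only: C_def mult.assoc)
    ultimately have "C (Suc s) = (-1) ^ Suc s * (P n / P s) * q ^ (Suc s * n + T (Suc s))"
      by (simp only:)
    also have "q ^ (Suc s * n + T (Suc s)) = q ^ (s * n + T s) * q ^ (Suc n + s)"
      unfolding T power_add[symmetric] by (rule arg_cong[of _ _ "power q"]) simp
    finally have 2: "C (Suc s) = - X * q ^ (Suc n + s)" by (simp add: X_def)
    have 3: "C s = X * (1 - q ^ s)" by (simp add: C_def X_def)
    show ?thesis unfolding 1 2 3 X_def[symmetric] by (simp add: algebra_simps power_add)
  qed
  have "(\<Sum>s\<le>Suc n. (-1) ^ s * (P (Suc n) / P s) * q ^ (s * Suc n + T s))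
      = (\<Sum>s\<le>n. (-1) ^ s * (P n / P s) * q ^ (s * n + T s)) + (\<Sum>s\<le>n. C (Suc s) - C s)
        + (-1) ^ Suc n * q ^ (Suc n * Suc n + T (Suc n))"
    unfolding step[symmetric] by (simp add: sum_subtractf P del: power_Suc)
  also have "(\<Sum>s\<le>n. C (Suc s) - C s) = C (Suc n) - C 0"
    unfolding lessThan_Suc_atMost[symmetric] by (rule sum_lessThan_telescope)
  also have "C (Suc n) - C 0 = (-1) ^ Suc n * q ^ (n * Suc n + T (Suc n))"
  proof -
    have PS: "P (Suc n) = P n * (1 - q ^ Suc n)" by (simp add: P_def)
    have "1 - q ^ Suc n \<noteq> 0" using q[of n] by simp
    hence "P n / P (Suc n) * (1 - q ^ Suc n) = 1"
      using P[of n] by (simp add: PS del: power_Suc)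
    moreover have "C (Suc n) = (-1) ^ Suc n * (P n / P (Suc n) * (1 - q ^ Suc n)) * q ^ (Suc n * n + T (Suc n))"
      by (simp only: C_def mult.assoc)
    ultimately have "C (Suc n) = (-1) ^ Suc n * q ^ (Suc n * n + T (Suc n))"
      by simp
    thus ?thesis by (simp add: C_def mult.commute)
  qed
  finally show ?case unfolding Suc.IH by (simp add: add_ac)
qed

lemma one_minus_power_nonzero:
  fixes q :: complex
  assumes "norm q < 1" "k > 0"
  shows "q ^ k \<noteq> 1"
proof
  assume "q ^ k = 1"
  hence "norm q ^ k = 1" by (metis norm_one norm_power)
  moreover have "norm q ^ k < 1" using assms by (intro power_less_one_iff[THEN iffD2]) auto
  ultimately show False by simp
qed

lemma euler_product_convergent:
  fixes q :: complex
  assumes "norm q < 1"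
  shows "convergent_prod (\<lambda>n. 1 - q ^ Suc n)"
    and "(\<Prod>n. 1 - q ^ Suc n) \<noteq> 0"
    and "(\<lambda>n. \<Prod>k<n. 1 - q ^ Suc k) \<longlonglongrightarrow> (\<Prod>n. 1 - q ^ Suc n)"
proof -
  have "summable (\<lambda>n. norm ((1 - q ^ Suc n) - 1))"
  proof -
    have "summable (\<lambda>n. norm q * norm q ^ n)"
      using assms by (intro summable_mult summable_geometric) auto
    thus ?thesis by (simp add: norm_power norm_mult)
  qed
  hence "abs_convergent_prod (\<lambda>n. 1 - q ^ Suc n)"
    by (rule summable_imp_abs_convergent_prod)
  thus c: "convergent_prod (\<lambda>n. 1 - q ^ Suc n)"
    by (rule abs_convergent_prod_imp_convergent_prod)
  show "(\<Prod>n. 1 - q ^ Suc n) \<noteq> 0"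
  proof (rule prodinf_nonzero[OF c])
    show "1 - q ^ Suc i \<noteq> 0" for i
      using one_minus_power_nonzero[OF assms, of "Suc i"] by auto
  qed
  have "(\<lambda>n. \<Prod>k\<le>n. 1 - q ^ Suc k) \<longlonglongrightarrow> (\<Prod>n. 1 - q ^ Suc n)"
    by (rule convergent_prod_LIMSEQ[OF c])
  hence "(\<lambda>n. \<Prod>k<Suc n. 1 - q ^ Suc k) \<longlonglongrightarrow> (\<Prod>n. 1 - q ^ Suc n)"
    by (simp only: lessThan_Suc_atMost)
  thus "(\<lambda>n. \<Prod>k<n. 1 - q ^ Suc k) \<longlonglongrightarrow> (\<Prod>n. 1 - q ^ Suc n)"
    by (rule LIMSEQ_imp_Suc)
qed

text \<open>In the limit of Shanks' identities only the term for \<open>s = 0\<close> survives. The quotients \<open>P n / P s\<close>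
  stay bounded because \<open>P\<close> has a nonzero limit.\<close>

lemma ratio_sum_limit:
  fixes P :: "nat \<Rightarrow> complex" and a :: "nat \<Rightarrow> nat \<Rightarrow> complex"
  assumes lim: "P \<longlonglongrightarrow> L" and L: "L \<noteq> 0" and P: "\<And>n. P n \<noteq> 0" "P 0 = 1"
    and r: "0 \<le> r" "r < 1" and a: "\<And>n s. s > 0 \<Longrightarrow> norm (a n s) \<le> r ^ n" and a0: "\<And>n. a n 0 = 1"
    and A: "\<And>n. finite (A n)" "\<And>n. n > 0 \<Longrightarrow> 0 \<in> A n" "\<And>n. card (A n) \<le> Suc n"
  shows "(\<lambda>n. \<Sum>s\<in>A n. P n / P s * a n s) \<longlonglongrightarrow> L"
proof -
  obtain K1 where K1: "K1 > 0" "\<And>n. norm (P n) \<le> K1"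
    using convergent_imp_Bseq[of P] lim by (auto simp: convergent_def Bseq_def)
  have "(\<lambda>n. inverse (P n)) \<longlonglongrightarrow> inverse L" by (intro tendsto_inverse lim L)
  then obtain K2 where K2: "K2 > 0" "\<And>n. norm (inverse (P n)) \<le> K2"
    using convergent_imp_Bseq[of "\<lambda>n. inverse (P n)"] by (auto simp: convergent_def Bseq_def)
  have "(\<lambda>n. (\<Sum>s\<in>A n. P n / P s * a n s) - P n) \<longlonglongrightarrow> 0"
  proof (rule Lim_null_comparison)
    have "(\<lambda>n. real n * r ^ n) \<longlonglongrightarrow> 0"
      using r by (intro powser_times_n_limit_0) auto
    moreover have "(\<lambda>n. r ^ n) \<longlonglongrightarrow> 0"
      using r by (intro LIMSEQ_realpow_zero)
    ultimately have "(\<lambda>n. K1 * K2 * (real n * r ^ n + r ^ n)) \<longlonglongrightarrow> K1 * K2 * (0 + 0)"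
      by (intro tendsto_mult_left tendsto_add)
    thus "(\<lambda>n. real (Suc n) * (K1 * K2 * r ^ n)) \<longlonglongrightarrow> 0"
      by (simp add: algebra_simps)
    show "\<forall>\<^sub>F n in sequentially. norm ((\<Sum>s\<in>A n. P n / P s * a n s) - P n) \<le> real (Suc n) * (K1 * K2 * r ^ n)"
      using eventually_gt_at_top[of 0]
    proof eventually_elim
      case (elim n)
      have "(\<Sum>s\<in>A n. P n / P s * a n s) = P n + (\<Sum>s\<in>A n - {0}. P n / P s * a n s)"
        using A(1,2) elim by (subst sum.remove[of "A n" 0]) (auto simp: P a0)
      hence "norm ((\<Sum>s\<in>A n. P n / P s * a n s) - P n) = norm (\<Sum>s\<in>A n - {0}. P n / P s * a n s)"
        by simp
      also have "\<dots> \<le> (\<Sum>s\<in>A n - {0}. K1 * K2 * r ^ n)"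
      proof (rule sum_norm_le)
        fix s assume s: "s \<in> A n - {0}"
        have "norm (P n / P s * a n s) = norm (P n) * norm (inverse (P s)) * norm (a n s)"
          by (simp add: norm_mult norm_divide norm_inverse divide_inverse)
        also have "\<dots> \<le> K1 * K2 * r ^ n"
          using s K1 K2 a[of s n] r by (intro mult_mono) auto
        finally show "norm (P n / P s * a n s) \<le> K1 * K2 * r ^ n" .
      qed
      also have "\<dots> = real (card (A n - {0})) * (K1 * K2 * r ^ n)" by simp
      also have "\<dots> \<le> real (Suc n) * (K1 * K2 * r ^ n)"
      proof (intro mult_right_mono)
        have "card (A n - {0}) \<le> Suc n"
          using A(1,3)[of n] card_mono[of "A n" "A n - {0}"] by auto
        thus "real (card (A n - {0})) \<le> real (Suc n)" by simp
      qed (use K1 K2 r in auto)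
      finally show ?case .
    qed
  qed
  from tendsto_add[OF this lim] show ?thesis by simp
qed

lemma pentagonal_sums:
  fixes q :: complex
  assumes q: "norm q < 1"
  shows "(\<lambda>n. \<Sum>j<n. (-1) ^ j * q ^ (j * j + \<Sum>{..j}) + (-1) ^ Suc j * q ^ (j * Suc j + \<Sum>{..Suc j}))
           \<longlonglongrightarrow> (\<Prod>n. 1 - q ^ Suc n)"
proof -
  define P where "P = (\<lambda>n. \<Prod>k<n. 1 - q ^ Suc k)"
  let ?L = "\<Prod>n. 1 - q ^ Suc n"
  have qk: "q ^ Suc k \<noteq> 1" for k using one_minus_power_nonzero[OF q] by blast
  have "(\<lambda>n. \<Sum>s\<in>{..n}. P n / P s * ((-1) ^ s * q ^ (s * n + \<Sum>{..s}))) \<longlonglongrightarrow> ?L"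
  proof (rule ratio_sum_limit[where r = "norm q"])
    show "P \<longlonglongrightarrow> ?L" "?L \<noteq> 0" using euler_product_convergent[OF q] by (simp_all add: P_def)
    show "P n \<noteq> 0" for n using qk by (auto simp: P_def)
    show "norm ((-1) ^ s * q ^ (s * n + \<Sum>{..s})) \<le> norm q ^ n" if "s > 0" for n s
    proof -
      have "n \<le> s * n + \<Sum>{..s}" using that by (cases s) auto
      thus ?thesis using q by (simp add: norm_mult norm_power power_decreasing)
    qed
  qed (use q in \<open>auto simp: P_def\<close>)
  moreover have "(\<lambda>n. \<Sum>s\<in>{..n}. P n / P s * ((-1) ^ s * q ^ (s * n + \<Sum>{..s})))
     = (\<lambda>n. (\<Sum>j<n. (-1) ^ j * q ^ (j * j + \<Sum>{..j}) + (-1) ^ Suc j * q ^ (j * Suc j + \<Sum>{..Suc j}))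
             + (-1) ^ n * q ^ (n * n + \<Sum>{..n}))"
    unfolding shanks_pentagonal[OF qk, symmetric] P_def by (intro ext sum.cong refl) (simp add: mult_ac)
  moreover have "(\<lambda>n. (-1) ^ n * q ^ (n * n + \<Sum>{..n})) \<longlonglongrightarrow> 0"
  proof (rule Lim_null_comparison)
    show "(\<lambda>n. norm q ^ n) \<longlonglongrightarrow> 0" using q by (intro LIMSEQ_realpow_zero) auto
    have "n \<le> n * n + \<Sum>{..n}" for n :: nat by (cases n) auto
    thus "\<forall>\<^sub>F n in sequentially. norm ((-1) ^ n * q ^ (n * n + \<Sum>{..n})) \<le> norm q ^ n"
      using q by (intro always_eventually allI) (simp add: norm_mult norm_power power_decreasing)
  qed
  ultimately show ?thesis
    using tendsto_diff by fastforce
qed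

text \<open>Shanks' finite form of Gauss' product for the sum over triangular exponents, proved in the same
  way.\<close>

lemma shanks_triangular:
  fixes q :: complex
  assumes q: "\<And>k. q ^ Suc k \<noteq> 1"
  defines "P \<equiv> \<lambda>n. \<Prod>k<n. (1 - q ^ (2 * k + 2)) / (1 - q ^ (2 * k + 1))"
  shows "(\<Sum>s<n. P n / P s * q ^ (s * (2 * n + 1))) = (\<Sum>s<2 * n. q ^ \<Sum>{..s})"
proof (induction n)
  case 0
  show ?case by simp
next
  case (Suc n)
  have q1: "1 - q ^ (2 * k + 1) \<noteq> 0" "1 - q ^ (2 * k + 2) \<noteq> 0" for k
    using q[of "2 * k"] q[of "2 * k + 1"] by auto
  have P: "P k \<noteq> 0" for k using q1 by (auto simp: P_def)
  have PS: "P (Suc k) = P k * ((1 - q ^ (2 * k + 2)) / (1 - q ^ (2 * k + 1)))" for k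
    by (simp add: P_def)
  define C where "C = (\<lambda>s. P n / (1 - q ^ (2 * n + 1)) * ((1 - q ^ (2 * s)) / P s) * q ^ (s * (2 * n + 1)))"
  have step: "P (Suc n) / P s * q ^ (s * (2 * Suc n + 1)) - P n / P s * q ^ (s * (2 * n + 1))
                = C (Suc s) - C s" for s
  proof -
    define d where "d = 1 - q ^ (2 * n + 1)"
    define X where "X = P n / (d * P s) * q ^ (s * (2 * n + 1))"
    have d: "d \<noteq> 0" using q1 by (simp add: d_def)
    have 1: "P (Suc n) / P s * q ^ (s * (2 * Suc n + 1)) = X * ((1 - q ^ (2 * n + 2)) * q ^ (2 * s))"
    proof -
      have "q ^ (s * (2 * Suc n + 1)) = q ^ (s * (2 * n + 1)) * q ^ (2 * s)"
        unfolding power_add[symmetric] by (rule arg_cong[of _ _ "power q"]) simp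
      moreover have "P (Suc n) / P s = P n / (d * P s) * (1 - q ^ (2 * n + 2))"
        by (simp only: PS d_def) simp
      ultimately show ?thesis by (simp add: X_def)
    qed
    have 2: "P n / P s * q ^ (s * (2 * n + 1)) = X * d"
      using d by (simp add: X_def)
    have "(1 - q ^ (2 * Suc s)) / P (Suc s) = (1 - q ^ (2 * s + 1)) / P s"
      using P[of s] q1[of s] by (simp add: PS del: power_Suc)
    hence "C (Suc s) = P n / d * ((1 - q ^ (2 * s + 1)) / P s) * q ^ (Suc s * (2 * n + 1))"
      by (simp only: C_def d_def)
    hence 3: "C (Suc s) = X * ((1 - q ^ (2 * s + 1)) * q ^ (2 * n + 1))"
      by (simp add: X_def power_add mult_ac)
    have 4: "C s = X * (1 - q ^ (2 * s))" by (simp add: C_def X_def d_def)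
    have "(1 - q ^ (2 * n + 2)) * q ^ (2 * s) - d
            = (1 - q ^ (2 * s + 1)) * q ^ (2 * n + 1) - (1 - q ^ (2 * s))"
      by (simp add: d_def algebra_simps power_add[symmetric])
    thus ?thesis unfolding 1 2 3 4 right_diff_distrib[symmetric] by simp
  qed
  have "(\<Sum>s<Suc n. P (Suc n) / P s * q ^ (s * (2 * Suc n + 1)))
     = (\<Sum>s<n. P n / P s * q ^ (s * (2 * n + 1))) + (\<Sum>s<n. C (Suc s) - C s)
       + P (Suc n) / P n * q ^ (n * (2 * Suc n + 1))"
    unfolding step[symmetric] by (simp add: sum_subtractf)
  also have "(\<Sum>s<n. C (Suc s) - C s) = C n - C 0" by (rule sum_lessThan_telescope)
  also have "C n - C 0 = (1 - q ^ (2 * n)) / (1 - q ^ (2 * n + 1)) * q ^ (n * (2 * n + 1))"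
    using P[of n] by (simp add: C_def)
  also have "P (Suc n) / P n = (1 - q ^ (2 * n + 2)) / (1 - q ^ (2 * n + 1))"
    using P[of n] by (simp add: PS)
  also have "(\<Sum>s<n. P n / P s * q ^ (s * (2 * n + 1)))
      + (1 - q ^ (2 * n)) / (1 - q ^ (2 * n + 1)) * q ^ (n * (2 * n + 1))
      + (1 - q ^ (2 * n + 2)) / (1 - q ^ (2 * n + 1)) * q ^ (n * (2 * Suc n + 1))
     = (\<Sum>s<n. P n / P s * q ^ (s * (2 * n + 1))) + (q ^ (n * (2 * n + 1)) + q ^ (n * (2 * n + 1) + (2 * n + 1)))"
  proof -
    have e: "q ^ (n * (2 * Suc n + 1)) = q ^ (n * (2 * n + 1)) * q ^ (2 * n)"
      unfolding power_add[symmetric] by (rule arg_cong[of _ _ "power q"]) simp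
    have "(1 - q ^ (2 * n)) + (1 - q ^ (2 * n + 2)) * q ^ (2 * n) = (1 + q ^ (2 * n + 1)) * (1 - q ^ (2 * n + 1))"
      by (simp add: algebra_simps power_add[symmetric])
    hence "(1 - q ^ (2 * n)) / (1 - q ^ (2 * n + 1)) + (1 - q ^ (2 * n + 2)) / (1 - q ^ (2 * n + 1)) * q ^ (2 * n)
        = 1 + q ^ (2 * n + 1)"
      using q1(1)[of n] by (simp add: add_divide_distrib[symmetric] divide_eq_eq)
    hence "((1 - q ^ (2 * n)) / (1 - q ^ (2 * n + 1)) + (1 - q ^ (2 * n + 2)) / (1 - q ^ (2 * n + 1)) * q ^ (2 * n))
        * q ^ (n * (2 * n + 1)) = q ^ (n * (2 * n + 1)) + q ^ (n * (2 * n + 1) + (2 * n + 1))"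
      by (simp only: ring_distribs power_add) (simp add: mult_ac)
    thus ?thesis unfolding e by (simp only: ring_distribs mult_ac add_ac)
  qed
  also have "n * (2 * n + 1) = \<Sum>{..2 * n}"
    by (induction n) auto
  also have "(\<Sum>s<n. P n / P s * q ^ (s * (2 * n + 1))) + (q ^ \<Sum>{..2 * n} + q ^ (\<Sum>{..2 * n} + (2 * n + 1)))
      = (\<Sum>s<2 * Suc n. q ^ \<Sum>{..s})"
    unfolding Suc.IH by simp
  finally show ?case .
qed

lemma triangular_series_nonzero:
  fixes q :: complex
  assumes q: "norm q < 1" and s: "(\<lambda>s. q ^ \<Sum>{..s}) sums S"
  shows "S \<noteq> 0"
proof -
  define P where "P = (\<lambda>n. \<Prod>k<n. (1 - q ^ (2 * k + 2)) / (1 - q ^ (2 * k + 1)))"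
  have qk: "q ^ Suc k \<noteq> 1" for k using one_minus_power_nonzero[OF q] by blast
  have q2: "norm (q ^ 2) < 1"
    using q by (simp add: norm_power power_less_one_iff)
  have geo: "summable (\<lambda>n. norm q ^ (2 * n))"
    using summable_geometric[of "norm q ^ 2"] q by (simp add: power_mult power_less_one_iff)
  have cA: "convergent_prod (\<lambda>n. 1 - q ^ (2 * n + 2))" and cB: "convergent_prod (\<lambda>n. 1 - q ^ (2 * n + 1))"
  proof -
    have "summable (\<lambda>n. norm ((1 - q ^ (2 * n + 2)) - 1))"
      using summable_mult[OF geo, of "norm q ^ 2"] by (simp add: norm_power norm_mult power2_eq_square mult_ac)
    thus "convergent_prod (\<lambda>n. 1 - q ^ (2 * n + 2))"
      by (intro abs_convergent_prod_imp_convergent_prod summable_imp_abs_convergent_prod)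
    have "summable (\<lambda>n. norm ((1 - q ^ (2 * n + 1)) - 1))"
      using summable_mult[OF geo, of "norm q"] by (simp add: norm_power norm_mult)
    thus "convergent_prod (\<lambda>n. 1 - q ^ (2 * n + 1))"
      by (intro abs_convergent_prod_imp_convergent_prod summable_imp_abs_convergent_prod)
  qed
  have q1: "1 - q ^ (2 * k + 1) \<noteq> 0" "1 - q ^ (2 * k + 2) \<noteq> 0" for k
    using qk[of "2 * k"] qk[of "2 * k + 1"] by auto
  let ?f = "\<lambda>k. (1 - q ^ (2 * k + 2)) / (1 - q ^ (2 * k + 1))"
  have c: "convergent_prod ?f" by (rule convergent_prod_divide[OF cA cB])
  have nz: "prodinf ?f \<noteq> 0" by (rule prodinf_nonzero[OF c]) (use q1 in auto)
  have "(\<lambda>n. \<Prod>k\<le>n. ?f k) \<longlonglongrightarrow> prodinf ?f" by (rule convergent_prod_LIMSEQ[OF c])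
  hence "(\<lambda>n. P (Suc n)) \<longlonglongrightarrow> prodinf ?f" by (simp only: P_def lessThan_Suc_atMost)
  hence Plim: "P \<longlonglongrightarrow> prodinf ?f" by (rule LIMSEQ_imp_Suc)
  have "(\<lambda>n. \<Sum>s\<in>{..<n}. P n / P s * q ^ (s * (2 * n + 1))) \<longlonglongrightarrow> prodinf ?f"
  proof (rule ratio_sum_limit[where r = "norm q", OF Plim nz])
    show "P n \<noteq> 0" for n using q1 by (auto simp: P_def)
    show "norm (q ^ (s * (2 * n + 1))) \<le> norm q ^ n" if "s > 0" for n s
    proof -
      have "n \<le> s * (2 * n + 1)" using that by (cases s) auto
      thus ?thesis using q by (simp add: norm_power power_decreasing del: mult_Suc_right)
    qed
  qed (use q in \<open>auto simp: P_def\<close>)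
  hence "(\<lambda>n. \<Sum>s<2 * n. q ^ \<Sum>{..s}) \<longlonglongrightarrow> prodinf ?f"
    unfolding P_def shanks_triangular[OF qk] .
  moreover have "(\<lambda>n. \<Sum>s<2 * n. q ^ \<Sum>{..s}) \<longlonglongrightarrow> S"
    using s unfolding sums_def
    by (rule filterlim_compose) (auto intro!: filterlim_subseq simp: strict_mono_def)
  ultimately show ?thesis using nz LIMSEQ_unique by blast
qed

section \<open>The eta function as a theta series\<close>

lemma theta_series_holomorphic:
  assumes B: "\<And>n. norm (\<phi> n) \<le> B"
  shows "theta_series \<phi> holomorphic_on {t. Re t > 0}"
  unfolding theta_series_def
proof (rule holomorphic_on_infsum)
  fix u :: complex assume "u \<in> {t. Re t > 0}"
  hence u: "Re u > 0" by simp
  have sub: "Re u / 2 \<le> Re w" if "w \<in> cball u (Re u / 2)" for w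
    using that abs_Re_le_cmod[of "u - w"] by (simp add: dist_norm)
  have "norm (\<phi> n * exp (- of_real pi * of_int n ^ 2 * w)) \<le> B * exp (- (pi * (Re u / 2)) * of_int n ^ 2 + 0 * of_int \<bar>n\<bar>)"
    if "w \<in> cball u (Re u / 2)" for w n
  proof -
    have "norm (exp (- of_real pi * of_int n ^ 2 * w)) \<le> exp (- (pi * (Re u / 2)) * of_int n ^ 2 + 0 * of_int \<bar>n\<bar>)"
    proof -
      have "pi * (Re u / 2) * of_int n ^ 2 \<le> pi * Re w * of_int n ^ 2"
        by (intro mult_right_mono mult_left_mono sub[OF that]) auto
      moreover have "- of_real pi * of_int n ^ 2 * w = - of_real pi * w * of_int n ^ 2" by simp
      ultimately show ?thesis by (simp only: norm_exp_mult_square) simp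
    qed
    thus ?thesis unfolding norm_mult using B[of n] order_trans[OF norm_ge_zero B[of n]]
      by (intro mult_mono) auto
  qed
  moreover have "(\<lambda>n::int. B * exp (- (pi * (Re u / 2)) * of_int n ^ 2 + 0 * of_int \<bar>n\<bar>)) summable_on UNIV"
    by (intro summable_on_cmult_right summable_gaussian_int) (use u in auto)
  moreover have "cball u (Re u / 2) \<subseteq> {t. Re t > 0}"
    using sub u by force
  ultimately show "\<exists>r>0. \<exists>M. cball u r \<subseteq> {t. Re t > 0} \<and> M summable_on UNIV \<and>
      (\<forall>n\<in>UNIV. \<forall>w\<in>cball u r. norm (\<phi> n * exp (- of_real pi * of_int n ^ 2 * w)) \<le> M n)"
    using u by (intro exI[of _ "Re u / 2"] conjI exI) auto
qed (auto intro!: holomorphic_intros)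

lemma norm_nome_less_1: "\<tau> \<in> upper_half \<Longrightarrow> norm (nome \<tau>) < 1"
  by (simp add: norm_nome upper_half_def)

lemma chi12_6k_plus_1: "chi12 (6 * k + 1) = (if even k then 1 else - 1)"
proof (cases "even k")
  case True
  then obtain m where "k = 2 * m" by auto
  thus ?thesis using chi12_add_mult_12[of "12 * m" 1] by (simp add: add.commute)
next
  case False
  then obtain m where "k = 2 * m + 1" by (auto elim: oddE)
  thus ?thesis using chi12_add_mult_12[of "12 * m" 7]
    by (simp add: algebra_simps) (simp add: chi12_eq mod12_char_def)
qed

text \<open>The character vanishes unless \<open>n\<close> is \<open>6 k + 1\<close> or the negative of such a number, and
  \<open>(6 k + 1)\<^sup>2 = 24 (k (3 k + 1) / 2) + 1\<close>: the pentagonal exponents shifted by \<open>1 / 24\<close>.\<close>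

theorem eta_eq_theta_series:
  assumes \<tau>: "\<tau> \<in> upper_half"
  shows "2 * dedekind_eta \<tau> = theta_series chi12 (- \<i> * \<tau> / 12)"
proof -
  define t where "t = - \<i> * \<tau> / 12"
  have t: "Re t > 0" using \<tau> by (simp add: t_def upper_half_def)
  define f where "f = (\<lambda>n::int. chi12 n * exp (- of_real pi * of_int n ^ 2 * t))"
  define q where "q = nome \<tau>"
  have q: "norm q < 1" unfolding q_def by (rule norm_nome_less_1[OF \<tau>])
  define h where "h = (\<lambda>k. f (6 * k + 1))"
  have sf: "f summable_on UNIV"
    unfolding f_def by (rule theta_series_summable[OF t norm_chi12_le])
  have sh: "h summable_on UNIV"
    using summable_on_reindex[of "\<lambda>k. 6 * k + 1" UNIV f] summable_on_subset_banach[OF sf]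
    by (auto simp: h_def o_def inj_on_def)
  have "theta_series chi12 t = infsum f UNIV" by (simp add: theta_series_def f_def)
  also have "\<dots> = (\<Sum>j<6. \<Sum>\<^sub>\<infinity>k\<in>UNIV. f (k * int 6 + int j))"
    by (rule infsum_int_residue_classes[OF sf, symmetric]) simp
  also have "\<dots> = infsum h UNIV + infsum h UNIV"
  proof -
    have z: "f (k * 6 + j) = 0" if "j \<in> {0, 2, 3, 4}" for k j
    proof -
      have "k * 6 + j = 2 * (k * 3 + j div 2) \<or> k * 6 + j = 3 * (k * 2 + j div 3)" using that by auto
      moreover have "chi12 2 = 0" "chi12 3 = 0" by (simp_all add: chi12_eq mod12_char_def)
      ultimately have "chi12 (k * 6 + j) = 0" by (metis chi12_mult mult_zero_left)
      thus ?thesis by (simp add: f_def)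
    qed
    have "f (k * 6 + 5) = h (- k - 1)" for k
    proof -
      have e: "6 * (- k - 1) + 1 = - (k * 6 + 5)" by simp
      show ?thesis unfolding h_def e f_def by (simp only: chi12_minus of_int_minus power2_minus)
    qed
    moreover have "(\<Sum>\<^sub>\<infinity>k\<in>UNIV. h (- k - 1)) = infsum h UNIV"
      by (rule infsum_reindex_bij_witness[of _ "\<lambda>k. - k - 1" "\<lambda>k. - k - 1"]) auto
    ultimately have "(\<Sum>\<^sub>\<infinity>k\<in>UNIV. f (k * 6 + 5)) = infsum h UNIV" by simp
    moreover have "(\<Sum>\<^sub>\<infinity>k\<in>UNIV. f (k * 6 + 1)) = infsum h UNIV" by (simp add: h_def mult.commute)
    moreover have "(\<Sum>\<^sub>\<infinity>k\<in>UNIV. f (k * 6 + j)) = 0" if "j \<in> {0, 2, 3, 4}" for j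
      using z[OF that] by simp
    from this[of 0] this[of 2] this[of 3] this[of 4]
    have "(\<Sum>\<^sub>\<infinity>k\<in>UNIV. f (k * 6)) = 0" "(\<Sum>\<^sub>\<infinity>k\<in>UNIV. f (k * 6 + 2)) = 0"
         "(\<Sum>\<^sub>\<infinity>k\<in>UNIV. f (k * 6 + 3)) = 0" "(\<Sum>\<^sub>\<infinity>k\<in>UNIV. f (k * 6 + 4)) = 0"
      by simp_all
    ultimately show ?thesis
      by (simp add: lessThan_nat_numeral lessThan_Suc)
  qed
  finally have 1: "theta_series chi12 t = 2 * infsum h UNIV" by simp
  define a where "a = exp (2 * of_real pi * \<i> * \<tau> / 24)"
  have hk: "h k = a * ((if even k then 1 else - 1) * nome (of_int (k * (3 * k + 1) div 2) * \<tau>))" for k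
  proof -
    have "2 dvd k * (3 * k + 1)" by simp
    then obtain m where m: "k * (3 * k + 1) = 2 * m" unfolding dvd_def by blast
    have sq: "(6 * k + 1) ^ 2 = 24 * m + 1"
      using m by (simp add: power2_eq_square algebra_simps)
    have "exp (- of_real pi * of_int (6 * k + 1) ^ 2 * t) = exp (- of_real pi * of_int (24 * m + 1) * t)"
      unfolding of_int_power[symmetric] sq ..
    also have "\<dots> = a * nome (of_int m * \<tau>)"
      by (simp add: a_def nome_def t_def algebra_simps flip: exp_add)
    finally show ?thesis
      by (simp add: h_def f_def chi12_6k_plus_1 m)
  qed
  have tri: "2 * int (\<Sum>{..j}) = int j * (int j + 1)" for j
    by (induction j) (auto simp: algebra_simps)
  have qpow: "nome (of_int (int n) * \<tau>) = q ^ n" for n by (simp add: q_def nome_power)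
  have pos: "h (int j) = a * ((-1) ^ j * q ^ (j * j + \<Sum>{..j}))" for j
  proof -
    have "int j * (3 * int j + 1) = 2 * int (j * j + \<Sum>{..j})"
      using tri[of j] by (simp add: algebra_simps)
    hence "int j * (3 * int j + 1) div 2 = int (j * j + \<Sum>{..j})" by simp
    thus ?thesis unfolding hk qpow[symmetric] by (simp add: minus_one_power_iff)
  qed
  have neg: "h (- 1 - int j) = a * ((-1) ^ Suc j * q ^ (j * Suc j + \<Sum>{..Suc j}))" for j
  proof -
    have "(- 1 - int j) * (3 * (- 1 - int j) + 1) = 2 * int (j * Suc j + \<Sum>{..Suc j})"
      using tri[of "Suc j"] by (simp add: algebra_simps)
    hence "(- 1 - int j) * (3 * (- 1 - int j) + 1) div 2 = int (j * Suc j + \<Sum>{..Suc j})" by simp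
    thus ?thesis unfolding hk qpow[symmetric] by (simp add: minus_one_power_iff)
  qed
  have "(\<lambda>n. \<Sum>j<n. h (int j) + h (- 1 - int j)) \<longlonglongrightarrow> infsum h UNIV"
    using infsum_int_sums[OF sh] by (simp add: sums_def)
  moreover have "(\<lambda>n. \<Sum>j<n. h (int j) + h (- 1 - int j)) \<longlonglongrightarrow> a * (\<Prod>n. 1 - q ^ Suc n)"
    unfolding pos neg ring_distribs(1)[symmetric] sum_distrib_left[symmetric]
    by (intro tendsto_mult_left pentagonal_sums q)
  ultimately have "infsum h UNIV = a * (\<Prod>n. 1 - q ^ Suc n)" by (rule LIMSEQ_unique)
  also have "\<dots> = dedekind_eta \<tau>"
    by (simp add: dedekind_eta_def a_def q_def)
  finally show ?thesis using 1 by (simp add: t_def)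
qed

section \<open>Analytic properties of the eta and theta functions\<close>

lemma dedekind_eta_holomorphic: "dedekind_eta holomorphic_on upper_half"
proof (rule holomorphic_transform)
  have "theta_series chi12 \<circ> (\<lambda>\<tau>. - \<i> * \<tau> / 12) holomorphic_on upper_half"
    by (rule holomorphic_on_compose_gen[OF _ theta_series_holomorphic[OF norm_chi12_le]])
       (auto simp: upper_half_def intro!: holomorphic_intros)
  thus "(\<lambda>\<tau>. theta_series chi12 (- \<i> * \<tau> / 12) / 2) holomorphic_on upper_half"
    by (intro holomorphic_intros) (simp_all add: o_def)
qed (use eta_eq_theta_series in \<open>simp add: field_simps\<close>)

lemma dedekind_eta_nonzero: "\<tau> \<in> upper_half \<Longrightarrow> dedekind_eta \<tau> \<noteq> 0"
  unfolding dedekind_eta_def using euler_product_convergent(2)[OF norm_nome_less_1] by simp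

lemma dedekind_eta_conv_nome:
  "dedekind_eta \<tau> = nome (\<tau> / 24) * (\<Prod>n. 1 - nome \<tau> ^ Suc n)"
  by (simp add: dedekind_eta_def nome_def)

lemma dedekind_eta_add_1: "dedekind_eta (\<tau> + 1) = nome (1 / 24) * dedekind_eta \<tau>"
  unfolding dedekind_eta_conv_nome by (simp add: nome_add add_divide_distrib)

lemma euler_product_tendsto_1: "((\<lambda>q :: complex. \<Prod>n. 1 - q ^ Suc n) \<longlongrightarrow> 1) (at 0)"
proof -
  define A where "A = cball (0 :: complex) (1 / 2)"
  have A: "norm q \<le> 1 / 2" if "q \<in> A" for q using that by (simp add: A_def)
  have "uniformly_convergent_on A (\<lambda>N q. \<Sum>n<N. norm (- (q ^ Suc n)))"
  proof (rule Weierstrass_m_test')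
    show "norm (norm (- (q ^ Suc n))) \<le> (1 / 2) ^ Suc n" if "q \<in> A" for n q
    proof -
      have "norm (norm (- (q ^ Suc n))) = norm q ^ Suc n" by (simp add: norm_mult norm_power)
      thus ?thesis using A[OF that] by (simp only:) (intro power_mono, auto)
    qed
    show "summable (\<lambda>n. (1 / 2 :: real) ^ Suc n)"
      by (subst summable_Suc_iff) (auto intro: summable_geometric)
  qed
  hence "uniformly_convergent_on A (\<lambda>N q. \<Prod>n<N. 1 + - (q ^ Suc n))"
    by (intro uniformly_convergent_on_prod) (auto simp: A_def intro!: continuous_intros)
  hence "uniform_limit A (\<lambda>N q. \<Prod>n<N. 1 + - (q ^ Suc n)) (\<lambda>q. lim (\<lambda>N. \<Prod>n<N. 1 + - (q ^ Suc n))) sequentially"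
    by (simp only: uniformly_convergent_uniform_limit_iff)
  moreover have "lim (\<lambda>N. \<Prod>n<N. 1 + - (q ^ Suc n)) = (\<Prod>n. 1 + - (q ^ Suc n))" if "q \<in> A" for q
  proof (rule limI)
    have "norm q < 1" using A[OF that] by simp
    from euler_product_convergent(3)[OF this]
    show "(\<lambda>N. \<Prod>n<N. 1 + - (q ^ Suc n)) \<longlonglongrightarrow> (\<Prod>n. 1 + - (q ^ Suc n))" by simp
  qed
  ultimately have "uniform_limit A (\<lambda>N q. \<Prod>n<N. 1 + - (q ^ Suc n)) (\<lambda>q. \<Prod>n. 1 + - (q ^ Suc n)) sequentially"
    by (simp cong: uniform_limit_cong')
  hence "continuous_on A (\<lambda>q. \<Prod>n. 1 + - (q ^ Suc n))"
    by (rule uniform_limit_theorem[rotated]) (auto intro!: always_eventually continuous_intros)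
  hence "isCont (\<lambda>q :: complex. \<Prod>n. 1 + - (q ^ Suc n)) 0"
    by (rule continuous_on_interior) (simp add: A_def)
  thus ?thesis by (simp add: isCont_def)
qed

lemma eventually_at_im_infty: "eventually P at_im_infty \<longleftrightarrow> (\<exists>y. \<forall>\<tau>. Im \<tau> \<ge> y \<longrightarrow> P \<tau>)"
  unfolding at_im_infty_def eventually_filtercomap eventually_at_top_linorder
  by (metis order_refl)

lemma eventually_at_im_inftyI: "(\<And>\<tau>. Im \<tau> > y \<Longrightarrow> P \<tau>) \<Longrightarrow> eventually P at_im_infty"
  unfolding eventually_at_im_infty by (intro exI[of _ "y + 1"]) auto

lemma eventually_upper_half: "eventually (\<lambda>\<tau>. \<tau> \<in> upper_half) at_im_infty"
  by (rule eventually_at_im_inftyI[of 0]) (simp add: upper_half_def)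

lemma filterlim_Im_at_im_infty: "filterlim Im at_top at_im_infty"
  unfolding at_im_infty_def by (rule filterlim_filtercomap)

lemma filterlim_at_im_inftyI: "filterlim (\<lambda>x. Im (f x)) at_top F \<Longrightarrow> filterlim f at_im_infty F"
  unfolding at_im_infty_def by (simp add: filterlim_filtercomap_iff o_def)

lemma nome_tendsto_0: "filterlim nome (at 0) at_im_infty"
proof -
  have "((\<lambda>y. exp (- 2 * pi * y)) \<longlongrightarrow> 0) at_top" by real_asymp
  hence "((\<lambda>\<tau>. exp (- 2 * pi * Im \<tau>)) \<longlongrightarrow> 0) at_im_infty"
    by (rule filterlim_compose[OF _ filterlim_Im_at_im_infty])
  hence "(nome \<longlongrightarrow> 0) at_im_infty"
    by (subst tendsto_norm_zero_iff[symmetric]) (simp add: norm_nome)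
  thus ?thesis by (simp add: filterlim_at)
qed

lemma euler_product_nome_tendsto_1:
  "((\<lambda>\<tau>. \<Prod>n. 1 - nome \<tau> ^ Suc n) \<longlongrightarrow> 1) at_im_infty"
  by (rule filterlim_compose[OF euler_product_tendsto_1 nome_tendsto_0])

lemma dedekind_eta_tendsto_0: "(dedekind_eta \<longlongrightarrow> 0) at_im_infty"
proof -
  have "filterlim (\<lambda>\<tau>. \<tau> / 24) at_im_infty at_im_infty"
    by (intro filterlim_at_im_inftyI)
       (use filterlim_tendsto_pos_mult_at_top[OF tendsto_const[of "1 / 24"] _ filterlim_Im_at_im_infty] in simp)
  hence "((\<lambda>\<tau>. nome (\<tau> / 24)) \<longlongrightarrow> 0) at_im_infty"
    using nome_tendsto_0 by (auto simp: filterlim_at intro: filterlim_compose)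
  from tendsto_mult[OF this euler_product_nome_tendsto_1] show ?thesis
    unfolding dedekind_eta_conv_nome[abs_def] by simp
qed

lemma theta_eq_theta_series: "theta \<tau> = theta_series (\<lambda>_. 1) (- 2 * \<i> * \<tau>)"
  unfolding theta_def theta_series_def by (intro infsum_cong) (simp add: mult_ac)

lemma theta_term: "exp (2 * of_real pi * \<i> * of_int (n ^ 2) * \<tau>) = nome (of_int (n ^ 2) * \<tau>)"
  unfolding nome_def by (simp only: mult.assoc)

lemma theta_add_of_int: "theta (\<tau> + of_int k) = theta \<tau>"
proof -
  have "exp (2 * of_real pi * \<i> * of_int (n ^ 2) * (\<tau> + of_int k)) = exp (2 * of_real pi * \<i> * of_int (n ^ 2) * \<tau>)" for n
  proof -
    have "of_int (n ^ 2) * (\<tau> + of_int k) = of_int (n ^ 2) * \<tau> + of_int (n ^ 2 * k)"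
      by (simp add: ring_distribs)
    thus ?thesis unfolding theta_term by (simp only: nome_add_of_int)
  qed
  thus ?thesis unfolding theta_def by simp
qed

lemma Re_csqrt_pos: "Re z > 0 \<Longrightarrow> Re (csqrt z) > 0"
  using csqrt_principal[of z] power2_csqrt[of z]
  by (auto simp: power2_eq_square complex_eq_iff)

lemma csqrt_one_over: "Re z > 0 \<Longrightarrow> csqrt (1 / z) = 1 / csqrt z"
  by (intro csqrt_unique) (auto simp: power_divide intro: Re_one_over_pos Re_csqrt_pos)

text \<open>Inversion turns \<open>theta\<close> at \<open>\<tau>\<close> into a sum over odd squares, that is over triangular
  numbers, and Gauss' product for that sum has no zero.\<close>

theorem theta_nonzero:
  assumes \<tau>: "\<tau> \<in> upper_half"
  shows "theta \<tau> \<noteq> 0"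
proof -
  \<comment> \<open>as \<open>n\<^sup>2\<close> and \<open>n\<close> have the same parity, translating by one half produces the signs \<open>(-1)\<^sup>n\<close>\<close>
  define t where "t = - 2 * \<i> * (\<tau> - 1 / 2)"
  have t: "Re t > 0" using \<tau> by (simp add: t_def upper_half_def)
  define \<phi> where "\<phi> = (\<lambda>n::int. nome (of_int n / 2))"
  have \<phi>2: "\<phi> (n + int 2) = \<phi> n" for n by (simp add: \<phi>_def add_divide_distrib)
  have half: "nome (1 / 2) = -1" by (simp add: nome_def)
  define u where "u = 1 / (of_nat 2 ^ 2 * t)"
  have u: "Re u > 0" unfolding u_def by (rule Re_one_over_pos) (use t in simp)
  define g where "g = (\<lambda>n::int. finite_fourier 2 \<phi> n * exp (- of_real pi * of_int n ^ 2 * u))"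
  have ff: "finite_fourier 2 \<phi> m = (if odd m then 2 else 0)" for m
  proof -
    have "finite_fourier 2 \<phi> m = 1 - nome (of_int m / 2)"
      by (simp add: finite_fourier_def \<phi>_def numeral_2_eq_2 half[simplified])
    also have "\<dots> = (if odd m then 2 else 0)"
    proof (cases "odd m")
      case True
      then obtain k where "m = 2 * k + 1" by (auto elim: oddE)
      thus ?thesis by (simp add: add_divide_distrib nome_add half)
    next
      case False
      then obtain k where "m = 2 * k" by auto
      thus ?thesis by simp
    qed
    finally show ?thesis .
  qed
  have sg: "g summable_on UNIV"
    unfolding g_def by (rule theta_series_summable[OF u, of _ 2]) (simp add: ff)
  define q where "q = exp (- 8 * of_real pi * u)"
  have q: "norm q < 1" using u by (simp add: q_def)
  have odd_part: "g (k * 2 + 1) = 2 * exp (- of_real pi * u) * exp (- 4 * of_real pi * u * of_int (k * (k + 1)))" for k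
    by (simp add: g_def ff power2_eq_square algebra_simps flip: exp_add)
  have tri: "2 * int (\<Sum>{..j}) = int j * (int j + 1)" for j
    by (induction j) (auto simp: algebra_simps)
  have pos: "exp (- 4 * of_real pi * u * of_int (int j * (int j + 1))) = q ^ \<Sum>{..j}" for j
  proof -
    have "q ^ \<Sum>{..j} = exp (of_nat (\<Sum>{..j}) * (- 8 * of_real pi * u))"
      by (simp only: q_def exp_of_nat_mult)
    also have "of_nat (\<Sum>{..j}) * (- 8 * of_real pi * u) = - 4 * of_real pi * u * of_int (2 * int (\<Sum>{..j}))"
      by simp
    finally show ?thesis by (simp only: tri)
  qed
  have ss: "(\<lambda>k. g (k * 2 + 1)) summable_on UNIV"
    using summable_on_reindex[of "\<lambda>k. k * 2 + 1" UNIV g] summable_on_subset_banach[OF sg]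
    by (auto simp: o_def inj_on_def)
  have "(\<lambda>j. g (int j * 2 + 1) + g ((- 1 - int j) * 2 + 1)) sums (\<Sum>\<^sub>\<infinity>k\<in>UNIV. g (k * 2 + 1))"
    by (rule infsum_int_sums[OF ss])
  also have "(\<lambda>j. g (int j * 2 + 1) + g ((- 1 - int j) * 2 + 1)) = (\<lambda>j. 4 * exp (- of_real pi * u) * q ^ \<Sum>{..j})"
  proof
    fix j
    have "(- 1 - int j) * (- 1 - int j + 1) = int j * (int j + 1)" by (simp add: algebra_simps)
    thus "g (int j * 2 + 1) + g ((- 1 - int j) * 2 + 1) = 4 * exp (- of_real pi * u) * q ^ \<Sum>{..j}"
      unfolding odd_part by (simp only: pos) simp
  qed
  finally have "(\<lambda>j. 4 * exp (- of_real pi * u) * q ^ \<Sum>{..j}) sums (\<Sum>\<^sub>\<infinity>k\<in>UNIV. g (k * 2 + 1))" .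
  from sums_mult[OF this, of "1 / (4 * exp (- of_real pi * u))"]
  have "(\<lambda>j. q ^ \<Sum>{..j}) sums ((\<Sum>\<^sub>\<infinity>k\<in>UNIV. g (k * 2 + 1)) / (4 * exp (- of_real pi * u)))"
    by simp
  from triangular_series_nonzero[OF q this] have nz: "(\<Sum>\<^sub>\<infinity>k\<in>UNIV. g (k * 2 + 1)) \<noteq> 0" by simp
  have "theta_series (finite_fourier 2 \<phi>) u = (\<Sum>j<2. \<Sum>\<^sub>\<infinity>k\<in>UNIV. g (k * int 2 + int j))"
    unfolding theta_series_def g_def[symmetric]
    using infsum_int_residue_classes[OF sg, of 2] by (simp add: g_def)
  also have "\<dots> = (\<Sum>\<^sub>\<infinity>k\<in>UNIV. g (k * 2)) + (\<Sum>\<^sub>\<infinity>k\<in>UNIV. g (k * 2 + 1))"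
    by (simp add: numeral_2_eq_2)
  also have "(\<Sum>\<^sub>\<infinity>k\<in>UNIV. g (k * 2)) = 0"
    by (simp add: g_def ff)
  finally have "theta_series (finite_fourier 2 \<phi>) u \<noteq> 0" using nz by simp
  moreover have "theta_series \<phi> t = theta_series (finite_fourier 2 \<phi>) u / (of_nat 2 * csqrt t)"
    unfolding u_def by (rule theta_series_inversion[of 2 \<phi> t]) (use \<phi>2 t in auto)
  moreover have "csqrt t \<noteq> 0" using t by auto
  ultimately have "theta_series \<phi> t \<noteq> 0" by simp
  moreover have "theta_series \<phi> t = theta \<tau>"
    unfolding theta_series_def theta_def
  proof (intro infsum_cong)
    fix n :: int
    have "even (n * (1 + n))" by simp
    then obtain k where k: "n * (1 + n) = 2 * k" unfolding dvd_def by blast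
    have "\<phi> n * exp (- of_real pi * of_int n ^ 2 * t)
            = nome (of_int n / 2 + of_int n ^ 2 * (\<tau> - 1 / 2))"
      unfolding nome_add by (simp add: \<phi>_def nome_def t_def algebra_simps flip: exp_add)
    also have "of_int n / 2 + of_int n ^ 2 * (\<tau> - 1 / 2) = of_int n ^ 2 * \<tau> + of_int (n * (1 + n)) / 2 - of_int (n ^ 2)"
      by (simp add: power2_eq_square field_simps)
    also have "\<dots> = of_int n ^ 2 * \<tau> + of_int (k - n ^ 2)"
      unfolding k by simp
    finally show "\<phi> n * exp (- of_real pi * of_int n ^ 2 * t) = exp (2 * of_real pi * \<i> * of_int (n ^ 2) * \<tau>)"
      unfolding theta_term by (simp only: nome_add_of_int of_int_power)
  qed
  ultimately show ?thesis by simp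
qed

section \<open>Transformation under linear fractional maps\<close>

lemma mobius_denominator_nonzero:
  assumes "a * d - b * c = (1::int)" "\<tau> \<in> upper_half"
  shows "of_int c * \<tau> + of_int d \<noteq> 0"
proof
  assume 0: "of_int c * \<tau> + of_int d = 0"
  from arg_cong[OF this, of Im] have "c = 0" using assms(2) by (auto simp: upper_half_def)
  with 0 have "d = 0" by simp
  with \<open>c = 0\<close> assms(1) show False by simp
qed

lemma Im_mobius:
  assumes "a * d - b * c = (1::int)"
  shows "Im (mobius a b c d \<tau>) = Im \<tau> / norm (of_int c * \<tau> + of_int d) ^ 2"
proof -
  have "real_of_int a * real_of_int d - real_of_int b * real_of_int c = 1"
    using assms by (metis of_int_1 of_int_diff of_int_mult)
  hence "Im \<tau> * (real_of_int a * real_of_int d - real_of_int b * real_of_int c) = Im \<tau>" by simp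
  hence "Im (of_int a * \<tau> + of_int b) * Re (of_int c * \<tau> + of_int d)
          - Re (of_int a * \<tau> + of_int b) * Im (of_int c * \<tau> + of_int d) = Im \<tau>"
    by (simp add: algebra_simps)
  thus ?thesis by (simp only: mobius_def Im_divide cmod_power2)
qed

lemma mobius_in_upper_half:
  assumes "a * d - b * c = (1::int)" "\<tau> \<in> upper_half"
  shows "mobius a b c d \<tau> \<in> upper_half"
  using mobius_denominator_nonzero[OF assms] assms(2) by (simp add: upper_half_def Im_mobius[OF assms(1)])

lemma mobius_partial_fraction:
  assumes det: "a * d - b * c = (1::int)" and \<tau>: "\<tau> \<in> upper_half" and c: "c \<noteq> 0"
  shows "mobius a b c d \<tau> = of_int a / of_int c - 1 / (of_int c * (of_int c * \<tau> + of_int d))"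
proof -
  have nz: "of_int c * \<tau> + of_int d \<noteq> (0::complex)"
    by (rule mobius_denominator_nonzero[OF det \<tau>])
  have "of_int a * of_int d - of_int b * of_int c = (1::complex)"
    using det by (metis of_int_1 of_int_diff of_int_mult)
  hence "of_int c * (of_int a * \<tau> + of_int b) = of_int a * (of_int c * \<tau> + of_int d) - (1::complex)"
    by (simp add: algebra_simps)
  hence "of_int a * \<tau> + of_int b = (of_int a * (of_int c * \<tau> + of_int d) - 1) / (of_int c :: complex)"
    using c by (simp add: nonzero_eq_divide_eq mult.commute)
  thus ?thesis unfolding mobius_def using nz c by (simp add: diff_divide_distrib)
qed

lemma neg_i_times_denominator:
  assumes "c > 0" "\<tau> \<in> upper_half"
  shows "Re (- \<i> * (of_int c * \<tau> + of_int d)) > 0"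
  using assms by (simp add: upper_half_def)

text \<open>Only residues divisible by 12 contribute to a quadratic exponential sum whose modulus is a
  multiple of 576: shifting the variable by \<open>C / 24\<close> twists the coefficients by a character modulo
  12.\<close>

lemma twisted_gauss_sum_576:
  fixes \<kappa> :: "int \<Rightarrow> complex"
  assumes C: "C > 0" "576 dvd C" and a: "coprime a (int C)" and per: "\<And>n. \<kappa> (n + 12) = \<kappa> n"
  shows "(\<Sum>r<C. \<kappa> (int r) * nome (of_int (a * int r ^ 2) / of_nat C)) = \<kappa> 0 * gauss_sum a C"
proof -
  obtain k where k: "C = 576 * k" using C(2) by blast
  have a12: "coprime a 12"
    by (rule coprime_divisors[OF dvd_refl _ a]) (simp add: k)
  define E where "E = (\<lambda>r::int. nome (of_int (a * r ^ 2) / of_nat C))"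
  define S where "S = (\<lambda>\<kappa>. \<Sum>r<C. \<kappa> (int r) * E (int r))"
  define Z where "Z = (\<Sum>r<C. if 12 dvd r then E (int r) else 0)"
  have main: "S \<kappa> = \<kappa> 0 * Z" if per: "\<And>n. \<kappa> (n + 12) = \<kappa> n" for \<kappa> :: "int \<Rightarrow> complex"
  proof -
    have twist: "S \<kappa> = S (\<lambda>r. \<kappa> r * nome (of_int (a * r) / 12))"
      if per: "\<And>n. \<kappa> (n + 12) = \<kappa> n" for \<kappa> :: "int \<Rightarrow> complex"
    proof -
      have p12: "\<kappa> (n + int (12 * j)) = \<kappa> n" for n j
        using periodic_mod(1)[of \<kappa> 12 n "int j", OF per] by (simp add: mult.commute)
      have perF: "\<kappa> (n + int C) * E (n + int C) = \<kappa> n * E n" for n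
        using p12[of n "48 * k"] nome_quadratic_periodic[OF C(1), of a n] by (simp add: E_def k)
      have "S \<kappa> = (\<Sum>r<C. \<kappa> (int r + int (24 * k)) * E (int r + int (24 * k)))"
        unfolding S_def by (rule sum_periodic_shift[OF C(1), of "\<lambda>r. \<kappa> r * E r", symmetric]) (rule perF)
      also have "\<dots> = S (\<lambda>r. \<kappa> r * nome (of_int (a * r) / 12))"
        unfolding S_def
      proof (intro sum.cong refl)
        fix r
        have "(of_int (a * (int r + int (24 * k)) ^ 2) / of_nat C :: complex)
                = of_int (a * int r ^ 2) / of_nat C + of_int (a * int r) / 12 + of_int (a * int k)"
          using C(1) by (simp add: k field_simps power2_eq_square)
        hence "E (int r + int (24 * k)) = E (int r) * nome (of_int (a * int r) / 12)"
          by (simp only: E_def nome_add nome_of_int) simp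
        moreover have "\<kappa> (int r + int (24 * k)) = \<kappa> (int r)"
          using p12[of "int r" "2 * k"] by simp
        ultimately show "\<kappa> (int r + int (24 * k)) * E (int r + int (24 * k))
            = \<kappa> (int r) * nome (of_int (a * int r) / 12) * E (int r)" by simp
      qed
      finally show ?thesis .
    qed
    have "S \<kappa> = S (\<lambda>r. \<kappa> r * nome (of_int (a * r) / 12) ^ j)" for j
    proof (induction j)
      case (Suc j)
      have "nome (of_int (a * (n + 12)) / 12) = nome (of_int (a * n) / 12)" for n
        by (simp add: ring_distribs add_divide_distrib nome_add)
      with twist[of "\<lambda>r. \<kappa> r * nome (of_int (a * r) / 12) ^ j"] Suc per show ?case
        by (simp add: mult_ac)
    qed simp
    hence "(\<Sum>j<12::nat. S \<kappa>) = (\<Sum>j<12::nat. S (\<lambda>r. \<kappa> r * nome (of_int (a * r) / 12) ^ j))"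
      by (rule sum.cong[OF refl])
    also have "\<dots> = (\<Sum>r<C. \<Sum>j<12. \<kappa> (int r) * nome (of_int (a * int r) / 12) ^ j * E (int r))"
      unfolding S_def by (rule sum.swap)
    also have "\<dots> = (\<Sum>r<C. 12 * (\<kappa> 0 * (if 12 dvd r then E (int r) else 0)))"
    proof (intro sum.cong refl)
      fix r
      have pw: "nome (of_int (a * int r) / 12) ^ j = nome (of_int (a * int r) * of_nat j / of_nat 12)" for j
        by (simp add: nome_power mult_ac)
      have "(\<Sum>j<12. \<kappa> (int r) * nome (of_int (a * int r) / 12) ^ j * E (int r))
          = \<kappa> (int r) * E (int r) * (\<Sum>j<12. nome (of_int (a * int r) / 12) ^ j)"
        by (simp add: sum_distrib_left mult_ac)
      also have "(\<Sum>j<12. nome (of_int (a * int r) / 12) ^ j) = (if int 12 dvd a * int r then of_nat 12 else 0)"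
        unfolding pw by (rule sum_nome_root_of_unity) simp
      also have "int 12 dvd a * int r \<longleftrightarrow> 12 dvd r"
      proof -
        have "int 12 dvd a * int r \<longleftrightarrow> int 12 dvd int r"
          using a12 by (simp add: coprime_dvd_mult_right_iff coprime_commute)
        thus ?thesis by (simp only: of_nat_dvd_iff)
      qed
      also have "\<kappa> (int r) * E (int r) * (if 12 dvd r then of_nat 12 else 0)
          = 12 * (\<kappa> 0 * (if 12 dvd r then E (int r) else 0))"
      proof (cases "12 dvd r")
        case True
        then obtain j where "r = 12 * j" by auto
        hence "\<kappa> (int r) = \<kappa> 0"
          using periodic_mod(1)[of \<kappa> 12 0 "int j", OF per] by (simp add: mult.commute)
        thus ?thesis using True by simp
      qed simp
      finally show "(\<Sum>j<12. \<kappa> (int r) * nome (of_int (a * int r) / 12) ^ j * E (int r))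
          = 12 * (\<kappa> 0 * (if 12 dvd r then E (int r) else 0))" .
    qed
    also have "\<dots> = 12 * (\<kappa> 0 * Z)" by (simp add: Z_def sum_distrib_left)
    finally show "S \<kappa> = \<kappa> 0 * Z" by simp
  qed
  have "gauss_sum a C = S (\<lambda>_. 1)" by (simp add: gauss_sum_def S_def E_def)
  also have "\<dots> = Z" using main[of "\<lambda>_. 1"] by simp
  finally show ?thesis using main[of \<kappa>] per by (simp add: S_def E_def)
qed

lemma finite_fourier_quadratic:
  "finite_fourier C (\<lambda>n. \<phi> n * nome (of_int n ^ 2 * of_real (of_int a / of_nat C))) m
     = (\<Sum>r<C. \<phi> (int r) * nome (of_int (a * int r ^ 2 + m * int r) / of_nat C))"
proof -
  have "of_int (a * int r ^ 2 + m * int r) / of_nat C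
          = of_int (int r) ^ 2 * of_real (of_int a / of_nat C) + (of_int m * of_nat r / of_nat C :: complex)" for r
    by (simp add: add_divide_distrib mult_ac)
  thus ?thesis unfolding finite_fourier_def by (simp only: nome_add mult.assoc)
qed

text \<open>Completing the square is possible for even frequencies; for odd ones a shift by \<open>C / 2\<close> changes the
  sign of the sum.\<close>

lemma finite_fourier_576:
  fixes \<phi> :: "int \<Rightarrow> complex"
  assumes C: "C > 0" "576 dvd C" and ad: "[a * d = 1] (mod int C)" and per: "\<And>n. \<phi> (n + 12) = \<phi> n"
  defines "ff \<equiv> finite_fourier C (\<lambda>n. \<phi> n * nome (of_int n ^ 2 * of_real (of_int a / of_nat C)))"
  shows "odd m \<Longrightarrow> ff m = 0"
    and "ff (2 * m) = \<phi> (- d * m) * nome (- of_int (d * m ^ 2) / of_nat C) * gauss_sum a C"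
proof -
  obtain k where k: "C = 576 * k" using C(2) by blast
  have p12: "\<phi> (n + int (12 * j)) = \<phi> n" for n j
    using periodic_mod(1)[of \<phi> 12 n "int j", OF per] by (simp add: mult.commute)
  define F where "F = (\<lambda>m r. \<phi> r * nome (of_int (a * r ^ 2 + m * r) / of_nat C))"
  have perF: "F m (n + int C) = F m n" for m n
  proof -
    have "a * (n + int C) ^ 2 + m * (n + int C) - (a * n ^ 2 + m * n) = int C * (a * (2 * n + int C) + m)"
      by (simp add: power2_eq_square algebra_simps)
    hence "[a * (n + int C) ^ 2 + m * (n + int C) = a * n ^ 2 + m * n] (mod int C)"
      by (simp add: cong_iff_dvd_diff)
    from nome_cong[OF C(1) this] show ?thesis
      using p12[of n "48 * k"] by (simp add: F_def k)
  qed
  have ff: "ff m = (\<Sum>r<C. F m (int r))" for m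
    unfolding ff_def F_def by (rule finite_fourier_quadratic)
  show "ff m = 0" if "odd m"
  proof -
    obtain j where j: "m = 2 * j + 1" using \<open>odd m\<close> by (auto elim: oddE)
    have "ff m = (\<Sum>r<C. F m (int r + int (288 * k)))"
      unfolding ff by (rule sum_periodic_shift[OF C(1), of "F m", symmetric]) (rule perF)
    also have "\<dots> = (\<Sum>r<C. - F m (int r))"
    proof (intro sum.cong refl)
      fix r
      have "(of_int (a * (int r + int (288 * k)) ^ 2 + m * (int r + int (288 * k))) / of_nat C :: complex)
              = of_int (a * int r ^ 2 + m * int r) / of_nat C + of_int (a * int r + 144 * a * int k + j) + 1 / 2"
        using C(1) by (simp add: k j field_simps power2_eq_square)
      moreover have "nome (1 / 2) = -1" by (simp add: nome_def)
      ultimately have "nome (of_int (a * (int r + int (288 * k)) ^ 2 + m * (int r + int (288 * k))) / of_nat C)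
          = - nome (of_int (a * int r ^ 2 + m * int r) / of_nat C)"
        by (simp only: nome_add nome_of_int) simp
      thus "F m (int r + int (288 * k)) = - F m (int r)"
        using p12[of "int r" "24 * k"] by (simp add: F_def)
    qed
    finally show "ff m = 0" unfolding ff by (simp add: sum_negf)
  qed
  show "ff (2 * m) = \<phi> (- d * m) * nome (- of_int (d * m ^ 2) / of_nat C) * gauss_sum a C"
  proof -
    have cop: "coprime a (int C)"
      using ad by (metis coprime_iff_invertible_int)
    have "ff (2 * m) = (\<Sum>r<C. F (2 * m) (int r + (- d * m)))"
      unfolding ff by (rule sum_periodic_shift[OF C(1), of "F (2 * m)", symmetric]) (rule perF)
    also have "\<dots> = (\<Sum>r<C. nome (- of_int (d * m ^ 2) / of_nat C) *
        (\<phi> (int r + - d * m) * nome (of_int (a * int r ^ 2) / of_nat C)))"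
    proof (intro sum.cong refl)
      fix r
      have "a * (int r + - d * m) ^ 2 + 2 * m * (int r + - d * m) - (a * int r ^ 2 - d * m ^ 2)
              = (a * d - 1) * (d * m ^ 2 - 2 * m * int r)"
        by (simp add: power2_eq_square algebra_simps)
      moreover have "int C dvd a * d - 1" using ad by (simp add: cong_iff_dvd_diff)
      ultimately have "[a * (int r + - d * m) ^ 2 + 2 * m * (int r + - d * m) = a * int r ^ 2 - d * m ^ 2] (mod int C)"
        by (simp add: cong_iff_dvd_diff)
      from nome_cong[OF C(1) this]
      show "F (2 * m) (int r + (- d * m)) = nome (- of_int (d * m ^ 2) / of_nat C) *
          (\<phi> (int r + - d * m) * nome (of_int (a * int r ^ 2) / of_nat C))"
        by (simp add: F_def nome_add[symmetric] diff_divide_distrib)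
    qed
    also have "\<dots> = nome (- of_int (d * m ^ 2) / of_nat C) *
        (\<Sum>r<C. \<phi> (int r + - d * m) * nome (of_int (a * int r ^ 2) / of_nat C))"
      by (rule sum_distrib_left[symmetric])
    also have "(\<Sum>r<C. \<phi> (int r + - d * m) * nome (of_int (a * int r ^ 2) / of_nat C))
        = \<phi> (0 + - d * m) * gauss_sum a C"
    proof (rule twisted_gauss_sum_576[OF C cop])
      show "\<phi> (n + 12 + - d * m) = \<phi> (n + - d * m)" for n
        using per[of "n + - d * m"] by (simp add: algebra_simps)
    qed
    finally show ?thesis by simp
  qed
qed

lemma theta_series_even_support:
  assumes "\<And>n. odd n \<Longrightarrow> \<phi> n = 0"
  shows "theta_series \<phi> t = theta_series (\<lambda>n. \<phi> (2 * n)) (4 * t)"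
proof -
  have "theta_series \<phi> t = infsum (\<lambda>n. \<phi> n * exp (- of_real pi * of_int n ^ 2 * t)) (range (\<lambda>n. 2 * n))"
    unfolding theta_series_def by (rule infsum_cong_neutral) (use assms in \<open>auto elim!: evenE\<close>)
  also have "\<dots> = (\<Sum>\<^sub>\<infinity>n\<in>UNIV. \<phi> (2 * n) * exp (- of_real pi * of_int (2 * n) ^ 2 * t))"
    by (subst infsum_reindex) (auto simp: inj_on_def o_def)
  also have "\<dots> = theta_series (\<lambda>n. \<phi> (2 * n)) (4 * t)"
    unfolding theta_series_def by (intro infsum_cong) (simp add: power_mult_distrib mult_ac)
  finally show ?thesis .
qed

lemma theta_series_cmult: "theta_series (\<lambda>n. c * \<phi> n) t = c * theta_series \<phi> t"
  unfolding theta_series_def mult.assoc by (rule infsum_cmult_right')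

text \<open>By the partial fraction of the linear fractional map, the series at the image of \<open>\<tau>\<close> is one
  with coefficients of period \<open>c\<close> at a point that the inversion formula takes back to a translate of \<open>\<tau>\<close>.
  The factor of proportionality does not depend on the coefficients \<open>\<phi>\<close>. Comparing
  \<open>\<phi> = 1\<close> with \<open>\<phi> = chi12\<close> gives the multiplier of the eta function relative to that of
  \<open>theta\<close>, and no Gauss sum has to be evaluated.\<close>

theorem theta_series_mobius_576:
  fixes \<phi> :: "int \<Rightarrow> complex"
  assumes det: "a * d - b * c = (1::int)" and c: "c > 0" "576 dvd c" and \<tau>: "\<tau> \<in> upper_half"
    and per: "\<And>n. \<phi> (n + 12) = \<phi> n"
  shows "theta_series \<phi> (- 2 * \<i> * mobius a b c d \<tau>)
           = gauss_sum a (nat c) / (of_int c * csqrt (2 * \<i> / (of_int c * (of_int c * \<tau> + of_int d))))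
             * theta_series (\<lambda>n. \<phi> (- d * n)) (- 2 * \<i> * \<tau>)"
proof -
  define C where "C = nat c"
  have C: "int C = c" "C > 0" "576 dvd C" "of_nat C = (of_int c :: complex)" "real C = of_int c"
  proof -
    obtain k where "c = 576 * k" using c(2) by blast
    thus "576 dvd C" by (simp add: C_def nat_mult_distrib)
  qed (use c in \<open>auto simp: C_def\<close>)
  define J where "J = of_int c * \<tau> + (of_int d :: complex)"
  define t where "t = 2 * \<i> / (of_int c * J)"
  have J0: "J \<noteq> 0" unfolding J_def by (rule mobius_denominator_nonzero[OF det \<tau>])
  have Re_J: "Re (- \<i> * J) > 0" unfolding J_def by (rule neg_i_times_denominator[OF c(1) \<tau>])
  have t_alt: "t = 1 / (of_real (of_int c / 2) * (- \<i> * J))"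
    using J0 c(1) by (simp add: t_def field_simps)
  have t: "Re t > 0"
  proof -
    have "Re (of_real (of_int c / 2) * (- \<i> * J)) = of_int c / 2 * Re (- \<i> * J)" by simp
    also have "\<dots> > 0" using Re_J c(1) by simp
    finally show ?thesis unfolding t_alt by (rule Re_one_over_pos)
  qed
  define \<psi> where "\<psi> = (\<lambda>n. \<phi> n * nome (of_int n ^ 2 * of_real (of_int a / of_nat C)))"
  have ad: "[a * d = 1] (mod int C)"
    using det by (simp add: cong_iff_dvd_diff C) (metis add_diff_cancel_left' diff_add_cancel dvd_triv_right)
  have "- 2 * \<i> * mobius a b c d \<tau> = t - 2 * \<i> * of_real (of_int a / of_nat C)"
    unfolding mobius_partial_fraction[OF det \<tau> less_imp_neq[OF c(1), symmetric]] J_def[symmetric] t_def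
    by (simp add: C algebra_simps)
  hence "theta_series \<phi> (- 2 * \<i> * mobius a b c d \<tau>) = theta_series \<psi> t"
    by (simp only: theta_series_shift \<psi>_def)
  also have "\<dots> = theta_series (finite_fourier C \<psi>) (1 / (of_nat C ^ 2 * t)) / (of_nat C * csqrt t)"
  proof (rule theta_series_inversion[OF C(2) _ t])
    show "\<psi> (n + int C) = \<psi> n" for n
    proof -
      obtain k where k: "C = 576 * k" using C(3) by blast
      have "\<phi> (n + int C) = \<phi> n"
        using periodic_mod(1)[of \<phi> 12 n "int (48 * k)", OF per] by (simp add: k mult.commute)
      moreover have "nome (of_int (n + int C) ^ 2 * of_real (of_int a / of_nat C))
          = nome (of_int n ^ 2 * of_real (of_int a / of_nat C))"
        using nome_quadratic_periodic[OF C(2), of a n] by (simp add: mult_ac)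
      ultimately show ?thesis by (simp only: \<psi>_def)
    qed
  qed
  also have "theta_series (finite_fourier C \<psi>) (1 / (of_nat C ^ 2 * t))
      = theta_series (\<lambda>m. finite_fourier C \<psi> (2 * m)) (4 * (1 / (of_nat C ^ 2 * t)))"
  proof (rule theta_series_even_support)
    show "finite_fourier C \<psi> m = 0" if "odd m" for m
      unfolding \<psi>_def by (rule finite_fourier_576(1)[where \<phi> = \<phi>, OF C(2,3) ad _ that]) (rule per)
  qed
  also have "4 * (1 / (of_nat C ^ 2 * t)) = - 2 * \<i> * \<tau> - 2 * \<i> * of_real (of_int d / of_nat C)"
    using J0 c(1) by (simp add: t_def C field_simps power2_eq_square) (simp add: J_def algebra_simps)
  also have "theta_series (\<lambda>m. finite_fourier C \<psi> (2 * m)) (- 2 * \<i> * \<tau> - 2 * \<i> * of_real (of_int d / of_nat C))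
      = theta_series (\<lambda>m. gauss_sum a C * \<phi> (- d * m)) (- 2 * \<i> * \<tau>)"
    unfolding theta_series_shift
  proof (rule arg_cong[of _ _ "\<lambda>f. theta_series f _"], rule ext)
    fix m
    have "nome (- of_int (d * m ^ 2) / of_nat C) * nome (of_int m ^ 2 * of_real (of_int d / of_nat C)) = 1"
      by (simp add: nome_add[symmetric] mult_ac)
    moreover have "finite_fourier C \<psi> (2 * m) = \<phi> (- d * m) * nome (- of_int (d * m ^ 2) / of_nat C) * gauss_sum a C"
      unfolding \<psi>_def by (rule finite_fourier_576(2)[where \<phi> = \<phi>, OF C(2,3) ad]) (rule per)
    ultimately show "finite_fourier C \<psi> (2 * m) * nome (of_int m ^ 2 * of_real (of_int d / of_nat C))
        = gauss_sum a C * \<phi> (- d * m)"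
      by (simp add: mult_ac)
  qed
  finally show ?thesis
    unfolding theta_series_cmult t_def J_def C_def using c(1) by simp
qed

section \<open>Multipliers of the eta function\<close>

lemma mobius_uminus: "mobius (- a) (- b) (- c) (- d) \<tau> = mobius a b c d \<tau>"
proof -
  have "mobius (- a) (- b) (- c) (- d) \<tau> = (- (of_int a * \<tau> + of_int b)) / (- (of_int c * \<tau> + of_int d))"
    by (simp add: mobius_def)
  thus ?thesis by (simp only: minus_divide_divide mobius_def)
qed

lemma upper_half_scale [simp]: "24 * \<tau> \<in> upper_half \<longleftrightarrow> \<tau> \<in> upper_half"
  by (simp add: upper_half_def)

lemma eta_theta_ratio_576_pos:
  assumes det: "a * d - b * c = (1::int)" and c: "c > 0" "576 dvd c" and \<tau>: "\<tau> \<in> upper_half"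
  shows "dedekind_eta (24 * mobius a b c d \<tau>) = chi12 d * theta_factor a b c d \<tau> * dedekind_eta (24 * \<tau>)"
proof -
  have eta: "2 * dedekind_eta (24 * w) = theta_series chi12 (- 2 * \<i> * w)" if "w \<in> upper_half" for w
  proof -
    have "- \<i> * (24 * w) / 12 = - 2 * \<i> * w" by simp
    thus ?thesis using eta_eq_theta_series[of "24 * w"] that by (simp only: upper_half_scale)
  qed
  define K where "K = gauss_sum a (nat c) / (of_int c * csqrt (2 * \<i> / (of_int c * (of_int c * \<tau> + of_int d))))"
  have "2 * dedekind_eta (24 * mobius a b c d \<tau>) = K * theta_series (\<lambda>n. chi12 (- d * n)) (- 2 * \<i> * \<tau>)"
    unfolding eta[OF mobius_in_upper_half[OF det \<tau>]] K_def
    by (rule theta_series_mobius_576[OF det c \<tau>]) simp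
  also have "(\<lambda>n. chi12 (- d * n)) = (\<lambda>n. chi12 d * chi12 n)"
    by (simp add: chi12_mult)
  also have "theta_series \<dots> (- 2 * \<i> * \<tau>) = chi12 d * (2 * dedekind_eta (24 * \<tau>))"
    unfolding theta_series_cmult eta[OF \<tau>] ..
  finally have 1: "dedekind_eta (24 * mobius a b c d \<tau>) = K * (chi12 d * dedekind_eta (24 * \<tau>))" by simp
  have "theta (mobius a b c d \<tau>) = K * theta \<tau>"
    unfolding theta_eq_theta_series K_def
    by (rule theta_series_mobius_576[OF det c \<tau>, of "\<lambda>_. 1"]) simp
  hence "theta_factor a b c d \<tau> = K"
    using theta_nonzero[OF \<tau>] by (simp add: theta_factor_def)
  thus ?thesis using 1 by simp
qed

theorem eta_theta_ratio_576:
  assumes det: "a * d - b * c = (1::int)" and c: "576 dvd c" and \<tau>: "\<tau> \<in> upper_half"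
  shows "dedekind_eta (24 * mobius a b c d \<tau>) = chi12 d * theta_factor a b c d \<tau> * dedekind_eta (24 * \<tau>)"
proof (cases c "0 :: int" rule: linorder_cases)
  case greater
  thus ?thesis using eta_theta_ratio_576_pos[OF det _ c \<tau>] by simp
next
  case less
  have "(- a) * (- d) - (- b) * (- c) = 1" using det by simp
  from eta_theta_ratio_576_pos[OF this _ _ \<tau>] less c show ?thesis
    by (simp add: mobius_uminus theta_factor_def)
next
  case equal
  hence ad: "a * d = 1" using det by simp
  then obtain k where k: "mobius a b c d \<tau> = \<tau> + of_int k" and d: "d = 1 \<or> d = -1"
  proof -
    have "(a = 1 \<and> d = 1) \<or> (a = -1 \<and> d = -1)" using ad by (simp add: zmult_eq_1_iff)
    thus ?thesis
    proof
      assume "a = 1 \<and> d = 1"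
      thus ?thesis using that[of b] equal by (simp add: mobius_def)
    next
      assume "a = -1 \<and> d = -1"
      thus ?thesis using that[of "- b"] equal by (simp add: mobius_def)
    qed
  qed
  have "dedekind_eta (24 * (\<tau> + of_int k)) = dedekind_eta (24 * \<tau>)"
  proof -
    have "24 * (\<tau> + of_int k) / 24 = \<tau> + of_int k" "24 * (\<tau> + of_int k) = 24 * \<tau> + of_int (24 * k)"
      by (simp_all add: ring_distribs)
    thus ?thesis unfolding dedekind_eta_conv_nome by (simp only: nome_add_of_int) simp
  qed
  moreover have "chi12 d = 1" using d by auto
  ultimately show ?thesis
    using theta_nonzero[OF \<tau>] by (simp add: k theta_factor_def theta_add_of_int)
qed

text \<open>The sum factors as \<open>x (1 - x\<^sup>6) (1 - x\<^sup>4)\<close> for \<open>x = nome (m / 12)\<close>, which is zero unless \<open>m\<close> is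
  coprime to 12.\<close>

lemma finite_fourier_chi12: "finite_fourier 12 chi12 m = of_real (sqrt 12) * chi12 m"
proof -
  define x where "x = nome (of_int m / 12)"
  define z where "z = nome (1 / 12)"
  have pw: "nome (of_int m * of_nat u / of_nat 12) = x ^ u" for u
    by (simp add: x_def nome_power mult_ac)
  have chi: "chi12 2 = 0" "chi12 3 = 0" "chi12 4 = 0" "chi12 5 = - 1" "chi12 6 = 0" "chi12 7 = - 1"
    "chi12 8 = 0" "chi12 9 = 0" "chi12 10 = 0" "chi12 11 = 1"
    by (simp_all add: chi12_eq mod12_char_def)
  have "finite_fourier 12 chi12 m = x - x ^ 5 - x ^ 7 + x ^ 11"
    unfolding finite_fourier_def pw by (simp add: lessThan_nat_numeral lessThan_Suc chi)
  also have "\<dots> = x * (1 - x ^ 6) * (1 - x ^ 4)"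
    by (simp add: algebra_simps flip: power_Suc power_add)
  finally have S: "finite_fourier 12 chi12 m = x * (1 - x ^ 6) * (1 - x ^ 4)" .
  have x6: "x ^ 6 = nome (of_int m / 2)" and x4: "x ^ 4 = nome (of_int m / 3)"
    by (simp_all add: x_def nome_power)
  have red: "x = z ^ k" if "m mod 12 = int k" for k
  proof -
    have "(of_int m :: complex) = of_int (12 * (m div 12) + int k)"
      using that by (metis mult_div_mod_eq)
    hence m: "(of_int m :: complex) / 12 = of_nat k * (1 / 12) + of_int (m div 12)"
      by (simp only: of_int_add of_int_mult) simp
    show ?thesis unfolding x_def z_def m nome_power nome_add_of_int ..
  qed
  have z: "z = Complex (sqrt 3 / 2) (1 / 2)"
  proof -
    have "z = cis (pi / 6)" by (simp add: z_def nome_def cis_conv_exp)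
    thus ?thesis by (simp add: complex_eq_iff cos_30 sin_30)
  qed
  have z2: "z ^ 2 = Complex (1 / 2) (sqrt 3 / 2)"
    by (simp add: z power2_eq_square complex_eq_iff field_simps)
  have z3: "z ^ 3 = \<i>"
  proof -
    have "z ^ 3 = z ^ 2 * z" by (simp add: power2_eq_square power3_eq_cube)
    thus ?thesis unfolding z2 by (simp add: z complex_eq_iff)
  qed
  have z5: "z ^ 5 = \<i> * z ^ 2" and z6: "z ^ 6 = - 1"
    using power_add[of z 3 2] power_add[of z 3 3] by (simp_all add: z3)
  have s3: "z - z ^ 5 = of_real (sqrt 3)"
    unfolding z5 z2 by (simp add: z complex_eq_iff)
  have s12: "2 * of_real (sqrt 3) = (of_real (sqrt 12) :: complex)"
  proof -
    have "sqrt 12 = sqrt (4 * 3)" by simp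
    also have "\<dots> = 2 * sqrt 3" unfolding real_sqrt_mult by simp
    finally show ?thesis by simp
  qed
  consider "2 dvd m" | "3 dvd m" | "\<not> 2 dvd m" "\<not> 3 dvd m" by blast
  thus ?thesis
  proof cases
    case 1
    then obtain j where j: "m = 2 * j" by auto
    hence "x ^ 6 = 1" unfolding x6 by simp
    moreover have "chi12 m = 0" unfolding j chi12_mult chi by simp
    ultimately show ?thesis by (simp add: S)
  next
    case 2
    then obtain j where j: "m = 3 * j" by auto
    hence "x ^ 4 = 1" unfolding x4 by simp
    moreover have "chi12 m = 0" unfolding j chi12_mult chi by simp
    ultimately show ?thesis by (simp add: S)
  next
    case 3
    have S': "x ^ 6 = -1 \<Longrightarrow> finite_fourier 12 chi12 m = 2 * (x - x ^ 5)"
      unfolding S by (simp add: algebra_simps flip: power_Suc)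
    have z1: "z ^ 25 = z" "z ^ 30 = -1" "z ^ 35 = - (z ^ 5)" "z ^ 7 = - z" "z ^ 42 = -1"
      "z ^ 11 = - (z ^ 5)" "z ^ 55 = - z" "z ^ 66 = -1"
      using power_mult[of z 6 4] power_mult[of z 6 5] power_mult[of z 6 7] power_mult[of z 6 9] power_mult[of z 6 11]
        power_add[of z 24 1] power_add[of z 30 5] power_add[of z 6 1] power_add[of z 6 5] power_add[of z 54 1]
      by (simp_all add: z6)
    show ?thesis
    proof (rule coprime_12_cases[OF 3])
      assume m: "m mod 12 = 1"
      have x: "x = z" using red[of 1] m by simp
      have "chi12 m = 1" using m by (simp add: chi12_eq mod12_char_def)
      thus ?thesis using S' by (simp add: x z6 s3 s12)
    next
      assume m: "m mod 12 = 5"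
      have x: "x = z ^ 5" using red[of 5] m by simp
      have "x ^ 6 = -1" "x ^ 5 = z" unfolding x power_mult[symmetric] using z1 by simp_all
      moreover have "chi12 m = -1" using m by (simp add: chi12_eq mod12_char_def)
      moreover have "z ^ 5 - z = - of_real (sqrt 3)" using s3 by (simp add: algebra_simps)
      ultimately show ?thesis using S' by (simp add: x s12[symmetric])
    next
      assume m: "m mod 12 = 7"
      have x: "x = z ^ 7" using red[of 7] m by simp
      have "x ^ 6 = -1" "x ^ 5 = - (z ^ 5)" unfolding x power_mult[symmetric] using z1 by simp_all
      moreover have "chi12 m = -1" using m by (simp add: chi12_eq mod12_char_def)
      moreover have "- z + z ^ 5 = - of_real (sqrt 3)" using s3 by (simp add: algebra_simps)
      ultimately show ?thesis using S' by (simp add: x z1 s12[symmetric])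
    next
      assume m: "m mod 12 = 11"
      have x: "x = z ^ 11" using red[of 11] m by simp
      have "x ^ 6 = -1" "x ^ 5 = - z" unfolding x power_mult[symmetric] using z1 by simp_all
      moreover have "chi12 m = 1" using m by (simp add: chi12_eq mod12_char_def)
      moreover have "- (z ^ 5) + z = of_real (sqrt 3)" using s3 by (simp add: algebra_simps)
      ultimately show ?thesis using S' by (simp add: x z1 s12[symmetric])
    qed
  qed
qed

lemma gauss_sum_complete_square:
  assumes C: "C > 0" and inv: "[2 * A * e = m] (mod int C)"
  shows "(\<Sum>v<C. nome (of_int (A * int v ^ 2 + m * int v) / of_nat C))
           = nome (- of_int (A * e ^ 2) / of_nat C) * gauss_sum A C"
proof -
  have "gauss_sum A C = (\<Sum>v<C. nome (of_int (A * (int v + e) ^ 2) / of_nat C))"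
    unfolding gauss_sum_def
    by (rule sum_periodic_shift[OF C, of "\<lambda>v. nome (of_int (A * v ^ 2) / of_nat C)", symmetric])
       (rule nome_quadratic_periodic[OF C])
  also have "\<dots> = (\<Sum>v<C. nome (of_int (A * e ^ 2) / of_nat C) * nome (of_int (A * int v ^ 2 + m * int v) / of_nat C))"
  proof (intro sum.cong refl)
    fix v
    have "A * (int v + e) ^ 2 - (A * e ^ 2 + (A * int v ^ 2 + m * int v)) = (2 * A * e - m) * int v"
      by (simp add: power2_eq_square algebra_simps)
    hence "[A * (int v + e) ^ 2 = A * e ^ 2 + (A * int v ^ 2 + m * int v)] (mod int C)"
      using inv by (simp add: cong_iff_dvd_diff)
    from nome_cong[OF C this]
    show "nome (of_int (A * (int v + e) ^ 2) / of_nat C)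
            = nome (of_int (A * e ^ 2) / of_nat C) * nome (of_int (A * int v ^ 2 + m * int v) / of_nat C)"
      by (simp only: of_int_add[of "A * e ^ 2"] add_divide_distrib[of "of_int (A * e ^ 2)"] nome_add)
  qed
  also have "\<dots> = nome (of_int (A * e ^ 2) / of_nat C) * (\<Sum>v<C. nome (of_int (A * int v ^ 2 + m * int v) / of_nat C))"
    by (rule sum_distrib_left[symmetric])
  finally show ?thesis
    by (simp add: nome_minus minus_divide_left[symmetric] field_simps)
qed

text \<open>The Chinese remainder theorem separates the character modulo 12 from the quadratic sum modulo
  \<open>C\<close>.\<close>

lemma finite_fourier_chi12_quadratic:
  assumes C: "C > 0" "coprime 12 (int C)" and inv: "[576 * b * d = 1] (mod int C)"
  shows "finite_fourier (12 * C) (\<lambda>n. chi12 n * nome (of_int n ^ 2 * of_real (of_int b / of_nat C))) m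
           = chi12 (int C) * of_real (sqrt 12) * gauss_sum b C * chi12 m * nome (- of_int (d * m ^ 2) / of_nat C)"
proof -
  define F where "F = (\<lambda>r::int. chi12 r * nome (of_int (b * r ^ 2) / of_nat C) * nome (of_int (m * r) / of_nat (12 * C)))"
  have quad: "nome (of_int (b * (r + int C * k) ^ 2) / of_nat C) = nome (of_int (b * r ^ 2) / of_nat C)" for r k
  proof (rule nome_cong[OF C(1)])
    have "b * (r + int C * k) ^ 2 - b * r ^ 2 = int C * (b * (2 * r * k + int C * k ^ 2))"
      by (simp add: power2_eq_square algebra_simps)
    thus "[b * (r + int C * k) ^ 2 = b * r ^ 2] (mod int C)" by (simp add: cong_iff_dvd_diff)
  qed
  have per: "F (n + int (12 * C)) = F n" for n
  proof -
    have "nome (of_int (m * (n + int (12 * C))) / of_nat (12 * C)) = nome (of_int (m * n) / of_nat (12 * C))"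
      by (rule nome_cong) (use C(1) in \<open>auto simp: cong_iff_dvd_diff algebra_simps\<close>)
    moreover have "chi12 (n + int (12 * C)) = chi12 n" by (rule chi12_add_mult_12) simp
    moreover have "nome (of_int (b * (n + int (12 * C)) ^ 2) / of_nat C) = nome (of_int (b * n ^ 2) / of_nat C)"
      using quad[of n 12] by (simp add: mult.commute)
    ultimately show ?thesis by (simp only: F_def)
  qed
  have "finite_fourier (12 * C) (\<lambda>n. chi12 n * nome (of_int n ^ 2 * of_real (of_int b / of_nat C))) m
      = (\<Sum>r<12 * C. F (int r))"
    unfolding finite_fourier_def F_def by (intro sum.cong refl) (simp add: mult_ac)
  also have "\<dots> = (\<Sum>u<12. \<Sum>v<C. F (int C * int u + int 12 * int v))"
  proof (rule sum_periodic_CRT[of 12 C F])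
    show "F (n + int (12 * C)) = F n" for n by (rule per)
    show "coprime (int 12) (int C)" using C(2) by simp
  qed (use C in auto)
  also have "\<dots> = (\<Sum>u<12. \<Sum>v<C. (chi12 (int u) * nome (of_int m * of_nat u / of_nat 12)) *
        (chi12 (int C) * nome (of_int (144 * b * int v ^ 2 + m * int v) / of_nat C)))"
  proof (intro sum.cong refl)
    fix u v :: nat
    have chi: "chi12 (int C * int u + int 12 * int v) = chi12 (int C) * chi12 (int u)"
      using chi12_add_mult_12[of "12 * int v" "int C * int u"] by (simp add: chi12_mult)
    have q: "nome (of_int (b * (int C * int u + int 12 * int v) ^ 2) / of_nat C)
              = nome (of_int (144 * b * int v ^ 2) / of_nat C)"
      using quad[of "12 * int v" "int u"] by (simp add: power_mult_distrib add.commute mult_ac)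
    have "(of_int (m * (int C * int u + int 12 * int v)) / of_nat (12 * C) :: complex)
            = of_int m * of_nat u / of_nat 12 + of_int (m * int v) / of_nat C"
      using C(1) by (simp add: field_simps)
    hence l: "nome (of_int (m * (int C * int u + int 12 * int v)) / of_nat (12 * C))
            = nome (of_int m * of_nat u / of_nat 12) * nome (of_int (m * int v) / of_nat C)"
      by (simp only: nome_add)
    show "F (int C * int u + int 12 * int v) = (chi12 (int u) * nome (of_int m * of_nat u / of_nat 12)) *
        (chi12 (int C) * nome (of_int (144 * b * int v ^ 2 + m * int v) / of_nat C))"
      unfolding F_def chi q l of_int_add add_divide_distrib nome_add by (simp only: mult_ac)
  qed
  also have "\<dots> = finite_fourier 12 chi12 m * (chi12 (int C) * (\<Sum>v<C. nome (of_int (144 * b * int v ^ 2 + m * int v) / of_nat C)))"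
    by (simp only: finite_fourier_def sum_distrib_left[symmetric] sum_distrib_right[symmetric])
  also have "(\<Sum>v<C. nome (of_int (144 * b * int v ^ 2 + m * int v) / of_nat C))
      = nome (- of_int (144 * b * (2 * d * m) ^ 2) / of_nat C) * gauss_sum (144 * b) C"
  proof (rule gauss_sum_complete_square[OF C(1)])
    have "2 * (144 * b) * (2 * d * m) - m = (576 * b * d - 1) * m" by (simp add: algebra_simps)
    thus "[2 * (144 * b) * (2 * d * m) = m] (mod int C)"
      using inv by (simp add: cong_iff_dvd_diff)
  qed
  also have "gauss_sum (144 * b) C = gauss_sum b C"
    using gauss_sum_square_factor[OF C, of b] by (simp add: mult.commute)
  also have "nome (- of_int (144 * b * (2 * d * m) ^ 2) / of_nat C) = nome (- of_int (d * m ^ 2) / of_nat C)"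
  proof -
    have "- (144 * b * (2 * d * m) ^ 2) - - (d * m ^ 2) = (576 * b * d - 1) * (- d * m ^ 2)"
      by (simp add: power2_eq_square algebra_simps)
    hence "[- (144 * b * (2 * d * m) ^ 2) = - (d * m ^ 2)] (mod int C)"
      using inv by (simp only: cong_iff_dvd_diff dvd_mult2)
    from nome_cong[OF C(1) this] show ?thesis by (simp only: of_int_minus)
  qed
  finally show ?thesis by (simp add: finite_fourier_chi12 mult_ac)
qed

text \<open>Here \<open>24\<close> divides both diagonal entries, which makes the roots of unity from the two ends of
  the inversion cancel; the matrices that occur below are all of this kind.\<close>

theorem dedekind_eta_mobius:
  assumes det: "(24 * b) * (24 * d) - \<beta> * c = (1::int)" and c: "c > 0" and \<tau>: "\<tau> \<in> upper_half"
  shows "dedekind_eta (mobius (24 * b) \<beta> c (24 * d) \<tau>)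
           = chi12 c * gauss_sum b (nat c) / of_real (sqrt (of_int c))
             * csqrt (- \<i> * (of_int c * \<tau> + of_int (24 * d))) * dedekind_eta \<tau>"
proof -
  define C where "C = nat c"
  have C: "int C = c" "C > 0" "of_nat C = (of_int c :: complex)" "real C = of_int c"
    using c by (auto simp: C_def)
  define J where "J = - \<i> * (of_int c * \<tau> + (of_int (24 * d) :: complex))"
  have Re_J: "Re J > 0" unfolding J_def by (rule neg_i_times_denominator[OF c \<tau>])
  hence J0: "J \<noteq> 0" by auto
  define t where "t = 1 / (of_real (12 * of_int c) * J)"
  have t: "Re t > 0"
  proof -
    have "Re (of_real (12 * of_int c) * J) = 12 * of_int c * Re J" by simp
    also have "\<dots> > 0" using Re_J c by simp
    finally show ?thesis unfolding t_def by (rule Re_one_over_pos)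
  qed
  have bd: "[576 * b * d = 1] (mod int C)"
  proof -
    have "576 * b * d - 1 = \<beta> * c" using det by (simp add: algebra_simps)
    thus ?thesis by (simp add: cong_iff_dvd_diff C)
  qed
  have cop: "coprime 12 (int C)"
  proof (rule coprimeI)
    fix k assume k: "k dvd 12" "k dvd int C"
    have "12 dvd (24 * b) * (24 * d)" by (rule dvdI[of _ _ "48 * b * d"]) simp
    hence "k dvd (24 * b) * (24 * d) - \<beta> * c"
      using k by (intro dvd_diff) (auto simp: C intro: dvd_trans)
    thus "k dvd 1" by (simp only: det)
  qed
  have \<tau>': "mobius (24 * b) \<beta> c (24 * d) \<tau> \<in> upper_half"
    by (rule mobius_in_upper_half[OF det \<tau>])
  have csqrt_t: "csqrt t = 1 / (of_real (sqrt (12 * of_int c)) * csqrt J)"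
  proof -
    have "csqrt t = 1 / csqrt (of_real (12 * of_int c) * J)"
      unfolding t_def by (rule csqrt_one_over) (use Re_J c in simp)
    thus ?thesis using csqrt_scale[of "12 * of_int c" J] c by simp
  qed
  define \<psi> where "\<psi> = (\<lambda>n. chi12 n * nome (of_int n ^ 2 * of_real (of_int b / of_nat C)))"
  have "- \<i> * mobius (24 * b) \<beta> c (24 * d) \<tau> / 12 = t - 2 * \<i> * of_real (of_int b / of_nat C)"
  proof -
    have "of_int c * \<tau> + of_int (24 * d) = \<i> * J" by (simp add: J_def)
    thus ?thesis
      unfolding mobius_partial_fraction[OF det \<tau> less_imp_neq[OF c, symmetric]] t_def
      using J0 c by (simp add: C(3,4) field_simps)
  qed
  hence "2 * dedekind_eta (mobius (24 * b) \<beta> c (24 * d) \<tau>) = theta_series \<psi> t"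
    by (simp only: eta_eq_theta_series[OF \<tau>'] theta_series_shift \<psi>_def)
  also have "\<dots> = theta_series (finite_fourier (12 * C) \<psi>) (1 / (of_nat (12 * C) ^ 2 * t)) / (of_nat (12 * C) * csqrt t)"
  proof (rule theta_series_inversion[OF _ _ t])
    show "12 * C > 0" using C by simp
    fix n
    have "nome (of_int (b * (n + int C * 12) ^ 2) / of_nat C) = nome (of_int (b * n ^ 2) / of_nat C)"
    proof (rule nome_cong[OF C(2)])
      have "b * (n + int C * 12) ^ 2 - b * n ^ 2 = int C * (b * (24 * n + int C * 144))"
        by (simp add: power2_eq_square algebra_simps)
      thus "[b * (n + int C * 12) ^ 2 = b * n ^ 2] (mod int C)" by (simp add: cong_iff_dvd_diff)
    qed
    moreover have "chi12 (n + int (12 * C)) = chi12 n" by (rule chi12_add_mult_12) simp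
    ultimately show "\<psi> (n + int (12 * C)) = \<psi> n" by (simp add: \<psi>_def mult_ac)
  qed
  also have "1 / (of_nat (12 * C) ^ 2 * t) = - \<i> * \<tau> / 12 - 2 * \<i> * of_real (of_int d / of_nat C)"
  proof -
    have "1 / (of_nat (12 * C) ^ 2 * t) = J / (12 * of_int c)"
      using J0 c by (simp add: t_def C(3) field_simps power2_eq_square)
    also have "\<dots> = - \<i> * \<tau> / 12 - 2 * \<i> * of_real (of_int d / of_nat C)"
      using c by (simp add: J_def C(4) field_simps)
    finally show ?thesis .
  qed
  also have "theta_series (finite_fourier (12 * C) \<psi>) (- \<i> * \<tau> / 12 - 2 * \<i> * of_real (of_int d / of_nat C))
     = theta_series (\<lambda>m. (chi12 c * of_real (sqrt 12) * gauss_sum b C) * chi12 m) (- \<i> * \<tau> / 12)"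
    unfolding theta_series_shift
  proof (rule arg_cong[of _ _ "\<lambda>f. theta_series f _"], rule ext)
    fix m
    have "nome (- of_int (d * m ^ 2) / of_nat C) * nome (of_int m ^ 2 * of_real (of_int d / of_nat C)) = 1"
      by (simp add: nome_add[symmetric] mult_ac)
    thus "finite_fourier (12 * C) \<psi> m * nome (of_int m ^ 2 * of_real (of_int d / of_nat C))
        = (chi12 c * of_real (sqrt 12) * gauss_sum b C) * chi12 m"
      unfolding \<psi>_def finite_fourier_chi12_quadratic[OF C(2) cop bd] by (simp add: C(1) mult_ac)
  qed
  also have "\<dots> = (chi12 c * of_real (sqrt 12) * gauss_sum b C) * (2 * dedekind_eta \<tau>)"
    unfolding theta_series_cmult eta_eq_theta_series[OF \<tau>] ..
  finally have "dedekind_eta (mobius (24 * b) \<beta> c (24 * d) \<tau>)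
      = chi12 c * gauss_sum b C * (of_real (sqrt 12) / (of_nat (12 * C) * csqrt t)) * dedekind_eta \<tau>"
  proof -
    have gen: "x = k * g * (s / D) * y" if "2 * x = (k * s * g) * (2 * y) / D" for x k s g y D :: complex
    proof -
      have "2 * x = 2 * (k * g * (s / D) * y)" using that by (simp add: mult_ac)
      thus ?thesis by (simp only: mult_cancel_left) simp
    qed
    assume "2 * dedekind_eta (mobius (24 * b) \<beta> c (24 * d) \<tau>)
      = (chi12 c * of_real (sqrt 12) * gauss_sum b C) * (2 * dedekind_eta \<tau>) / (of_nat (12 * C) * csqrt t)"
    thus ?thesis by (rule gen)
  qed
  also have "of_real (sqrt 12) / (of_nat (12 * C) * csqrt t) = csqrt J / of_real (sqrt (of_int c))"
  proof -
    have "of_real (sqrt 12) * of_real (sqrt (12 * of_int c)) / (12 * of_int c) = (1 / of_real (sqrt (of_int c)) :: complex)"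
    proof -
      have "sqrt 12 * sqrt (12 * of_int c) = 12 * sqrt (of_int c)"
        unfolding real_sqrt_mult by simp
      moreover have "sqrt (of_int c) / of_int c = 1 / sqrt (of_int c :: real)"
        using c by (simp add: real_div_sqrt field_simps)
      ultimately have "sqrt 12 * sqrt (12 * of_int c) / (12 * of_int c) = 1 / sqrt (of_int c)"
        by simp
      from arg_cong[OF this, of complex_of_real] show ?thesis by simp
    qed
    hence "of_real (sqrt 12) * of_real (sqrt (12 * of_int c)) / (12 * of_int c) * csqrt J
              = csqrt J / of_real (sqrt (of_int c))" by simp
    thus ?thesis unfolding csqrt_t by (simp add: C(3) mult_ac)
  qed
  finally show ?thesis by (simp add: C_def J_def)
qed

corollary dedekind_eta_S:
  assumes "\<tau> \<in> upper_half"
  shows "dedekind_eta (- 1 / \<tau>) = csqrt (- \<i> * \<tau>) * dedekind_eta \<tau>"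
proof -
  have "gauss_sum 0 (nat 1) = 1" by (simp add: gauss_sum_def)
  thus ?thesis using dedekind_eta_mobius[of 0 0 "-1" 1 \<tau>] assms by (simp add: mobius_def)
qed

lemma theta_fricke:
  assumes \<tau>: "\<tau> \<in> upper_half"
  shows "theta \<tau> = theta (- 1 / (4 * \<tau>)) / csqrt (- 2 * \<i> * \<tau>)"
proof -
  have t: "Re (- 2 * \<i> * \<tau>) > 0" using \<tau> by (simp add: upper_half_def)
  have \<tau>0: "\<tau> \<noteq> 0" using \<tau> by (auto simp: upper_half_def)
  have "finite_fourier 1 (\<lambda>_. 1) = (\<lambda>_. 1)"
    by (simp add: finite_fourier_def fun_eq_iff)
  hence "theta \<tau> = theta_series (\<lambda>_. 1) (1 / (- 2 * \<i> * \<tau>)) / csqrt (- 2 * \<i> * \<tau>)"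
    using theta_series_inversion[of 1 "\<lambda>_. 1", OF _ _ t] by (simp add: theta_eq_theta_series)
  also have "1 / (- 2 * \<i> * \<tau>) = - 2 * \<i> * (- 1 / (4 * \<tau>))"
    using \<tau>0 by (simp add: field_simps)
  finally show ?thesis by (simp only: theta_eq_theta_series[symmetric])
qed

section \<open>Modular transformations from generators\<close>

lemma exists_small_residue:
  assumes "m \<noteq> (0::int)"
  shows "\<exists>n. 2 * \<bar>d + n * m\<bar> \<le> \<bar>m\<bar>"
proof -
  define k where "k = d mod \<bar>m\<bar>"
  have k: "0 \<le> k" "k < \<bar>m\<bar>" using assms by (auto simp: k_def)
  have sg: "sgn m * m = \<bar>m\<bar>" by (simp add: sgn_mult_abs abs_sgn mult.commute)
  have e: "d + (- (d div \<bar>m\<bar>) * sgn m) * m = k"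
    unfolding k_def mult.assoc sg by (simp add: minus_mult_div_eq_mod algebra_simps)
  show ?thesis
  proof (cases "2 * k \<le> \<bar>m\<bar>")
    case True
    thus ?thesis using e k by (intro exI[of _ "- (d div \<bar>m\<bar>) * sgn m"]) (simp only: abs_of_nonneg)
  next
    case False
    have "d + (- (d div \<bar>m\<bar>) * sgn m - sgn m) * m = k - \<bar>m\<bar>"
      using e sg by (simp add: left_diff_distrib)
    hence "2 * \<bar>d + (- (d div \<bar>m\<bar>) * sgn m - sgn m) * m\<bar> \<le> \<bar>m\<bar>"
      using False k by simp
    thus ?thesis by blast
  qed
qed

text \<open>For \<open>N = 1\<close> and \<open>N = 4\<close> the group of matrices with \<open>N\<close> dividing the lower left entry is generated,
  up to sign, by the two unipotent matrices: a Euclidean algorithm on the lower row in which the second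
  entry is reduced modulo the first and the first modulo \<open>N\<close> times the second.\<close>

theorem modular_from_generators:
  fixes \<Phi> :: "complex \<Rightarrow> complex" and N :: int
  assumes p: "even p" and N: "N = 1 \<or> N = 4"
    and T: "\<And>\<tau>. \<tau> \<in> upper_half \<Longrightarrow> \<Phi> (\<tau> + 1) = \<Phi> \<tau>"
    and U: "\<And>\<tau>. \<tau> \<in> upper_half \<Longrightarrow> \<Phi> (\<tau> / (of_int N * \<tau> + 1)) = (of_int N * \<tau> + 1) ^ p * \<Phi> \<tau>"
    and "a * d - b * c = 1" "N dvd c" "\<tau> \<in> upper_half"
  shows "\<Phi> (mobius a b c d \<tau>) = (of_int c * \<tau> + of_int d) ^ p * \<Phi> \<tau>"
proof -
  have Tn: "\<Phi> (\<tau> + of_int n) = \<Phi> \<tau>" if "\<tau> \<in> upper_half" for \<tau> n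
  proof (induction n rule: int_induct[of _ 0])
    case (step1 i)
    have "\<tau> + of_int i \<in> upper_half" using that by (simp add: upper_half_def)
    from T[OF this] step1 show ?case by (simp add: add.assoc)
  next
    case (step2 i)
    have "\<tau> + of_int (i - 1) \<in> upper_half" using that by (simp add: upper_half_def)
    from T[OF this] step2 show ?case by (simp add: add.assoc)
  qed simp
  have Uw: "\<tau> / (of_int (N * m) * \<tau> + 1) \<in> upper_half" and Uz: "of_int (N * m) * \<tau> + 1 \<noteq> 0"
    if "\<tau> \<in> upper_half" for \<tau> m
    using mobius_in_upper_half[of 1 1 0 "N * m" \<tau>] mobius_denominator_nonzero[of 1 1 0 "N * m" \<tau>] that
    by (simp_all add: mobius_def)
  have Um: "\<Phi> (\<tau> / (of_int (N * m) * \<tau> + 1)) = (of_int (N * m) * \<tau> + 1) ^ p * \<Phi> \<tau>"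
    if \<tau>: "\<tau> \<in> upper_half" for \<tau> m
  proof -
    have step: "\<Phi> (\<tau> / (of_int (N * (i + 1)) * \<tau> + 1)) * (of_int (N * i) * \<tau> + 1) ^ p
        = (of_int (N * (i + 1)) * \<tau> + 1) ^ p * \<Phi> (\<tau> / (of_int (N * i) * \<tau> + 1))" for i
    proof -
      define x where "x = of_int (N * i) * \<tau> + (1::complex)"
      define y where "y = of_int (N * (i + 1)) * \<tau> + (1::complex)"
      have x0: "x \<noteq> 0" unfolding x_def by (rule Uz[OF \<tau>])
      have y0: "y \<noteq> 0" unfolding y_def by (rule Uz[OF \<tau>])
      have yx: "of_int N * \<tau> + x = y" by (simp add: x_def y_def algebra_simps)
      have 1: "of_int N * (\<tau> / x) + 1 = y / x"
        using x0 yx by (simp add: add_divide_distrib[symmetric] divide_simps)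
      have "\<Phi> (\<tau> / x / (y / x)) = (y / x) ^ p * \<Phi> (\<tau> / x)"
        using U[of "\<tau> / x"] Uw[OF \<tau>, of i] unfolding 1 by (simp add: x_def)
      moreover have "\<tau> / x / (y / x) = \<tau> / y" using x0 by simp
      ultimately show ?thesis
        unfolding x_def[symmetric] y_def[symmetric] using x0 by (simp add: power_divide)
    qed
    show ?thesis
    proof (induction m rule: int_induct[of _ 0])
      case (step1 i)
      thus ?case using step[of i] Uz[OF \<tau>, of i] by simp
    next
      case (step2 i)
      have "\<Phi> (\<tau> / (of_int (N * i) * \<tau> + 1)) * (of_int (N * (i - 1)) * \<tau> + 1) ^ p
        = (of_int (N * i) * \<tau> + 1) ^ p * \<Phi> (\<tau> / (of_int (N * (i - 1)) * \<tau> + 1))"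
        using step[of "i - 1"] by simp
      hence "(of_int (N * i) * \<tau> + 1) ^ p * (\<Phi> \<tau> * (of_int (N * (i - 1)) * \<tau> + 1) ^ p)
        = (of_int (N * i) * \<tau> + 1) ^ p * \<Phi> (\<tau> / (of_int (N * (i - 1)) * \<tau> + 1))"
        unfolding step2.IH by (simp only: mult.assoc)
      thus ?case using Uz[OF \<tau>, of i] by (simp add: mult.commute)
    qed simp
  qed
  have "\<forall>\<tau>\<in>upper_half. \<Phi> (mobius a b c d \<tau>) = (of_int c * \<tau> + of_int d) ^ p * \<Phi> \<tau>"
    using \<open>a * d - b * c = 1\<close> \<open>N dvd c\<close>
  proof (induction "nat \<bar>c\<bar>" arbitrary: a b c d rule: less_induct)
    case less
    show ?case
    proof (cases "c = 0")
      case True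
      hence "(a = 1 \<and> d = 1) \<or> (a = -1 \<and> d = -1)"
        using less.prems by (simp add: zmult_eq_1_iff)
      thus ?thesis
      proof
        assume "a = 1 \<and> d = 1"
        thus ?thesis using True Tn[of _ b] by (simp add: mobius_def)
      next
        assume "a = -1 \<and> d = -1"
        thus ?thesis using True Tn[of _ "- b"] p by (simp add: mobius_def)
      qed
    next
      case False
      obtain n where n: "d + n * c \<noteq> 0"
        "2 * \<bar>d + n * c\<bar> \<le> \<bar>c\<bar> \<or> (N = 1 \<and> \<bar>d + n * c\<bar> = 1 \<and> \<bar>c\<bar> = 1)"
      proof -
        obtain n where n: "2 * \<bar>d + n * c\<bar> \<le> \<bar>c\<bar>" using exists_small_residue[OF False] by blast
        show ?thesis
        proof (cases "d + n * c = 0")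
          case True
          \<comment> \<open>a zero entry would stop the algorithm, so one more translation replaces it by \<open>c = \<plusminus>1\<close>\<close>
          have "a * (d + n * c) - (b + n * a) * c = 1" using less.prems(1) by (simp add: algebra_simps)
          hence "(b + n * a) * c = - 1" unfolding True by simp
          hence "c dvd - 1" by (metis dvd_triv_right)
          hence "c dvd 1" by simp
          hence c1: "\<bar>c\<bar> = 1" by (simp only: zdvd1_eq)
          have "N = 1" using N c1 less.prems(2) by (metis abs_dvd_iff dvd_abs_iff zdvd1_eq abs_numeral)
          moreover have "d + (n + 1) * c = c" using True by (simp add: algebra_simps)
          ultimately show ?thesis using that[of "n + 1"] c1 False by simp
        qed (use that n in blast)
      qed
      define b' d' where "b' = b + n * a" and "d' = d + n * c"
      have det': "a * d' - b' * c = 1" using less.prems(1) by (simp add: b'_def d'_def algebra_simps)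
      have d': "d' \<noteq> 0" using n by (simp add: d'_def)
      hence "N * d' \<noteq> 0" using N by auto
      then obtain m where m: "2 * \<bar>c + m * (N * d')\<bar> \<le> \<bar>N * d'\<bar>" using exists_small_residue by blast
      define a' c' where "a' = a + N * m * b'" and "c' = c + N * m * d'"
      have m': "2 * \<bar>c'\<bar> \<le> N * \<bar>d'\<bar>"
        using m N by (auto simp: c'_def abs_mult mult_ac)
      have det'': "a' * d' - b' * c' = 1" using det' by (simp add: a'_def c'_def algebra_simps)
      have Nc': "N dvd c'" using less.prems(2) by (simp add: c'_def mult.assoc)
      have "\<bar>c'\<bar> < \<bar>c\<bar>"
        using n(2)
      proof
        assume small: "2 * \<bar>d + n * c\<bar> \<le> \<bar>c\<bar>"
        show ?thesis
          using N
        proof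
          assume "N = 1"
          hence "2 * \<bar>c'\<bar> \<le> \<bar>d'\<bar>" using m' by simp
          moreover have "\<bar>c\<bar> > 0" using False by simp
          moreover have "x < z" if "2 * x \<le> y" "2 * y \<le> z" "0 < z" for x y z :: int
            using that by linarith
          ultimately show ?thesis using small unfolding d'_def by blast
        next
          assume N4: "N = 4"
          have "\<bar>c'\<bar> \<noteq> 2 * \<bar>d'\<bar>"
          proof
            assume *: "\<bar>c'\<bar> = 2 * \<bar>d'\<bar>"
            obtain k where "\<bar>c'\<bar> = 4 * k" using Nc' N4 by (metis dvd_abs_iff dvdE)
            hence "\<bar>d'\<bar> = 2 * k" using * by simp
            hence "even d'" by (metis dvd_abs_iff dvd_triv_left)
            moreover have "even c" using less.prems(2) N4 by (metis dvd_trans even_numeral)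
            ultimately have "even (a * d' - b' * c)" by simp
            thus False using det' by simp
          qed
          thus ?thesis using m' small N4 by (simp add: d'_def)
        qed
      next
        assume *: "N = 1 \<and> \<bar>d + n * c\<bar> = 1 \<and> \<bar>c\<bar> = 1"
        thus ?thesis using m' by (simp add: d'_def)
      qed
      hence "nat \<bar>c'\<bar> < nat \<bar>c\<bar>" by simp
      from less.hyps[OF this det'' Nc']
      have IH: "\<Phi> (mobius a' b' c' d' w) = (of_int c' * w + of_int d') ^ p * \<Phi> w" if "w \<in> upper_half" for w
        using that by blast
      have Q1: "\<Phi> (mobius a b' c d' w) = (of_int c * w + of_int d') ^ p * \<Phi> w" if w: "w \<in> upper_half" for w
      proof -
        define x where "x = of_int (N * (- m)) * w + (1::complex)"
        have x0: "x \<noteq> 0" unfolding x_def by (rule Uz[OF w])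
        have wx: "w / x \<in> upper_half" unfolding x_def by (rule Uw[OF w])
        have e1: "of_int a' * (w / x) + of_int b' = (of_int a * w + of_int b') / x"
          using x0 by (simp add: divide_simps) (simp add: a'_def x_def algebra_simps)
        have e2: "of_int c' * (w / x) + of_int d' = (of_int c * w + of_int d') / x"
          using x0 by (simp add: divide_simps) (simp add: c'_def x_def algebra_simps)
        have "mobius a' b' c' d' (w / x) = mobius a b' c d' w"
          unfolding mobius_def e1 e2 using x0 by simp
        with IH[OF wx] have "\<Phi> (mobius a b' c d' w) = ((of_int c * w + of_int d') / x) ^ p * \<Phi> (w / x)"
          by (simp only: e2)
        also have "\<Phi> (w / x) = x ^ p * \<Phi> w" unfolding x_def by (rule Um[OF w])
        finally show ?thesis using x0 by (simp add: power_divide)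
      qed
      show ?thesis
      proof
        fix w assume w: "w \<in> upper_half"
        have w': "w - of_int n \<in> upper_half" using w by (simp add: upper_half_def)
        have "mobius a b' c d' (w - of_int n) = mobius a b c d w"
          by (simp add: mobius_def b'_def d'_def algebra_simps)
        moreover have "of_int c * (w - of_int n) + of_int d' = of_int c * w + of_int d"
          by (simp add: d'_def algebra_simps)
        moreover have "\<Phi> (w - of_int n) = \<Phi> w" using Tn[OF w', of n] by simp
        ultimately show "\<Phi> (mobius a b c d w) = (of_int c * w + of_int d) ^ p * \<Phi> w"
          using Q1[OF w'] by simp
      qed
    qed
  qed
  thus ?thesis using \<open>\<tau> \<in> upper_half\<close> by blast
qed

text \<open>The lower unipotent generator is \<open>S T\<^sup>-\<^sup>1 S\<close> up to sign.\<close>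

corollary modular_from_S_T:
  fixes \<Phi> :: "complex \<Rightarrow> complex"
  assumes p: "even p"
    and T: "\<And>\<tau>. \<tau> \<in> upper_half \<Longrightarrow> \<Phi> (\<tau> + 1) = \<Phi> \<tau>"
    and S: "\<And>\<tau>. \<tau> \<in> upper_half \<Longrightarrow> \<Phi> (- 1 / \<tau>) = \<tau> ^ p * \<Phi> \<tau>"
    and det: "a * d - b * c = 1" and \<tau>: "\<tau> \<in> upper_half"
  shows "\<Phi> (mobius a b c d \<tau>) = (of_int c * \<tau> + of_int d) ^ p * \<Phi> \<tau>"
proof (rule modular_from_generators[where \<Phi> = \<Phi> and N = 1])
  fix \<tau> assume \<tau>: "\<tau> \<in> upper_half"
  have \<tau>0: "\<tau> \<noteq> 0" "\<tau> + 1 \<noteq> 0" using \<tau> by (auto simp: upper_half_def complex_eq_iff)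
  have S\<tau>: "- 1 / \<tau> \<in> upper_half"
    using mobius_in_upper_half[of 0 0 "-1" 1 \<tau>] \<tau> by (simp add: mobius_def)
  define w where "w = - 1 / \<tau> - 1"
  have w: "w \<in> upper_half" using S\<tau> by (simp add: w_def upper_half_def)
  have w_alt: "w = - (\<tau> + 1) / \<tau>" using \<tau>0 by (simp add: w_def field_simps)
  have "- 1 / (- u / \<tau>) = \<tau> / u" for u by simp
  hence "\<Phi> (\<tau> / (of_int 1 * \<tau> + 1)) = \<Phi> (- 1 / w)"
    by (simp only: w_alt) simp
  also have "\<dots> = w ^ p * \<Phi> w" by (rule S[OF w])
  also have "\<Phi> w = \<Phi> (- 1 / \<tau>)" using T[OF w] by (simp add: w_def)
  also have "\<dots> = \<tau> ^ p * \<Phi> \<tau>" by (rule S[OF \<tau>])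
  also have "w ^ p * (\<tau> ^ p * \<Phi> \<tau>) = (of_int 1 * \<tau> + 1) ^ p * \<Phi> \<tau>"
  proof -
    have "w ^ p * \<tau> ^ p = (- (\<tau> + 1)) ^ p"
      using \<tau>0 by (simp only: power_mult_distrib[symmetric] w_alt) simp
    also have "\<dots> = (\<tau> + 1) ^ p" using p by (rule power_minus_even)
    finally show ?thesis by (simp add: mult.assoc[symmetric])
  qed
  finally show "\<Phi> (\<tau> / (of_int 1 * \<tau> + 1)) = (of_int 1 * \<tau> + 1) ^ p * \<Phi> \<tau>" .
qed (use p T det \<tau> in auto)

text \<open>The involution \<open>\<tau> \<mapsto> -1 / (4 \<tau>)\<close> conjugates the translation to the inverse of the other
  generator.\<close>

lemma theta_power4_modular:
  assumes "a * d - b * c = 1" "4 dvd c" "\<tau> \<in> upper_half"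
  shows "theta (mobius a b c d \<tau>) ^ 4 = (of_int c * \<tau> + of_int d) ^ 2 * theta \<tau> ^ 4"
proof (rule modular_from_generators[where \<Phi> = "\<lambda>\<tau>. theta \<tau> ^ 4" and N = 4])
  show "theta (\<tau> + 1) ^ 4 = theta \<tau> ^ 4" for \<tau>
    using theta_add_of_int[of \<tau> 1] by simp
  fix \<tau> assume \<tau>: "\<tau> \<in> upper_half"
  have fricke: "theta (- 1 / (4 * \<sigma>)) ^ 4 = - 4 * \<sigma> ^ 2 * theta \<sigma> ^ 4" if "\<sigma> \<in> upper_half" for \<sigma>
  proof -
    have s0: "\<sigma> \<noteq> 0" using that by (auto simp: upper_half_def)
    have "csqrt (- 2 * \<i> * \<sigma>) ^ 4 = (csqrt (- 2 * \<i> * \<sigma>) ^ 2) ^ 2"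
      by (simp only: power_mult[symmetric]) simp
    also have "\<dots> = - 4 * \<sigma> ^ 2" unfolding power2_csqrt by (simp add: power_mult_distrib)
    finally have "theta \<sigma> ^ 4 = theta (- 1 / (4 * \<sigma>)) ^ 4 / (- 4 * \<sigma> ^ 2)"
      by (subst theta_fricke[OF that]) (simp only: power_divide)
    thus ?thesis using s0 by (simp add: field_simps)
  qed
  define w where "w = \<tau> / (4 * \<tau> + 1)"
  have w: "w \<in> upper_half" and z: "4 * \<tau> + 1 \<noteq> 0"
    using mobius_in_upper_half[of 1 1 0 4 \<tau>] mobius_denominator_nonzero[of 1 1 0 4 \<tau>] \<tau>
    by (simp_all add: mobius_def w_def)
  have \<tau>0: "\<tau> \<noteq> 0" using \<tau> by (auto simp: upper_half_def)
  have "- 1 / (4 * w) = - 1 / (4 * \<tau>) + of_int (-1)"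
    using \<tau>0 z by (simp add: w_def field_simps)
  hence "- 4 * w ^ 2 * theta w ^ 4 = - 4 * \<tau> ^ 2 * theta \<tau> ^ 4"
    using fricke[OF w] fricke[OF \<tau>] by (simp only: theta_add_of_int)
  hence "w ^ 2 * theta w ^ 4 = \<tau> ^ 2 * theta \<tau> ^ 4" by simp
  hence "theta w ^ 4 = (4 * \<tau> + 1) ^ 2 * theta \<tau> ^ 4"
    using \<tau>0 z by (simp add: w_def power_divide field_simps)
  thus "theta (\<tau> / (of_int 4 * \<tau> + 1)) ^ 4 = (of_int 4 * \<tau> + 1) ^ 2 * theta \<tau> ^ 4"
    by (simp add: w_def)
qed (use assms in auto)

lemma theta_factor_power_even:
  assumes "a * d - b * c = 1" "4 dvd c" "\<tau> \<in> upper_half" "even s"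
  shows "theta_factor a b c d \<tau> ^ (2 * s) = (of_int c * \<tau> + of_int d) ^ s"
proof -
  obtain k where k: "s = 2 * k" using \<open>even s\<close> by auto
  have "theta_factor a b c d \<tau> ^ 4 = (of_int c * \<tau> + of_int d) ^ 2"
    unfolding theta_factor_def power_divide theta_power4_modular[OF assms(1-3)]
    using theta_nonzero[OF assms(3)] by simp
  hence "(theta_factor a b c d \<tau> ^ 4) ^ k = ((of_int c * \<tau> + of_int d) ^ 2) ^ k" by simp
  thus ?thesis by (simp add: k power_mult[symmetric])
qed

lemma dedekind_eta_power24_modular:
  assumes "a * d - b * c = 1" "\<tau> \<in> upper_half"
  shows "dedekind_eta (mobius a b c d \<tau>) ^ 24 = (of_int c * \<tau> + of_int d) ^ 12 * dedekind_eta \<tau> ^ 24"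
proof (rule modular_from_S_T[where \<Phi> = "\<lambda>\<tau>. dedekind_eta \<tau> ^ 24"])
  fix \<tau> assume \<tau>: "\<tau> \<in> upper_half"
  show "dedekind_eta (\<tau> + 1) ^ 24 = dedekind_eta \<tau> ^ 24"
    by (simp add: dedekind_eta_add_1 power_mult_distrib nome_power)
  have "csqrt (- \<i> * \<tau>) ^ 24 = (csqrt (- \<i> * \<tau>) ^ 2) ^ 12"
    by (simp only: power_mult[symmetric]) simp
  also have "\<dots> = \<tau> ^ 12" unfolding power2_csqrt by (simp add: power_mult_distrib)
  finally show "dedekind_eta (- 1 / \<tau>) ^ 24 = \<tau> ^ 12 * dedekind_eta \<tau> ^ 24"
    unfolding dedekind_eta_S[OF \<tau>] by (simp only: power_mult_distrib)
qed (use assms in auto)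

text \<open>Absolute values do not see the 24th roots of unity in the multiplier.\<close>

lemma norm_dedekind_eta_mobius:
  assumes "a * d - b * c = 1" "\<tau> \<in> upper_half"
  shows "norm (dedekind_eta (mobius a b c d \<tau>)) ^ 2 = norm (of_int c * \<tau> + of_int d) * norm (dedekind_eta \<tau>) ^ 2"
proof -
  have "(norm (dedekind_eta (mobius a b c d \<tau>)) ^ 2) ^ 12 = norm (dedekind_eta (mobius a b c d \<tau>) ^ 24)"
    by (simp add: norm_power)
  also have "\<dots> = (norm (of_int c * \<tau> + of_int d) * norm (dedekind_eta \<tau>) ^ 2) ^ 12"
    unfolding dedekind_eta_power24_modular[OF assms] by (simp add: norm_power norm_mult power_mult_distrib)
  finally show ?thesis by (rule power_eq_imp_eq_base) auto
qed

section \<open>The space of eta multiples and its cusp forms\<close>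

lemma
  assumes "f \<in> modular_forms s"
  shows modular_form_holomorphic: "f holomorphic_on upper_half"
    and modular_form_off: "\<tau> \<notin> upper_half \<Longrightarrow> f \<tau> = 0"
    and modular_form_mobius: "a * d - b * c = 1 \<Longrightarrow> \<tau> \<in> upper_half \<Longrightarrow>
           f (mobius a b c d \<tau>) = (of_int c * \<tau> + of_int d) ^ s * f \<tau>"
    and modular_form_bounded: "Bfun f at_im_infty"
  using assms by (auto simp: modular_forms_def holomorphic_upper_half_def)

lemma modular_form_add_1:
  assumes "f \<in> modular_forms s" "\<tau> \<in> upper_half"
  shows "f (\<tau> + 1) = f \<tau>"
  using modular_form_mobius[OF assms(1) _ assms(2), of 1 1 1 0] by (simp add: mobius_def)

lemma eta_multiple_tendsto_0:
  assumes "f \<in> modular_forms s" "r > 0"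
  shows "((\<lambda>\<tau>. dedekind_eta \<tau> ^ r * f \<tau>) \<longlongrightarrow> 0) at_im_infty"
proof -
  have "((\<lambda>\<tau>. dedekind_eta \<tau> ^ r) \<longlongrightarrow> 0 ^ r) at_im_infty"
    by (intro tendsto_power dedekind_eta_tendsto_0)
  hence "Zfun (\<lambda>\<tau>. dedekind_eta \<tau> ^ r) at_im_infty"
    using assms(2) by (simp add: tendsto_Zfun_iff zero_power)
  from bounded_bilinear.Zfun_prod_Bfun[OF bounded_bilinear_mult this modular_form_bounded[OF assms(1)]]
  show ?thesis by (simp add: tendsto_Zfun_iff)
qed

lemma norm_eta_multiple_mobius:
  assumes f: "f \<in> modular_forms s" and det: "a * d - b * c = 1" and \<tau>: "\<tau> \<in> upper_half"
  shows "norm (dedekind_eta (mobius a b c d \<tau>) ^ r * f (mobius a b c d \<tau>)) ^ 2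
           = norm (of_int c * \<tau> + of_int d) ^ (r + 2 * s) * norm (dedekind_eta \<tau> ^ r * f \<tau>) ^ 2"
proof -
  have "norm (dedekind_eta (mobius a b c d \<tau>) ^ r * f (mobius a b c d \<tau>)) ^ 2
      = (norm (dedekind_eta (mobius a b c d \<tau>)) ^ 2) ^ r * norm (f (mobius a b c d \<tau>)) ^ 2"
    by (simp add: norm_mult norm_power power_mult_distrib mult.commute flip: power_mult)
  also have "\<dots> = norm (of_int c * \<tau> + of_int d) ^ (r + 2 * s) * norm (dedekind_eta \<tau> ^ r * f \<tau>) ^ 2"
    unfolding norm_dedekind_eta_mobius[OF det \<tau>] modular_form_mobius[OF f det \<tau>]
    by (simp add: norm_mult norm_power power_mult_distrib power_add mult_ac flip: power_mult)
  finally show ?thesis .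
qed

text \<open>The matrix \<open>diag (24, 1)\<close> times an element of \<open>SL(2, \<int>)\<close> is an element of \<open>SL(2, \<int>)\<close> times an
  upper triangular matrix. Hence the behaviour at every cusp is governed by that at infinity.\<close>

lemma dilation_mobius_decompose:
  assumes det: "a * d - b * c = (1::int)"
  obtains a' b' c' d' A B D where "a' * d' - b' * c' = 1" "A > 0" "D > 0"
    "\<And>\<tau>. \<tau> \<in> upper_half \<Longrightarrow> 24 * mobius a b c d \<tau> = mobius a' b' c' d' ((of_int A * \<tau> + of_int B) / of_int D)"
    "\<And>\<tau>. of_int c' * ((of_int A * \<tau> + of_int B) / of_int D) + of_int d' = (of_int c * \<tau> + of_int d) / (of_int D :: complex)"
proof -
  define A where "A = gcd (24 * a) c"
  have ac: "a \<noteq> 0 \<or> c \<noteq> 0" using det by auto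
  hence A: "A > 0" by (simp add: A_def)
  define p q where "p = 24 * a div A" and "q = c div A"
  have pA: "p * A = 24 * a" and qA: "q * A = c" by (simp_all add: p_def q_def A_def)
  have "coprime p q" unfolding p_def q_def A_def by (rule div_gcd_coprime) (use ac in auto)
  then obtain x y where xy: "p * x + q * y = 1"
    using bezout_int[of p q] by (auto simp: mult.commute)
  define B where "B = 24 * b * x + y * d"
  define D where "D = p * d - 24 * b * q"
  have "A * D = (p * A) * d - 24 * b * (q * A)" by (simp add: D_def algebra_simps)
  also have "\<dots> = 24 * (a * d - b * c)" unfolding pA qA by (simp add: algebra_simps)
  finally have "A * D = 24 * (a * d - b * c)" .
  hence AD: "A * D = 24" by (simp add: det)
  hence D: "D > 0" using A by (metis zero_less_mult_pos zero_less_numeral)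
  have D0: "of_int D \<noteq> (0::complex)" using D by simp
  have B1: "q * B + x * D = d"
  proof -
    have "q * B + x * D = d * (p * x + q * y)" by (simp add: B_def D_def algebra_simps)
    thus ?thesis by (simp add: xy)
  qed
  have B2: "p * B - y * D = 24 * b"
  proof -
    have "p * B - y * D = 24 * b * (p * x + q * y)" by (simp add: B_def D_def algebra_simps)
    thus ?thesis by (simp add: xy)
  qed
  have den: "of_int q * ((of_int A * \<tau> + of_int B) / of_int D) + of_int x = (of_int c * \<tau> + of_int d) / (of_int D :: complex)" for \<tau>
  proof -
    have "(of_int c * \<tau> + of_int d :: complex) = of_int (q * A) * \<tau> + of_int (q * B + x * D)"
      by (simp only: qA B1)
    thus ?thesis using D0 by (simp add: field_simps)
  qed
  have num: "of_int p * ((of_int A * \<tau> + of_int B) / of_int D) + of_int (- y) = (of_int (24 * a) * \<tau> + of_int (24 * b)) / (of_int D :: complex)" for \<tau>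
  proof -
    have "(of_int (24 * a) * \<tau> + of_int (24 * b) :: complex) = of_int (p * A) * \<tau> + of_int (p * B - y * D)"
      by (simp only: pA B2)
    thus ?thesis using D0 by (simp add: field_simps)
  qed
  show ?thesis
  proof (rule that[of p x "- y" q A D B])
    show "p * x - - y * q = 1" using xy by (simp add: mult.commute)
    show "24 * mobius a b c d \<tau> = mobius p (- y) q x ((of_int A * \<tau> + of_int B) / of_int D)"
      if "\<tau> \<in> upper_half" for \<tau>
    proof -
      have "mobius p (- y) q x ((of_int A * \<tau> + of_int B) / of_int D)
          = (of_int (24 * a) * \<tau> + of_int (24 * b)) / (of_int c * \<tau> + of_int d)"
        unfolding mobius_def num den using D0 by simp
      thus ?thesis by (simp add: mobius_def algebra_simps add_divide_distrib)
    qed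
  qed (use A D den in auto)
qed

lemma not_dvd_of_det:
  fixes a b c d k :: int
  assumes "a * d - b * c = 1" "576 dvd c"
  shows "\<not> 2 dvd d" "\<not> 3 dvd d"
proof -
  have *: "\<not> k dvd d" if "k dvd 576" "\<not> k dvd 1" for k
  proof
    assume "k dvd d"
    moreover have "k dvd c" using that(1) assms(2) by (rule dvd_trans)
    ultimately have "k dvd a * d - b * c" by simp
    thus False using that(2) by (simp only: assms(1))
  qed
  show "\<not> 2 dvd d" "\<not> 3 dvd d" by (rule *; simp)+
qed

lemma holomorphic_upper_half_dilate:
  assumes "g holomorphic_on upper_half"
  shows "(\<lambda>\<tau>. g (24 * \<tau>)) holomorphic_on upper_half"
  by (rule holomorphic_on_compose_gen[OF _ assms, of "\<lambda>\<tau>. 24 * \<tau>" upper_half, unfolded o_def])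
     (auto intro!: holomorphic_intros)

text \<open>The power of the theta multiplier splits into \<open>r\<close> factors, which with the odd power of the
  character belong to the power of eta, and an even number \<open>2 s\<close>, which make up the weight of \<open>f\<close>.\<close>

theorem eta_space_subset_cusp_forms:
  assumes r: "odd r" and s: "even s"
  shows "eta_space r s \<subseteq> half_integral_cusp_forms (s + (r - 1) div 2) 576 chi12"
proof
  fix g assume "g \<in> eta_space r s"
  then obtain f where f: "f \<in> modular_forms s" and g: "g = (\<lambda>\<tau>. dedekind_eta (24 * \<tau>) ^ r * f (24 * \<tau>))"
    by (auto simp: eta_space_def)
  have r0: "r > 0" using r by (cases r) auto
  have k: "2 * (s + (r - 1) div 2) + 1 = 2 * s + r"
    using r by (auto elim: oddE)
  have hol: "holomorphic_upper_half g"
    unfolding holomorphic_upper_half_def g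
    by (intro conjI holomorphic_intros holomorphic_upper_half_dilate dedekind_eta_holomorphic
          modular_form_holomorphic[OF f])
       (use modular_form_off[OF f] in simp)
  have trans: "g (mobius a b c d \<tau>) = chi12 d * theta_factor a b c d \<tau> ^ (2 * (s + (r - 1) div 2) + 1) * g \<tau>"
    if det: "a * d - b * c = 1" and c: "int 576 dvd c" and \<tau>: "\<tau> \<in> upper_half" for a b c d \<tau>
  proof -
    have c': "576 dvd c" using c by simp
    have "24 dvd c" by (rule dvd_trans[OF _ c']) simp
    then obtain e where e: "c = 24 * e" by auto
    have "24 * mobius a b c d \<tau> = mobius a (24 * b) e d (24 * \<tau>)"
      by (simp add: mobius_def e algebra_simps add_divide_distrib)
    moreover have "a * d - (24 * b) * e = 1" using det e by simp
    hence "f (mobius a (24 * b) e d (24 * \<tau>)) = (of_int e * (24 * \<tau>) + of_int d) ^ s * f (24 * \<tau>)"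
      by (rule modular_form_mobius[OF f]) (simp add: \<tau>)
    moreover have "of_int e * (24 * \<tau>) = of_int c * \<tau>" by (simp add: e)
    ultimately have F: "f (24 * mobius a b c d \<tau>) = (of_int c * \<tau> + of_int d) ^ s * f (24 * \<tau>)"
      by (simp only:)
    have "chi12 d ^ r = chi12 d"
    proof -
      obtain j where "r = 2 * j + 1" using r by (auto elim: oddE)
      thus ?thesis
        using chi12_self_square[of d] not_dvd_of_det[OF det c'] by (simp add: power_mult power2_eq_square)
    qed
    moreover have "theta_factor a b c d \<tau> ^ (2 * s) = (of_int c * \<tau> + of_int d) ^ s"
      by (rule theta_factor_power_even[OF det _ \<tau> s]) (rule dvd_trans[OF _ c'], simp)
    ultimately show ?thesis
      unfolding g k F eta_theta_ratio_576[OF det c' \<tau>]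
      by (simp add: power_mult_distrib power_add mult_ac)
  qed
  have cusp: "((\<lambda>\<tau>. g (mobius a b c d \<tau>) / csqrt (of_int c * \<tau> + of_int d) ^ (2 * (s + (r - 1) div 2) + 1)) \<longlongrightarrow> 0) at_im_infty"
    if det: "a * d - b * c = 1" for a b c d
  proof -
    obtain a' b' c' d' A B D where det': "a' * d' - b' * c' = (1::int)" and A: "A > 0" and D: "D > 0"
      and num: "\<And>\<tau>. \<tau> \<in> upper_half \<Longrightarrow> 24 * mobius a b c d \<tau> = mobius a' b' c' d' ((of_int A * \<tau> + of_int B) / of_int D)"
      and den: "\<And>\<tau>. of_int c' * ((of_int A * \<tau> + of_int B) / of_int D) + of_int d' = (of_int c * \<tau> + of_int d) / (of_int D :: complex)"
      using dilation_mobius_decompose[OF det] by metis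
    define w where "w = (\<lambda>\<tau>. (of_int A * \<tau> + of_int B) / (of_int D :: complex))"
    define h where "h = (\<lambda>\<tau>. dedekind_eta \<tau> ^ r * f \<tau>)"
    have Im_w: "Im (w \<tau>) = of_int A / of_int D * Im \<tau>" for \<tau>
      using Im_divide_of_real[of "of_int A * \<tau> + of_int B" "of_int D"] by (simp add: w_def)
    have w: "w \<tau> \<in> upper_half" if "\<tau> \<in> upper_half" for \<tau>
      using that A D by (simp add: upper_half_def Im_w)
    have "filterlim (\<lambda>\<tau>. Im (w \<tau>)) at_top at_im_infty"
      unfolding Im_w
      by (rule filterlim_tendsto_pos_mult_at_top[OF tendsto_const _ filterlim_Im_at_im_infty]) (use A D in simp)
    hence "filterlim w at_im_infty at_im_infty" by (rule filterlim_at_im_inftyI)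
    with eta_multiple_tendsto_0[OF f r0] have lim: "((\<lambda>\<tau>. h (w \<tau>)) \<longlongrightarrow> 0) at_im_infty"
      unfolding h_def by (rule filterlim_compose)
    show ?thesis
    proof (rule Lim_null_comparison)
      show "((\<lambda>\<tau>. norm (h (w \<tau>))) \<longlongrightarrow> 0) at_im_infty" by (rule tendsto_norm_zero[OF lim])
      show "\<forall>\<^sub>F \<tau> in at_im_infty. norm (g (mobius a b c d \<tau>) / csqrt (of_int c * \<tau> + of_int d) ^ (2 * (s + (r - 1) div 2) + 1)) \<le> norm (h (w \<tau>))"
        using eventually_upper_half
      proof eventually_elim
        case (elim \<tau>)
        define z where "z = of_int c * \<tau> + (of_int d :: complex)"
        have z0: "z \<noteq> 0" unfolding z_def by (rule mobius_denominator_nonzero[OF det elim])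
        have csq: "norm (csqrt z ^ n) ^ 2 = norm z ^ n" for n
        proof -
          have "norm (csqrt z ^ n) ^ 2 = norm (csqrt z ^ 2) ^ n"
            by (simp only: norm_power power_mult[symmetric] mult.commute)
          thus ?thesis by simp
        qed
        have gh: "g (mobius a b c d \<tau>) = h (mobius a' b' c' d' (w \<tau>))"
          unfolding g h_def num[OF elim] w_def ..
        have "norm (g (mobius a b c d \<tau>) / csqrt z ^ (2 * s + r)) ^ 2
                = norm (h (mobius a' b' c' d' (w \<tau>))) ^ 2 / norm z ^ (2 * s + r)"
          unfolding gh norm_divide power_divide csq ..
        also have "norm (h (mobius a' b' c' d' (w \<tau>))) ^ 2 = norm (z / of_int D) ^ (r + 2 * s) * norm (h (w \<tau>)) ^ 2"
          unfolding h_def norm_eta_multiple_mobius[OF f det' w[OF elim]] by (simp only: w_def den z_def)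
        also have "norm (z / of_int D) ^ (r + 2 * s) * norm (h (w \<tau>)) ^ 2 / norm z ^ (2 * s + r)
            = norm (h (w \<tau>)) ^ 2 / of_int D ^ (2 * s + r)"
          using z0 D by (simp add: norm_divide power_divide add.commute)
        also have "\<dots> \<le> norm (h (w \<tau>)) ^ 2"
        proof -
          have "(1 :: real) \<le> of_int D ^ (2 * s + r)" using D by (intro one_le_power) simp
          thus ?thesis by (simp add: divide_le_eq mult_le_cancel_left1)
        qed
        finally have "norm (g (mobius a b c d \<tau>) / csqrt z ^ (2 * s + r)) \<le> norm (h (w \<tau>))"
          by (rule power2_le_imp_le) simp
        thus ?case unfolding k z_def .
      qed
    qed
  qed
  show "g \<in> half_integral_cusp_forms (s + (r - 1) div 2) 576 chi12"
    unfolding half_integral_cusp_forms_def using hol trans cusp by blast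
qed

theorem eta_space_subspace: "cfun.subspace (eta_space r s)"
  unfolding cfun.subspace_def
proof (intro conjI ballI allI)
  have "(\<lambda>_. 0) \<in> modular_forms s"
    by (auto simp: modular_forms_def holomorphic_upper_half_def intro: BfunI[of _ 0])
  thus "0 \<in> eta_space r s"
    unfolding eta_space_def by (intro CollectI exI[of _ "\<lambda>_. 0"]) (auto simp: fun_eq_iff)
next
  fix g h assume "g \<in> eta_space r s" "h \<in> eta_space r s"
  then obtain u v where uv: "u \<in> modular_forms s" "v \<in> modular_forms s"
    and gh: "g = (\<lambda>\<tau>. dedekind_eta (24 * \<tau>) ^ r * u (24 * \<tau>))" "h = (\<lambda>\<tau>. dedekind_eta (24 * \<tau>) ^ r * v (24 * \<tau>))"
    by (auto simp: eta_space_def)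
  obtain Ku Kv where "eventually (\<lambda>\<tau>. norm (u \<tau>) \<le> Ku) at_im_infty" "eventually (\<lambda>\<tau>. norm (v \<tau>) \<le> Kv) at_im_infty"
    using modular_form_bounded[OF uv(1)] modular_form_bounded[OF uv(2)] by (auto elim!: BfunE)
  hence "eventually (\<lambda>\<tau>. norm (u \<tau> + v \<tau>) \<le> Ku + Kv) at_im_infty"
    by eventually_elim (rule norm_triangle_le, simp)
  hence "Bfun (\<lambda>\<tau>. u \<tau> + v \<tau>) at_im_infty" by (rule BfunI)
  hence "(\<lambda>\<tau>. u \<tau> + v \<tau>) \<in> modular_forms s"
    using uv by (auto simp: modular_forms_def holomorphic_upper_half_def ring_distribs intro!: holomorphic_intros)
  thus "g + h \<in> eta_space r s"
    unfolding eta_space_def gh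
    by (intro CollectI exI[of _ "\<lambda>\<tau>. u \<tau> + v \<tau>"]) (auto simp: fun_eq_iff ring_distribs)
next
  fix c :: complex and g assume "g \<in> eta_space r s"
  then obtain u where u: "u \<in> modular_forms s" and g: "g = (\<lambda>\<tau>. dedekind_eta (24 * \<tau>) ^ r * u (24 * \<tau>))"
    by (auto simp: eta_space_def)
  obtain K where "eventually (\<lambda>\<tau>. norm (u \<tau>) \<le> K) at_im_infty"
    using modular_form_bounded[OF u] by (auto elim!: BfunE)
  hence "eventually (\<lambda>\<tau>. norm (c * u \<tau>) \<le> norm c * K) at_im_infty"
    by eventually_elim (simp add: norm_mult mult_left_mono)
  hence "Bfun (\<lambda>\<tau>. c * u \<tau>) at_im_infty" by (rule BfunI)
  hence "(\<lambda>\<tau>. c * u \<tau>) \<in> modular_forms s"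
    using u by (auto simp: modular_forms_def holomorphic_upper_half_def mult_ac intro!: holomorphic_intros)
  thus "(\<lambda>\<tau>. c * g \<tau>) \<in> eta_space r s"
    unfolding eta_space_def g
    by (intro CollectI exI[of _ "\<lambda>\<tau>. c * u \<tau>"]) (auto simp: fun_eq_iff mult_ac)
qed

section \<open>Fourier expansions\<close>

text \<open>A periodic function on the upper half plane is a holomorphic function of \<open>nome \<tau>\<close> in the
  punctured disc; it suffices for a removable singularity that it grows more slowly than
  \<open>1 / nome \<tau>\<close>.\<close>

theorem periodic_eq_function_of_nome:
  assumes hol: "f holomorphic_on upper_half" and per: "\<And>\<tau>. \<tau> \<in> upper_half \<Longrightarrow> f (\<tau> + 1) = f \<tau>"
    and lim: "((\<lambda>\<tau>. nome \<tau> * f \<tau>) \<longlongrightarrow> 0) at_im_infty"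
  obtains \<Phi> where "\<Phi> holomorphic_on ball 0 1" "\<And>\<tau>. \<tau> \<in> upper_half \<Longrightarrow> f \<tau> = \<Phi> (nome \<tau>)"
proof -
  define L where "L = (\<lambda>q. Ln q / (2 * of_real pi * \<i>))"
  define \<Phi>0 where "\<Phi>0 = (\<lambda>q. f (L q))"
  have nome_L: "nome (L q) = q" if "q \<noteq> 0" for q
    using that by (simp add: nome_def L_def)
  have in_H: "\<tau> \<in> upper_half" if "norm (nome \<tau>) < 1" for \<tau>
    using that by (simp add: norm_nome upper_half_def zero_less_mult_iff)
  have per_int: "f (\<tau> + of_int n) = f \<tau>" if "\<tau> \<in> upper_half" for \<tau> n
  proof (induction n rule: int_induct[of _ 0])
    case (step1 i)
    have "\<tau> + of_int i \<in> upper_half" using that by (simp add: upper_half_def)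
    from per[OF this] step1 show ?case by (simp add: add.assoc)
  next
    case (step2 i)
    have "\<tau> + of_int (i - 1) \<in> upper_half" using that by (simp add: upper_half_def)
    from per[OF this] step2 show ?case by (simp add: add.assoc)
  qed simp
  have eq: "f \<tau>' = f \<tau>" if "nome \<tau>' = nome \<tau>" "\<tau> \<in> upper_half" for \<tau> \<tau>'
  proof -
    have "nome (\<tau>' - \<tau>) = 1" using that(1) by (simp add: nome_diff)
    then obtain n :: int where "\<tau>' - \<tau> = of_int n" by (auto simp: nome_eq_1_iff)
    hence "\<tau>' = \<tau> + of_int n" by (simp add: algebra_simps)
    thus ?thesis using per_int[OF that(2)] by simp
  qed
  have f_eq: "f \<tau> = \<Phi>0 (nome \<tau>)" if "\<tau> \<in> upper_half" for \<tau>
    unfolding \<Phi>0_def by (rule eq[symmetric]) (use that nome_L in auto)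
  have diff: "\<Phi>0 field_differentiable (at q0)" if "norm q0 < 1" "q0 \<noteq> 0" for q0
  proof -
    \<comment> \<open>near \<open>q0\<close> the cut of the logarithm is avoided by rotating it away; by periodicity the branch
      does not matter\<close>
    define \<tau>0 where "\<tau>0 = L q0"
    define U where "U = ball 0 1 \<inter> {q. q / q0 \<in> - \<real>\<^sub>\<le>\<^sub>0}"
    have "open {q. q / q0 \<in> - \<real>\<^sub>\<le>\<^sub>0}"
      using open_vimage[of "- \<real>\<^sub>\<le>\<^sub>0" "\<lambda>q. q / q0"] that
      by (simp add: vimage_def open_Compl closed_nonpos_Reals_complex continuous_intros)
    hence U: "open U" "q0 \<in> U" using that by (auto simp: U_def)
    have U0: "q \<noteq> 0" if "q \<in> U" for q using that by (auto simp: U_def)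
    define M where "M = (\<lambda>q. \<tau>0 + L (q / q0))"
    have nome_M: "nome (M q) = q" if "q \<in> U" for q
      using U0[OF that] \<open>q0 \<noteq> 0\<close> by (simp add: M_def nome_add \<tau>0_def nome_L)
    have M: "M q \<in> upper_half" if "q \<in> U" for q
      using that nome_M[OF that] by (intro in_H) (simp add: U_def)
    have "M holomorphic_on U"
      unfolding M_def L_def by (intro holomorphic_intros) (use \<open>q0 \<noteq> 0\<close> in \<open>auto simp: U_def\<close>)
    hence "f \<circ> M holomorphic_on U"
      by (rule holomorphic_on_compose_gen[OF _ hol]) (use M in auto)
    hence "\<Phi>0 holomorphic_on U"
    proof (rule holomorphic_transform)
      show "(f \<circ> M) q = \<Phi>0 q" if "q \<in> U" for q
        using f_eq[OF M[OF that]] nome_M[OF that] by simp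
    qed
    thus ?thesis using U by (simp add: holomorphic_on_imp_differentiable_at)
  qed
  have hol0: "\<Phi>0 holomorphic_on ball 0 1 - {0}"
  proof (rule holomorphic_onI)
    show "\<Phi>0 field_differentiable at q within ball 0 1 - {0}" if "q \<in> ball 0 1 - {0}" for q
      by (rule field_differentiable_at_within, rule diff) (use that in auto)
  qed
  have "filterlim L at_im_infty (at 0)"
  proof (rule filterlim_at_im_inftyI)
    have "filterlim (\<lambda>x. - ln x / (2 * pi)) at_top (at_right 0)" by real_asymp
    moreover have "filterlim norm (at_right 0) (at (0 :: complex))"
      unfolding filterlim_at by (auto intro!: tendsto_eq_intros eventually_at_filter[THEN iffD2])
    ultimately have "filterlim (\<lambda>q::complex. - ln (norm q) / (2 * pi)) at_top (at 0)"
      by (rule filterlim_compose)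
    moreover have "\<forall>\<^sub>F q in at 0. - ln (norm q) / (2 * pi) = Im (L q)"
      using eventually_neq_at_within[of 0]
    proof eventually_elim
      case (elim q)
      have "2 * of_real pi * \<i> = \<i> * of_real (2 * pi)" by simp
      hence "L q = - \<i> * Ln q / of_real (2 * pi)" unfolding L_def by (simp add: field_simps)
      thus ?case using elim by (simp add: Im_divide_of_real Re_Ln)
    qed
    ultimately show "filterlim (\<lambda>q. Im (L q)) at_top (at 0)"
      by (rule filterlim_cong[OF refl refl, THEN iffD1, rotated])
  qed
  from filterlim_compose[OF lim this] have "((\<lambda>q. nome (L q) * f (L q)) \<longlongrightarrow> 0) (at 0)" .
  moreover have "\<forall>\<^sub>F q in at 0. nome (L q) * f (L q) = (q - 0) * \<Phi>0 q"
    using eventually_neq_at_within[of 0] by eventually_elim (simp add: nome_L \<Phi>0_def)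
  ultimately have "((\<lambda>q. (q - 0) * \<Phi>0 q) \<longlongrightarrow> 0) (at 0)"
    by (rule Lim_transform_eventually)
  then obtain \<Phi> where \<Phi>: "\<Phi> holomorphic_on ball 0 1" "\<And>q. q \<in> ball 0 1 - {0} \<Longrightarrow> \<Phi> q = \<Phi>0 q"
    using holomorphic_on_extend_lim[OF hol0] by auto
  show ?thesis
  proof (rule that[OF \<Phi>(1)])
    show "f \<tau> = \<Phi> (nome \<tau>)" if "\<tau> \<in> upper_half" for \<tau>
      using f_eq[OF that] \<Phi>(2)[of "nome \<tau>"] norm_nome_less_1[OF that] by simp
  qed
qed

text \<open>This makes the definite description in the definition of Fourier coefficients meaningful.\<close>

lemma nome_series_unique:
  assumes "\<forall>\<tau>\<in>upper_half. (\<lambda>n. a n * nome \<tau> ^ n) sums f \<tau>" "\<forall>\<tau>\<in>upper_half. (\<lambda>n. b n * nome \<tau> ^ n) sums f \<tau>"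
  shows "a = b"
proof -
  define c where "c = (\<lambda>n. a n - b n)"
  have sums0: "(\<lambda>n. c n * q ^ n) sums 0" if q: "norm q < 1" "q \<noteq> 0" for q
  proof -
    define \<tau> where "\<tau> = Ln q / (2 * of_real pi * \<i>)"
    have nq: "nome \<tau> = q" using q by (simp add: nome_def \<tau>_def)
    have "\<tau> \<in> upper_half"
      using q nq norm_nome[of \<tau>] by (simp add: upper_half_def zero_less_mult_iff)
    with assms have "(\<lambda>n. a n * q ^ n - b n * q ^ n) sums (f \<tau> - f \<tau>)"
      by (intro sums_diff) (auto simp: nq)
    thus ?thesis by (simp add: c_def left_diff_distrib)
  qed
  have c0: "c 0 = 0"
  proof -
    have "((\<lambda>_. 0 :: complex) \<longlongrightarrow> c 0) (at (0 :: complex))"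
      by (rule powser_limit_0_strong[of 1]) (use sums0 in auto)
    thus ?thesis by (simp add: tendsto_const_iff)
  qed
  have "c m = 0" for m
  proof (rule ccontr)
    assume m: "c m \<noteq> 0"
    hence "m > 0" using c0 by (cases m) auto
    have s: "(\<lambda>n. c n * (x - 0) ^ n) sums 0" if "norm (x - 0) < 1" for x
      using sums0[of x] c0 that by (cases "x = 0") (auto simp: sums_iff)
    obtain e where e: "e > 0" "\<And>z :: complex. z \<in> cball 0 e - {0} \<Longrightarrow> (0 :: complex) \<noteq> 0"
      using powser_0_nonzero[OF zero_less_one s refl m \<open>m > 0\<close>] by blast
    have "of_real e \<in> cball (0 :: complex) e - {0}" using e(1) by simp
    from e(2)[OF this] show False by simp
  qed
  thus ?thesis by (auto simp: c_def fun_eq_iff)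
qed

lemma fourier_coeffs_sums:
  assumes hol: "f holomorphic_on upper_half" and per: "\<And>\<tau>. \<tau> \<in> upper_half \<Longrightarrow> f (\<tau> + 1) = f \<tau>"
    and lim: "(f \<longlongrightarrow> 0) at_im_infty"
  shows "\<tau> \<in> upper_half \<Longrightarrow> (\<lambda>n. fourier_coeffs f n * nome \<tau> ^ n) sums f \<tau>"
    and "fourier_coeffs f 0 = 0"
proof -
  have n0: "(nome \<longlongrightarrow> 0) at_im_infty" using nome_tendsto_0 by (simp add: filterlim_at)
  have "((\<lambda>\<tau>. nome \<tau> * f \<tau>) \<longlongrightarrow> 0 * 0) at_im_infty" by (intro tendsto_mult n0 lim)
  then obtain \<Phi> where \<Phi>: "\<Phi> holomorphic_on ball 0 1" "\<And>\<tau>. \<tau> \<in> upper_half \<Longrightarrow> f \<tau> = \<Phi> (nome \<tau>)"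
    using periodic_eq_function_of_nome[OF hol per] by auto
  define a where "a = (\<lambda>n. (deriv ^^ n) \<Phi> 0 / fact n)"
  have a: "\<forall>\<tau>\<in>upper_half. (\<lambda>n. a n * nome \<tau> ^ n) sums f \<tau>"
  proof
    fix \<tau> assume \<tau>: "\<tau> \<in> upper_half"
    have "nome \<tau> \<in> ball 0 1" using norm_nome_less_1[OF \<tau>] by simp
    from holomorphic_power_series[OF \<Phi>(1) this]
    show "(\<lambda>n. a n * nome \<tau> ^ n) sums f \<tau>" by (simp add: a_def \<Phi>(2)[OF \<tau>])
  qed
  have fc: "fourier_coeffs f = a"
    unfolding fourier_coeffs_def
    by (rule the_equality[where P = "\<lambda>a. \<forall>\<tau>\<in>upper_half. (\<lambda>n. a n * nome \<tau> ^ n) sums f \<tau>"])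
       (use a nome_series_unique in blast)+
  show "(\<lambda>n. fourier_coeffs f n * nome \<tau> ^ n) sums f \<tau>" if "\<tau> \<in> upper_half"
    using a that by (simp add: fc)
  have "isCont \<Phi> 0"
    using \<Phi>(1) by (meson centre_in_ball continuous_on_eq_continuous_at holomorphic_on_imp_continuous_on
        open_ball zero_less_one)
  hence "((\<lambda>\<tau>. \<Phi> (nome \<tau>)) \<longlongrightarrow> \<Phi> 0) at_im_infty"
    by (rule isCont_tendsto_compose[OF _ n0])
  moreover have "\<forall>\<^sub>F \<tau> in at_im_infty. \<Phi> (nome \<tau>) = f \<tau>"
    using eventually_upper_half by eventually_elim (simp add: \<Phi>(2))
  ultimately have "(f \<longlongrightarrow> \<Phi> 0) at_im_infty"
    by (rule Lim_transform_eventually)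
  moreover have "at_im_infty \<noteq> bot"
    unfolding trivial_limit_def eventually_at_im_infty by (metis complex.sel(2) order_refl)
  ultimately have "\<Phi> 0 = 0" using lim tendsto_unique by blast
  thus "fourier_coeffs f 0 = 0" by (simp add: fc a_def)
qed

section \<open>The Hecke operator\<close>

text \<open>The map \<open>b \<mapsto> -1 / (576 b)\<close> permutes the units; the factor \<open>576\<close> is \<open>24\<^sup>2\<close> and comes from
  translations by multiples of 24.\<close>

lemma sum_unit_inversion:
  fixes G :: "int \<Rightarrow> complex"
  assumes c: "c > 0" and per: "\<And>n. G (n + int c) = G n"
    and \<iota>: "\<And>b. coprime (int b) (int c) \<Longrightarrow> [576 * int b * \<iota> b = - 1] (mod int c)"
  defines "S \<equiv> {b. b < c \<and> coprime (int b) (int c)}"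
  shows "(\<Sum>b\<in>S. G (\<iota> b)) = (\<Sum>b\<in>S. G (int b))"
proof -
  define g where "g = (\<lambda>b. nat (\<iota> b mod int c))"
  have g: "int (g b) = \<iota> b mod int c" for b using c by (simp add: g_def)
  have "finite S" by (simp add: S_def)
  have into: "g b \<in> S" if "b \<in> S" for b
  proof -
    have "[576 * int b * \<iota> b = - 1] (mod int c)" using that by (intro \<iota>) (simp add: S_def)
    hence "[- (576 * int b * \<iota> b) = - (- 1)] (mod int c)" by (simp only: cong_minus_minus_iff)
    hence "[\<iota> b * (- 576 * int b) = 1] (mod int c)" by (simp add: mult_ac)
    hence "coprime (\<iota> b) (int c)" by (metis coprime_iff_invertible_int)
    hence "coprime (int (g b)) (int c)" by (simp add: g coprime_mod_left_iff c)
    moreover have "g b < c" using c by (simp add: g_def nat_less_iff)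
    ultimately show ?thesis by (simp add: S_def)
  qed
  have "inj_on g S"
  proof (rule inj_onI)
    fix b b' assume b: "b \<in> S" "b' \<in> S" "g b = g b'"
    have \<iota>b: "[576 * int b * \<iota> b = - 1] (mod int c)" and \<iota>b': "[576 * int b' * \<iota> b' = - 1] (mod int c)"
      using b by (auto intro!: \<iota> simp: S_def)
    have "[\<iota> b = \<iota> b'] (mod int c)" using b(3) g[of b] g[of b'] by (simp add: cong_def)
    hence *: "[(576 * int b * int b') * \<iota> b = (576 * int b * int b') * \<iota> b'] (mod int c)"
      by (rule cong_scalar_left)
    have "[int b' * (576 * int b * \<iota> b) = int b' * - 1] (mod int c)" by (rule cong_scalar_left[OF \<iota>b])
    moreover have "[int b * (576 * int b' * \<iota> b') = int b * - 1] (mod int c)" by (rule cong_scalar_left[OF \<iota>b'])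
    moreover have "int b' * (576 * int b * \<iota> b) = (576 * int b * int b') * \<iota> b"
      "int b * (576 * int b' * \<iota> b') = (576 * int b * int b') * \<iota> b'" by simp_all
    ultimately have "[int b' * - 1 = int b * - 1] (mod int c)"
      using * by (metis cong_sym cong_trans)
    hence "[- int b' = - int b] (mod int c)" by simp
    hence "[int b' = int b] (mod int c)" by (simp only: cong_minus_minus_iff)
    thus "b = b'" using b by (simp add: S_def cong_def flip: of_nat_mod)
  qed
  hence bij: "bij_betw g S S"
    using into \<open>finite S\<close> by (simp add: bij_betw_def endo_inj_surj image_subset_iff)
  have "(\<Sum>b\<in>S. G (\<iota> b)) = (\<Sum>b\<in>S. G (int (g b)))"
    using periodic_mod(2)[of G "int c", OF per] by (simp add: g)
  also have "\<dots> = (\<Sum>b\<in>S. G (int b))" by (rule sum.reindex_bij_betw[OF bij])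
  finally show ?thesis .
qed

locale eta_multiple = odd_prime +
  fixes r s :: nat and f :: "complex \<Rightarrow> complex"
  assumes l_neq_3: "l \<noteq> 3" and odd_r: "odd r" and r_less: "r < 24" and even_s: "even s"
    and f: "f \<in> modular_forms s"
begin

definition "k = s + (r - 1) div 2"

definition "h = (\<lambda>\<tau>. dedekind_eta \<tau> ^ r * f \<tau>)"

text \<open>The factor by which \<open>h\<close> changes under \<open>\<tau> \<mapsto> -1 / \<tau>\<close>.\<close>

definition automorphy :: "complex \<Rightarrow> complex" where "automorphy \<tau> = csqrt (- \<i> * \<tau>) ^ r * \<tau> ^ s"

abbreviation leg :: "int \<Rightarrow> complex" where "leg n \<equiv> of_int (Legendre n (int l))"

definition units :: "nat \<Rightarrow> nat set" where "units c = {b. b < c \<and> coprime (int b) (int c)}"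

lemma r_pos: "r > 0" using odd_r by (cases r) auto

lemma twice_k: "2 * k + 1 = r + 2 * s"
  using odd_r by (auto simp: k_def elim: oddE)

lemma l_not_dvd: "\<not> 2 dvd int l" "\<not> 3 dvd int l"
proof -
  have "\<not> 2 dvd l" "\<not> 3 dvd l"
    using prime_l l_gt_2 l_neq_3 primes_dvd_imp_eq[of 2 l] primes_dvd_imp_eq[of 3 l] by auto
  thus "\<not> 2 dvd int l" "\<not> 3 dvd int l" by presburger+
qed

lemma coprime_576_l: "coprime 576 (int l)"
proof -
  have "coprime (int l) 2" "coprime (int l) 3"
    using coprime_l_iff[of 2] coprime_l_iff[of 3] l_gt_2 l_neq_3
      zdvd_imp_le[of "int l" 2] zdvd_imp_le[of "int l" 3] by (auto simp: coprime_commute)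
  hence "coprime (int l) (2 ^ 6 * 3 ^ 2)"
    by (simp only: coprime_mult_right_iff coprime_power_right_iff) simp
  thus ?thesis by (simp add: coprime_commute)
qed

lemma chi12_l_square: "chi12 (int l) * chi12 (int l) = 1"
  by (rule chi12_self_square[OF l_not_dvd])

lemma l_square_eq: obtains m :: int where "int l ^ 2 = 1 + 24 * m"
proof -
  note witness = that
  have *: thesis if t: "int l mod 12 = t" "t ^ 2 = 1 + 24 * u" for t u
  proof -
    define q where "q = int l div 12"
    have "int l = 12 * q + t" unfolding q_def t(1)[symmetric] by simp
    hence "int l ^ 2 = 24 * (6 * q ^ 2 + q * t) + t ^ 2"
      by (simp add: power2_eq_square algebra_simps)
    hence "int l ^ 2 = 1 + 24 * (6 * q ^ 2 + q * t + u)" by (simp add: t(2))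
    thus thesis by (rule witness)
  qed
  show ?thesis
    using *[of 1 0] *[of 5 1] *[of 7 2] *[of 11 5] by (rule coprime_12_cases[OF l_not_dvd]) simp_all
qed

lemma exists_inverse:
  assumes "coprime (int b) (int (l ^ e))"
  shows "\<exists>x. [576 * int b * x = - 1] (mod int (l ^ e))"
proof -
  have "coprime (576 * int b) (int (l ^ e))" using coprime_576_l assms by simp
  then obtain x where "[576 * int b * x = 1] (mod int (l ^ e))" using cong_solve_coprime_int by blast
  hence "[- (576 * int b * x) = - 1] (mod int (l ^ e))" by (simp only: cong_minus_minus_iff)
  thus ?thesis by (intro exI[of _ "- x"]) simp
qed

definition neg_inverse :: "nat \<Rightarrow> nat \<Rightarrow> int" where
  "neg_inverse e b = (SOME x. [576 * int b * x = - 1] (mod int (l ^ e)))"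

lemma neg_inverse_cong: "coprime (int b) (int (l ^ e)) \<Longrightarrow> [576 * int b * neg_inverse e b = - 1] (mod int (l ^ e))"
  unfolding neg_inverse_def by (rule someI_ex[OF exists_inverse])

lemma sum_units_inversion:
  fixes G :: "int \<Rightarrow> complex"
  assumes "\<And>n. G (n + int (l ^ e)) = G n"
  shows "(\<Sum>b\<in>units (l ^ e). G (neg_inverse e b)) = (\<Sum>b\<in>units (l ^ e). G (int b))"
  unfolding units_def by (rule sum_unit_inversion) (use l_pos assms neg_inverse_cong in auto)

lemma finite_units [simp]: "finite (units c)"
  by (simp add: units_def)

lemma units_prime_iff: "b \<in> units l \<longleftrightarrow> b < l \<and> b > 0"
proof -
  have "int l dvd int b \<longleftrightarrow> l dvd b" by simp
  thus ?thesis using coprime_l_iff[of "int b"] by (auto simp: units_def dest: nat_dvd_not_less intro: Nat.gr0I)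
qed

lemma units_prime_square_iff: "b \<in> units (l ^ 2) \<longleftrightarrow> b < l ^ 2 \<and> \<not> l dvd b"
  using coprime_l_iff[of "int b"] by (simp add: units_def)

lemma sum_split_square:
  fixes F :: "nat \<Rightarrow> complex"
  shows "(\<Sum>b<l ^ 2. F b) = (\<Sum>b\<in>units (l ^ 2). F b) + F 0 + (\<Sum>b\<in>units l. F (l * b))"
proof -
  have "{..<l ^ 2} = units (l ^ 2) \<union> (*) l ` {..<l}"
  proof (intro equalityI subsetI)
    fix b assume b: "b \<in> {..<l ^ 2}"
    show "b \<in> units (l ^ 2) \<union> (*) l ` {..<l}"
    proof (cases "l dvd b")
      case True
      then obtain j where j: "b = l * j" by auto
      hence "j < l" using b l_pos by (simp add: power2_eq_square)
      thus ?thesis using j by blast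
    qed (use b in \<open>simp add: units_prime_square_iff\<close>)
  next
    fix b assume "b \<in> units (l ^ 2) \<union> (*) l ` {..<l}"
    thus "b \<in> {..<l ^ 2}"
    proof
      assume "b \<in> (*) l ` {..<l}"
      then obtain j where "b = l * j" "j < l" by auto
      thus ?thesis using l_pos by (simp add: power2_eq_square)
    qed (simp add: units_prime_square_iff)
  qed
  moreover have "units (l ^ 2) \<inter> (*) l ` {..<l} = {}"
    by (auto simp: units_prime_square_iff)
  ultimately have "(\<Sum>b<l ^ 2. F b) = (\<Sum>b\<in>units (l ^ 2). F b) + (\<Sum>b\<in>(*) l ` {..<l}. F b)"
    by (simp only: sum.union_disjoint finite_imageI finite_lessThan finite_units)
  also have "(\<Sum>b\<in>(*) l ` {..<l}. F b) = (\<Sum>b<l. F (l * b))"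
    using l_pos by (subst sum.reindex) (auto simp: inj_on_def)
  also have "{..<l} = insert 0 (units l)"
    using l_pos by (auto simp: units_prime_iff)
  also have "(\<Sum>b\<in>insert 0 (units l). F (l * b)) = F 0 + (\<Sum>b\<in>units l. F (l * b))"
    by (subst sum.insert) (auto simp: units_prime_iff)
  finally show ?thesis by (simp add: add.assoc)
qed

lemma sum_leg_units:
  fixes F :: "nat \<Rightarrow> complex"
  shows "(\<Sum>b<l. leg (int b) * F b) = (\<Sum>b\<in>units l. leg (int b) * F b)"
proof -
  have "{..<l} = insert 0 (units l)" using l_pos by (auto simp: units_prime_iff)
  moreover have "Legendre 0 (int l) = 0" by (simp add: Legendre_def)
  ultimately show ?thesis by (simp add: units_prime_iff)
qed

subsection \<open>Transformations of the eta multiple\<close>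

lemma h_holomorphic: "h holomorphic_on upper_half"
  unfolding h_def by (intro holomorphic_intros dedekind_eta_holomorphic modular_form_holomorphic[OF f])

lemma h_tendsto_0: "(h \<longlongrightarrow> 0) at_im_infty"
  unfolding h_def by (rule eta_multiple_tendsto_0[OF f r_pos])

lemma h_add_of_int:
  assumes "\<tau> \<in> upper_half"
  shows "h (\<tau> + of_int n) = nome (of_int (int r * n) / 24) * h \<tau>"
proof -
  have one: "h (w + 1) = nome (of_nat r / 24) * h w" if "w \<in> upper_half" for w
    using modular_form_add_1[OF f that]
    by (simp add: h_def dedekind_eta_add_1 power_mult_distrib nome_power)
  have in_H: "\<tau> + of_int i \<in> upper_half" for i using assms by (simp add: upper_half_def)
  have split: "nome (of_int (int r * (i + 1)) / 24) = nome (of_nat r / 24) * nome (of_int (int r * i) / 24)" for i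
    unfolding nome_add[symmetric] by (rule arg_cong[of _ _ nome]) (simp add: field_simps)
  show ?thesis
  proof (induction n rule: int_induct[of _ 0])
    case (step1 i)
    thus ?case using one[OF in_H[of i]] split[of i] by (simp add: add.assoc)
  next
    case (step2 i)
    thus ?case using one[OF in_H[of "i - 1"]] split[of "i - 1"] by simp
  qed simp
qed

lemma h_add_24: "\<tau> \<in> upper_half \<Longrightarrow> h (\<tau> + of_int (24 * n)) = h \<tau>"
proof -
  assume "\<tau> \<in> upper_half"
  moreover have "(of_int (int r * (24 * n)) / 24 :: complex) = of_int (int r * n)" by simp
  ultimately show ?thesis
    using h_add_of_int[of \<tau> "24 * n"] by (simp only: nome_of_int) simp
qed

lemma h_mobius:
  assumes det: "(24 * b) * (24 * d) - \<beta> * c = (1::int)" and c: "c > 0" and w: "w \<in> upper_half"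
  shows "h (mobius (24 * b) \<beta> c (24 * d) w)
     = (chi12 c * gauss_sum b (nat c) / of_real (sqrt (of_int c))) ^ r * automorphy (of_int c * w + of_int (24 * d)) * h w"
  unfolding h_def automorphy_def dedekind_eta_mobius[OF det c w] modular_form_mobius[OF f det w]
  by (simp only: power_mult_distrib mult_ac)

lemma automorphy_scale: "x > 0 \<Longrightarrow> automorphy (of_real x * \<tau>) = of_real (sqrt x) ^ r * of_real x ^ s * automorphy \<tau>"
  using csqrt_scale[of x "- \<i> * \<tau>"] by (simp add: automorphy_def power_mult_distrib mult_ac)

lemma S_upper_half: "\<tau> \<in> upper_half \<Longrightarrow> - 1 / \<tau> \<in> upper_half"
  using mobius_in_upper_half[of 0 0 "-1" 1 \<tau>] by (simp add: mobius_def)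

lemma automorphy_S:
  assumes "\<tau> \<in> upper_half"
  shows "automorphy \<tau> * automorphy (- 1 / \<tau>) = 1"
proof -
  have t0: "\<tau> \<noteq> 0" using assms by (auto simp: upper_half_def)
  have re: "Re (- \<i> * \<tau>) > 0" using assms by (simp add: upper_half_def)
  have "- \<i> * (- 1 / \<tau>) = 1 / (- \<i> * \<tau>)" using t0 by (simp add: field_simps)
  hence "csqrt (- \<i> * (- 1 / \<tau>)) = 1 / csqrt (- \<i> * \<tau>)" by (simp only: csqrt_one_over[OF re])
  moreover have "csqrt (- \<i> * \<tau>) \<noteq> 0" using t0 by simp
  moreover have "\<tau> ^ s * (- 1 / \<tau>) ^ s = 1"
    using t0 even_s by (simp add: power_mult_distrib[symmetric])
  ultimately show ?thesis by (simp add: automorphy_def power_divide)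
qed

lemma h_S: "\<tau> \<in> upper_half \<Longrightarrow> h (- 1 / \<tau>) = automorphy \<tau> * h \<tau>"
proof -
  assume "\<tau> \<in> upper_half"
  moreover have "gauss_sum 0 (nat 1) = 1" by (simp add: gauss_sum_def)
  ultimately show ?thesis using h_mobius[of 0 0 "-1" 1 \<tau>] by (simp add: mobius_def)
qed

text \<open>The three kinds of representatives of determinant \<open>l\<^sup>2\<close>: \<open>\<tau> \<mapsto> (\<tau> + 24 b) / l\<^sup>2\<close>,
  \<open>\<tau> \<mapsto> \<tau> + 24 b / l\<close> and \<open>\<tau> \<mapsto> l\<^sup>2 \<tau>\<close>. The translations are multiples of 24 so that the
  multiplier of the eta function does not interfere.\<close>

definition A :: "complex \<Rightarrow> int \<Rightarrow> complex" where "A \<tau> b = h ((\<tau> + of_int (24 * b)) / of_nat l ^ 2)"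

definition B :: "complex \<Rightarrow> int \<Rightarrow> complex" where "B \<tau> b = h (\<tau> + of_int (24 * b) / of_nat l)"

lemma divide_upper_half: "\<tau> \<in> upper_half \<Longrightarrow> (\<tau> + of_int n) / of_nat l ^ 2 \<in> upper_half"
  using Im_divide_of_real[of "\<tau> + of_int n" "real l ^ 2"] l_pos by (simp add: upper_half_def)

lemma translate_upper_half: "\<tau> \<in> upper_half \<Longrightarrow> \<tau> + of_int n / of_nat l \<in> upper_half"
  using Im_divide_of_real[of "of_int n" "real l"] by (simp add: upper_half_def)

lemma A_periodic:
  assumes "\<tau> \<in> upper_half"
  shows "A \<tau> (b + int (l ^ 2)) = A \<tau> b"
proof -
  have "(\<tau> + of_int (24 * (b + int (l ^ 2)))) / of_nat l ^ 2 = (\<tau> + of_int (24 * b)) / of_nat l ^ 2 + of_int (24 * 1)"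
    using l_pos by (simp add: field_simps)
  thus ?thesis unfolding A_def by (simp only: h_add_24[OF divide_upper_half[OF assms]])
qed

lemma B_periodic:
  assumes "\<tau> \<in> upper_half"
  shows "B \<tau> (b + int l) = B \<tau> b"
proof -
  have "\<tau> + of_int (24 * (b + int l)) / of_nat l = \<tau> + of_int (24 * b) / of_nat l + of_int (24 * 1)"
    using l_pos by (simp add: field_simps)
  thus ?thesis unfolding B_def by (simp only: h_add_24[OF translate_upper_half[OF assms]])
qed

text \<open>Here the matrix has lower left entry \<open>l\<^sup>2\<close>, and the multiplier is \<open>1\<close>.\<close>

lemma A_S_unit:
  assumes \<tau>: "\<tau> \<in> upper_half" and b: "b \<in> units (l ^ 2)"
  shows "A (- 1 / \<tau>) (int b) = automorphy \<tau> * A \<tau> (neg_inverse 2 b)"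
proof -
  define x where "x = neg_inverse 2 b"
  have bl: "\<not> int l dvd int b" using b by (simp add: units_prime_square_iff)
  have t0: "\<tau> \<noteq> 0" using \<tau> by (auto simp: upper_half_def)
  have "[576 * int b * x = - 1] (mod int (l ^ 2))"
    unfolding x_def using b by (intro neg_inverse_cong) (simp add: units_def)
  then obtain \<beta> where \<beta>: "576 * int b * x - (- 1) = int (l ^ 2) * \<beta>"
    unfolding cong_iff_dvd_diff dvd_def by blast
  define w where "w = (\<tau> + of_int (24 * x)) / of_nat l ^ 2"
  have w: "w \<in> upper_half" unfolding w_def by (rule divide_upper_half[OF \<tau>])
  have det: "(24 * int b) * (24 * (- x)) - (- \<beta>) * int (l ^ 2) = 1"
    using \<beta> by (simp add: algebra_simps)
  have c: "int (l ^ 2) > 0" using l_pos by simp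
  have den: "of_int (int (l ^ 2)) * w + of_int (24 * (- x)) = \<tau>"
    using l_pos by (simp add: w_def field_simps)
  have \<beta>': "of_nat l ^ 2 * of_int \<beta> = (576 * of_int (int b) * of_int x + 1 :: complex)"
    using arg_cong[OF \<beta>, of "of_int :: int \<Rightarrow> complex"] by simp
  have num: "of_int (24 * int b) * w + of_int (- \<beta>) = (of_int (24 * int b) * \<tau> - 1) / of_nat l ^ 2"
    using l_pos \<beta>' by (simp add: w_def field_simps)
  have "mobius (24 * int b) (- \<beta>) (int (l ^ 2)) (24 * (- x)) w = (- 1 / \<tau> + of_int (24 * int b)) / of_nat l ^ 2"
    unfolding mobius_def den num using t0 l_pos by (simp add: field_simps)
  hence "A (- 1 / \<tau>) (int b) = h (mobius (24 * int b) (- \<beta>) (int (l ^ 2)) (24 * (- x)) w)"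
    by (simp only: A_def)
  also have "\<dots> = (chi12 (int (l ^ 2)) * gauss_sum (int b) (nat (int (l ^ 2))) / of_real (sqrt (of_int (int (l ^ 2))))) ^ r
      * automorphy \<tau> * h w"
    unfolding h_mobius[OF det c w] den ..
  also have "chi12 (int (l ^ 2)) * gauss_sum (int b) (nat (int (l ^ 2))) / of_real (sqrt (of_int (int (l ^ 2)))) = 1"
  proof -
    have "chi12 (int (l ^ 2)) = 1" using chi12_l_square by (simp add: power2_eq_square chi12_mult)
    moreover have "gauss_sum (int b) (nat (int (l ^ 2))) = of_nat l"
      using gauss_sum_prime_square[OF bl] by (simp only: nat_int)
    moreover have "sqrt (of_int (int (l ^ 2))) = real l" by simp
    ultimately show ?thesis using l_pos by simp
  qed
  finally show ?thesis by (simp add: A_def x_def w_def)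
qed

text \<open>The constant that remains from the multiplier of a matrix with lower left entry \<open>l\<close> when its
  Legendre symbol is split off.\<close>

definition nonunit_const :: complex where "nonunit_const = (chi12 (int l) * legendre_gauss_sum l) ^ r * of_nat l ^ s"

lemma leg_square_unit: "b \<in> units l \<Longrightarrow> leg (int b) * leg (int b) = 1"
  using Legendre_self_square[of l "int b"] coprime_l_iff[of "int b"]
  by (simp add: units_def flip: of_int_mult)

lemma A_S_nonunit:
  assumes \<tau>: "\<tau> \<in> upper_half" and b: "b \<in> units l"
  shows "A (- 1 / \<tau>) (int (l * b)) = nonunit_const * leg (- 1) * automorphy \<tau> * (leg (neg_inverse 1 b) * B \<tau> (neg_inverse 1 b))"
proof -
  define x where "x = neg_inverse 1 b"
  have bl: "\<not> int l dvd int b" using b coprime_l_iff[of "int b"] by (simp add: units_def)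
  have t0: "\<tau> \<noteq> 0" using \<tau> by (auto simp: upper_half_def)
  have cong: "[576 * int b * x = - 1] (mod int l)"
    using neg_inverse_cong[of b 1] b by (simp add: x_def units_def)
  then obtain \<beta> where \<beta>: "576 * int b * x - (- 1) = int l * \<beta>"
    unfolding cong_iff_dvd_diff dvd_def by blast
  define w where "w = \<tau> + of_int (24 * x) / of_nat l"
  have w: "w \<in> upper_half" unfolding w_def by (rule translate_upper_half[OF \<tau>])
  have det: "(24 * int b) * (24 * (- x)) - (- \<beta>) * int l = 1"
    using \<beta> by (simp add: algebra_simps)
  have c: "int l > 0" using l_pos by simp
  have den: "of_int (int l) * w + of_int (24 * (- x)) = of_real (real l) * \<tau>"
    using l_pos by (simp add: w_def field_simps)
  have \<beta>': "of_nat l * of_int \<beta> = (576 * of_int (int b) * of_int x + 1 :: complex)"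
    using arg_cong[OF \<beta>, of "of_int :: int \<Rightarrow> complex"] by simp
  have num: "of_int (24 * int b) * w + of_int (- \<beta>) = (of_int (24 * int b) * of_nat l * \<tau> - 1) / of_nat l"
    using l_pos \<beta>' by (simp add: w_def field_simps)
  have "mobius (24 * int b) (- \<beta>) (int l) (24 * (- x)) w = (- 1 / \<tau> + of_int (24 * int (l * b))) / of_nat l ^ 2"
    unfolding mobius_def den num using t0 l_pos by (simp add: field_simps power2_eq_square)
  hence "A (- 1 / \<tau>) (int (l * b)) = h (mobius (24 * int b) (- \<beta>) (int l) (24 * (- x)) w)"
    by (simp only: A_def)
  also have "\<dots> = (chi12 (int l) * gauss_sum (int b) (nat (int l)) / of_real (sqrt (of_int (int l)))) ^ r
      * automorphy (of_real (real l) * \<tau>) * h w"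
    unfolding h_mobius[OF det c w] den ..
  also have "gauss_sum (int b) (nat (int l)) = leg (int b) * legendre_gauss_sum l"
    using gauss_sum_prime[OF bl] by simp
  also have "automorphy (of_real (real l) * \<tau>) = of_real (sqrt (real l)) ^ r * of_nat l ^ s * automorphy \<tau>"
    using automorphy_scale[of "real l" \<tau>] l_pos by simp
  also have "(chi12 (int l) * (leg (int b) * legendre_gauss_sum l) / of_real (sqrt (of_int (int l)))) ^ r
        * (of_real (sqrt (real l)) ^ r * of_nat l ^ s * automorphy \<tau>) * h w
      = nonunit_const * leg (int b) ^ r * automorphy \<tau> * h w"
    using l_pos by (simp add: nonunit_const_def power_mult_distrib power_divide)
  also have "leg (int b) ^ r = leg (int b)"
  proof -
    obtain j where "r = 2 * j + 1" using odd_r by (auto elim: oddE)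
    thus ?thesis using leg_square_unit[OF b] by (simp add: power_mult power2_eq_square)
  qed
  also have "leg (int b) = leg (- 1) * leg x"
  proof -
    have n24: "\<not> int l dvd 24"
    proof
      assume "int l dvd 24"
      hence "int l dvd 576" by (rule dvd_trans) simp
      thus False using coprime_576_l coprime_l_iff[of 576] by simp
    qed
    have "Legendre (-1) (int l) = Legendre (24 ^ 2 * (int b * x)) (int l)"
      by (rule Legendre_cong[OF cong_sym]) (use cong in \<open>simp add: mult.assoc\<close>)
    also have "\<dots> = Legendre (int b) (int l) * Legendre x (int l)"
      unfolding Legendre_mult[OF prime_l l_gt_2] Legendre_square[OF prime_l l_gt_2 n24] by simp
    finally have L: "Legendre (-1) (int l) = Legendre (int b) (int l) * Legendre x (int l)" .
    have "\<not> int l dvd x"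
    proof
      assume "int l dvd x"
      hence "int l dvd 576 * int b * x" by simp
      moreover have "int l dvd 576 * int b * x + 1" using cong by (simp add: cong_iff_dvd_diff)
      ultimately have "int l dvd 1" by (simp only: dvd_add_right_iff)
      thus False using l_gt_2 by simp
    qed
    from Legendre_self_square[OF this]
    have "Legendre (-1) (int l) * Legendre x (int l) = Legendre (int b) (int l)"
      unfolding L by (simp add: mult.assoc)
    thus ?thesis by (simp flip: of_int_mult)
  qed
  finally show ?thesis by (simp add: B_def x_def w_def mult_ac)
qed

text \<open>Chosen so that the involution exchanges the two kinds of terms in the next definition correctly.
  It turns out to be the coefficient in the Hecke operator divided by the Gauss sum.\<close>

definition twist_const :: complex where "twist_const = nonunit_const * leg (- 1) / of_nat l ^ 2"

text \<open>The Hecke operator acting on \<open>h\<close> instead of \<open>h (24 \<tau>)\<close>.\<close>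

definition hecke_h :: "complex \<Rightarrow> complex" where
  "hecke_h \<tau> = (\<Sum>b<l ^ 2. A \<tau> (int b)) / of_nat l ^ 2 + twist_const * (\<Sum>b<l. leg (int b) * B \<tau> (int b))
                + of_nat l ^ (2 * k) / of_nat l * h (of_nat l ^ 2 * \<tau>)"

lemma sum_A_S_nonunit:
  assumes \<tau>: "\<tau> \<in> upper_half"
  shows "(\<Sum>b\<in>units l. A (- 1 / \<tau>) (int (l * b))) = nonunit_const * leg (- 1) * automorphy \<tau> * (\<Sum>b<l. leg (int b) * B \<tau> (int b))"
proof -
  have "(\<Sum>b\<in>units l. A (- 1 / \<tau>) (int (l * b)))
      = nonunit_const * leg (- 1) * automorphy \<tau> * (\<Sum>b\<in>units l. leg (neg_inverse 1 b) * B \<tau> (neg_inverse 1 b))"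
    unfolding sum_distrib_left by (intro sum.cong refl A_S_nonunit \<tau>)
  also have "(\<Sum>b\<in>units l. leg (neg_inverse 1 b) * B \<tau> (neg_inverse 1 b)) = (\<Sum>b\<in>units l. leg (int b) * B \<tau> (int b))"
    using sum_units_inversion[of "\<lambda>b. leg b * B \<tau> b" 1] by (simp add: Legendre_periodic B_periodic[OF \<tau>])
  finally show ?thesis by (simp only: sum_leg_units)
qed

lemma h_dilate_S:
  assumes \<tau>: "\<tau> \<in> upper_half" and x: "x > 0"
  shows "h (- 1 / (of_real x * \<tau>)) = of_real (sqrt x) ^ r * of_real x ^ s * automorphy \<tau> * h (of_real x * \<tau>)"
  using h_S[of "of_real x * \<tau>"] \<tau> x by (simp add: upper_half_def automorphy_scale)

text \<open>The involution exchanges the representatives of the second kind with those of the first kind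
  with \<open>l\<close> dividing \<open>b\<close>, and \<open>b = 0\<close> with the third kind.\<close>

lemma hecke_h_S:
  assumes \<tau>: "\<tau> \<in> upper_half"
  shows "hecke_h (- 1 / \<tau>) = automorphy \<tau> * hecke_h \<tau>"
proof -
  let ?L = "of_nat l :: complex"
  have L0: "?L \<noteq> 0" using l_pos by simp
  have t0: "\<tau> \<noteq> 0" using \<tau> by (auto simp: upper_half_def)
  define U where "U = (\<Sum>b\<in>units (l ^ 2). A \<tau> (int b))"
  define V where "V = (\<Sum>b\<in>units l. A \<tau> (int (l * b)))"
  define W where "W = (\<Sum>b<l. leg (int b) * B \<tau> (int b))"
  define W' where "W' = (\<Sum>b<l. leg (int b) * B (- 1 / \<tau>) (int b))"
  have 1: "(\<Sum>b\<in>units (l ^ 2). A (- 1 / \<tau>) (int b)) = automorphy \<tau> * U"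
  proof -
    have "(\<Sum>b\<in>units (l ^ 2). A (- 1 / \<tau>) (int b)) = automorphy \<tau> * (\<Sum>b\<in>units (l ^ 2). A \<tau> (neg_inverse 2 b))"
      unfolding sum_distrib_left by (intro sum.cong refl A_S_unit \<tau>)
    also have "(\<Sum>b\<in>units (l ^ 2). A \<tau> (neg_inverse 2 b)) = U"
      unfolding U_def by (rule sum_units_inversion) (rule A_periodic[OF \<tau>])
    finally show ?thesis .
  qed
  have "sqrt (real l ^ 2) = real l" by simp
  hence 2: "A (- 1 / \<tau>) 0 = ?L ^ (r + 2 * s) * automorphy \<tau> * h (?L ^ 2 * \<tau>)"
    using h_dilate_S[OF \<tau>, of "real l ^ 2"] l_pos t0
    by (simp add: A_def power_add power_mult[symmetric] mult.commute)
  have 3: "(\<Sum>b\<in>units l. A (- 1 / \<tau>) (int (l * b))) = twist_const * ?L ^ 2 * automorphy \<tau> * W"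
    unfolding sum_A_S_nonunit[OF \<tau>] W_def twist_const_def using L0 by simp
  have "- 1 / (- 1 / \<tau>) = \<tau>" by simp
  hence "V = twist_const * ?L ^ 2 * automorphy (- 1 / \<tau>) * W'"
    using sum_A_S_nonunit[OF S_upper_half[OF \<tau>]] L0 by (simp add: V_def W'_def twist_const_def)
  hence "automorphy \<tau> * V = twist_const * ?L ^ 2 * (automorphy \<tau> * automorphy (- 1 / \<tau>)) * W'" by (simp only: mult_ac)
  hence "automorphy \<tau> * V = twist_const * ?L ^ 2 * W'" unfolding automorphy_S[OF \<tau>] by simp
  hence 4: "twist_const * W' = automorphy \<tau> * V / ?L ^ 2" using L0 by (simp only:) simp
  have 5: "?L ^ (2 * k) / ?L * h (?L ^ 2 * (- 1 / \<tau>)) = automorphy \<tau> * A \<tau> 0 / ?L ^ 2"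
  proof -
    have "h (?L ^ 2 * (- 1 / \<tau>)) = h (- 1 / (of_real (1 / real l ^ 2) * \<tau>))"
      using L0 t0 by (simp add: field_simps)
    also have "\<dots> = of_real (sqrt (1 / real l ^ 2)) ^ r * of_real (1 / real l ^ 2) ^ s * automorphy \<tau> * h (of_real (1 / real l ^ 2) * \<tau>)"
      by (rule h_dilate_S[OF \<tau>]) (use l_pos in simp)
    also have "of_real (sqrt (1 / real l ^ 2)) ^ r * of_real (1 / real l ^ 2) ^ s = 1 / ?L ^ (r + 2 * s)"
      by (simp add: real_sqrt_divide power_add power_divide power_mult)
    also have "h (of_real (1 / real l ^ 2) * \<tau>) = A \<tau> 0" by (simp add: A_def)
    finally show ?thesis
      unfolding twice_k[symmetric] using L0 by (simp add: power_add power2_eq_square field_simps)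
  qed
  have "hecke_h (- 1 / \<tau>) = (automorphy \<tau> * U + ?L ^ (r + 2 * s) * automorphy \<tau> * h (?L ^ 2 * \<tau>) + twist_const * ?L ^ 2 * automorphy \<tau> * W) / ?L ^ 2
      + automorphy \<tau> * V / ?L ^ 2 + automorphy \<tau> * A \<tau> 0 / ?L ^ 2"
    unfolding hecke_h_def sum_split_square 1 3 4[symmetric] 5 W'_def of_nat_0 2 ..
  also have "?L ^ (r + 2 * s) = ?L ^ (2 * k) / ?L * ?L ^ 2"
    unfolding twice_k[symmetric] using L0 by (simp add: power_add power2_eq_square)
  also have "(automorphy \<tau> * U + ?L ^ (2 * k) / ?L * ?L ^ 2 * automorphy \<tau> * h (?L ^ 2 * \<tau>) + twist_const * ?L ^ 2 * automorphy \<tau> * W) / ?L ^ 2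
      + automorphy \<tau> * V / ?L ^ 2 + automorphy \<tau> * A \<tau> 0 / ?L ^ 2
    = automorphy \<tau> * ((U + A \<tau> 0 + V) / ?L ^ 2 + twist_const * W + ?L ^ (2 * k) / ?L * h (?L ^ 2 * \<tau>))"
    using L0 by (simp add: add_divide_distrib ring_distribs mult_ac)
  also have "\<dots> = automorphy \<tau> * hecke_h \<tau>"
    unfolding hecke_h_def sum_split_square U_def V_def W_def by simp
  finally show ?thesis .
qed

text \<open>As \<open>l\<^sup>2\<close> is \<open>1\<close> modulo 24, a translation by \<open>1\<close> is one by \<open>l\<^sup>2\<close> and a multiple of 24.\<close>

lemma hecke_h_T:
  assumes \<tau>: "\<tau> \<in> upper_half"
  shows "hecke_h (\<tau> + 1) = nome (of_nat r / 24) * hecke_h \<tau>"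
proof -
  let ?\<omega> = "nome (of_nat r / 24)"
  obtain m where m: "int l ^ 2 = 1 + 24 * m" by (rule l_square_eq)
  have mc: "of_nat l ^ 2 = (1 + 24 * of_int m :: complex)"
    using arg_cong[OF m, of "of_int :: int \<Rightarrow> complex"] by simp
  have L0: "(of_nat l :: complex) \<noteq> 0" using l_pos by simp
  have one: "h (w + 1) = ?\<omega> * h w" if "w \<in> upper_half" for w
    using h_add_of_int[OF that, of 1] by simp
  have "A (\<tau> + 1) b = ?\<omega> * A \<tau> (b + (- m))" for b
  proof -
    have "(\<tau> + 1 + of_int (24 * b)) / of_nat l ^ 2 = (\<tau> + of_int (24 * (b + (- m))) + of_nat l ^ 2) / of_nat l ^ 2"
      unfolding mc by (simp add: algebra_simps)
    also have "\<dots> = (\<tau> + of_int (24 * (b + (- m)))) / of_nat l ^ 2 + 1"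
      using L0 by (simp add: add_divide_distrib)
    finally show ?thesis unfolding A_def by (simp only: one[OF divide_upper_half[OF \<tau>]])
  qed
  hence "(\<Sum>b<l ^ 2. A (\<tau> + 1) (int b)) = ?\<omega> * (\<Sum>b<l ^ 2. A \<tau> (int b + (- m)))"
    by (simp only: sum_distrib_left)
  also have "(\<Sum>b<l ^ 2. A \<tau> (int b + (- m))) = (\<Sum>b<l ^ 2. A \<tau> (int b))"
    by (rule sum_periodic_shift) (use l_pos A_periodic[OF \<tau>] in auto)
  finally have 1: "(\<Sum>b<l ^ 2. A (\<tau> + 1) (int b)) = ?\<omega> * (\<Sum>b<l ^ 2. A \<tau> (int b))" .
  have "B (\<tau> + 1) b = ?\<omega> * B \<tau> b" for b
    unfolding B_def using one[OF translate_upper_half[OF \<tau>, of "24 * b"]] by (simp add: add_ac)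
  hence 2: "(\<Sum>b<l. leg (int b) * B (\<tau> + 1) (int b)) = ?\<omega> * (\<Sum>b<l. leg (int b) * B \<tau> (int b))"
    by (simp add: sum_distrib_left mult_ac)
  have 3: "h (of_nat l ^ 2 * (\<tau> + 1)) = ?\<omega> * h (of_nat l ^ 2 * \<tau>)"
  proof -
    have "of_nat l ^ 2 * \<tau> \<in> upper_half"
    proof -
      have "Im (of_real (real l ^ 2) * \<tau>) > 0" using \<tau> l_pos by (simp add: upper_half_def)
      thus ?thesis by (simp add: upper_half_def)
    qed
    hence "h (of_nat l ^ 2 * \<tau> + of_int (int l ^ 2)) = nome (of_int (int r * int l ^ 2) / 24) * h (of_nat l ^ 2 * \<tau>)"
      by (rule h_add_of_int)
    also have "(of_int (int r * int l ^ 2) / 24 :: complex) = of_nat r / 24 + of_int (int r * m)"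
      unfolding m by (simp add: field_simps)
    finally show ?thesis by (simp only: nome_add_of_int) (simp add: ring_distribs)
  qed
  show ?thesis unfolding hecke_h_def 1 2 3 by (simp add: ring_distribs mult_ac)
qed

lemma hecke_h_holomorphic: "hecke_h holomorphic_on upper_half"
proof -
  have comp: "(\<lambda>\<tau>. h (u \<tau>)) holomorphic_on upper_half"
    if "u holomorphic_on upper_half" "\<And>\<tau>. \<tau> \<in> upper_half \<Longrightarrow> u \<tau> \<in> upper_half" for u
    using holomorphic_on_compose_gen[OF that(1) h_holomorphic] that(2) by (auto simp: o_def)
  have "(\<lambda>\<tau>. A \<tau> b) holomorphic_on upper_half" for b
    unfolding A_def
  proof (rule comp)
    show "(\<tau> + of_int (24 * b)) / of_nat l ^ 2 \<in> upper_half" if "\<tau> \<in> upper_half" for \<tau>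
      by (rule divide_upper_half[OF that])
  qed (use l_pos in \<open>auto intro!: holomorphic_intros\<close>)
  moreover have "(\<lambda>\<tau>. B \<tau> b) holomorphic_on upper_half" for b
    unfolding B_def
  proof (rule comp)
    show "\<tau> + of_int (24 * b) / of_nat l \<in> upper_half" if "\<tau> \<in> upper_half" for \<tau>
      by (rule translate_upper_half[OF that])
  qed (use l_pos in \<open>auto intro!: holomorphic_intros\<close>)
  moreover have "(\<lambda>\<tau>. h (of_nat l ^ 2 * \<tau>)) holomorphic_on upper_half"
  proof (rule comp)
    show "of_nat l ^ 2 * \<tau> \<in> upper_half" if "\<tau> \<in> upper_half" for \<tau>
    proof -
      have "Im (of_real (real l ^ 2) * \<tau>) > 0" using that l_pos by (simp add: upper_half_def)
      thus ?thesis by (simp add: upper_half_def)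
    qed
  qed (intro holomorphic_intros)
  ultimately show ?thesis
    unfolding hecke_h_def[abs_def] using l_pos by (intro holomorphic_intros) auto
qed

lemma hecke_h_tendsto_0: "(hecke_h \<longlongrightarrow> 0) at_im_infty"
proof -
  have comp: "((\<lambda>\<tau>. h (u \<tau>)) \<longlongrightarrow> 0) at_im_infty"
    if "\<And>\<tau>. Im (u \<tau>) = x * Im \<tau>" "x > 0" for u x
  proof -
    have "filterlim u at_im_infty at_im_infty"
      by (rule filterlim_at_im_inftyI)
         (unfold that(1), rule filterlim_tendsto_pos_mult_at_top[OF tendsto_const that(2) filterlim_Im_at_im_infty])
    thus ?thesis by (rule filterlim_compose[OF h_tendsto_0])
  qed
  have "((\<lambda>\<tau>. A \<tau> b) \<longlongrightarrow> 0) at_im_infty" for b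
    unfolding A_def
  proof (rule comp[of _ "1 / real l ^ 2"])
    show "Im ((\<tau> + of_int (24 * b)) / of_nat l ^ 2) = 1 / real l ^ 2 * Im \<tau>" for \<tau>
      using Im_divide_of_real[of "\<tau> + of_int (24 * b)" "real l ^ 2"] by simp
  qed (use l_pos in simp)
  moreover have "((\<lambda>\<tau>. B \<tau> b) \<longlongrightarrow> 0) at_im_infty" for b
    unfolding B_def
  proof (rule comp[of _ 1])
    show "Im (\<tau> + of_int (24 * b) / of_nat l) = 1 * Im \<tau>" for \<tau>
      using Im_divide_of_real[of "of_int (24 * b)" "real l"] by simp
  qed simp
  moreover have "((\<lambda>\<tau>. h (of_nat l ^ 2 * \<tau>)) \<longlongrightarrow> 0) at_im_infty"
  proof (rule comp[of _ "real l ^ 2"])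
    show "Im (of_nat l ^ 2 * \<tau>) = real l ^ 2 * Im \<tau>" for \<tau>
    proof -
      have "Im (of_real x * \<tau>) = x * Im \<tau>" for x by simp
      from this[of "real l ^ 2"] show ?thesis by simp
    qed
  qed (use l_pos in simp)
  ultimately have "(hecke_h \<longlongrightarrow> (\<Sum>b<l ^ 2. 0) / of_nat l ^ 2 + twist_const * (\<Sum>b<l. leg (int b) * 0)
                + of_nat l ^ (2 * k) / of_nat l * 0) at_im_infty"
    unfolding hecke_h_def[abs_def] using l_pos by (intro tendsto_intros) auto
  thus ?thesis by simp
qed

subsection \<open>Dividing out the power of eta\<close>

definition quotient :: "complex \<Rightarrow> complex" where
  "quotient \<tau> = (if \<tau> \<in> upper_half then hecke_h \<tau> / dedekind_eta \<tau> ^ r else 0)"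

lemma quotient_mult: "\<tau> \<in> upper_half \<Longrightarrow> dedekind_eta \<tau> ^ r * quotient \<tau> = hecke_h \<tau>"
  using dedekind_eta_nonzero by (simp add: quotient_def)

lemma quotient_holomorphic: "quotient holomorphic_on upper_half"
proof (rule holomorphic_transform)
  show "(\<lambda>\<tau>. hecke_h \<tau> / dedekind_eta \<tau> ^ r) holomorphic_on upper_half"
    by (intro holomorphic_intros hecke_h_holomorphic dedekind_eta_holomorphic) (simp add: dedekind_eta_nonzero)
qed (simp add: quotient_def)

lemma quotient_T: "\<tau> \<in> upper_half \<Longrightarrow> quotient (\<tau> + 1) = quotient \<tau>"
proof -
  assume \<tau>: "\<tau> \<in> upper_half"
  hence "\<tau> + 1 \<in> upper_half" by (simp add: upper_half_def)
  thus ?thesis using \<tau>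
    by (simp add: quotient_def hecke_h_T dedekind_eta_add_1 power_mult_distrib nome_power)
qed

lemma quotient_S: "\<tau> \<in> upper_half \<Longrightarrow> quotient (- 1 / \<tau>) = \<tau> ^ s * quotient \<tau>"
proof -
  assume \<tau>: "\<tau> \<in> upper_half"
  hence "csqrt (- \<i> * \<tau>) \<noteq> 0" by (auto simp: upper_half_def)
  thus ?thesis using \<tau> S_upper_half[OF \<tau>]
    unfolding quotient_def hecke_h_S[OF \<tau>] dedekind_eta_S[OF \<tau>] automorphy_def
    by (simp add: power_mult_distrib)
qed

text \<open>Since \<open>r < 24\<close>, dividing by \<open>\<eta>\<^sup>r\<close> costs less than one power of \<open>nome \<tau>\<close>. The quotient
  therefore cannot have a pole at infinity.\<close>

lemma quotient_bounded: "Bfun quotient at_im_infty"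
proof -
  define E where "E = (\<lambda>\<tau>. \<Prod>n. 1 - nome \<tau> ^ Suc n)"
  have E: "(E \<longlongrightarrow> 1) at_im_infty" unfolding E_def by (rule euler_product_nome_tendsto_1)
  have "((\<lambda>\<tau>. nome (of_real (1 - real r / 24) * \<tau>) * hecke_h \<tau>) \<longlongrightarrow> 0) at_im_infty"
  proof (rule Lim_null_comparison)
    show "((\<lambda>\<tau>. norm (hecke_h \<tau>)) \<longlongrightarrow> 0) at_im_infty" by (rule tendsto_norm_zero[OF hecke_h_tendsto_0])
    show "\<forall>\<^sub>F \<tau> in at_im_infty. norm (nome (of_real (1 - real r / 24) * \<tau>) * hecke_h \<tau>) \<le> norm (hecke_h \<tau>)"
      using eventually_upper_half
    proof eventually_elim
      case (elim \<tau>)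
      have "Im (of_real (1 - real r / 24) * \<tau>) = (1 - real r / 24) * Im \<tau>" by simp
      also have "\<dots> \<ge> 0" using elim r_less by (intro mult_nonneg_nonneg) (auto simp: upper_half_def)
      finally have "norm (nome (of_real (1 - real r / 24) * \<tau>)) \<le> 1" by (simp add: norm_nome)
      thus ?case unfolding norm_mult by (intro mult_left_le_one_le) auto
    qed
  qed
  hence "((\<lambda>\<tau>. nome (of_real (1 - real r / 24) * \<tau>) * hecke_h \<tau> / E \<tau> ^ r) \<longlongrightarrow> 0 / 1 ^ r) at_im_infty"
    by (intro tendsto_intros E) auto
  moreover have "\<forall>\<^sub>F \<tau> in at_im_infty. nome (of_real (1 - real r / 24) * \<tau>) * hecke_h \<tau> / E \<tau> ^ r = nome \<tau> * quotient \<tau>"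
    using eventually_upper_half
  proof eventually_elim
    case (elim \<tau>)
    have "of_real (1 - real r / 24) * \<tau> = \<tau> - of_nat r * (\<tau> / 24)" by (simp add: algebra_simps)
    hence "nome (of_real (1 - real r / 24) * \<tau>) = nome \<tau> / nome (\<tau> / 24) ^ r"
      by (simp only: nome_diff nome_power)
    thus ?case using elim
      by (simp add: quotient_def dedekind_eta_conv_nome E_def power_mult_distrib)
  qed
  ultimately have "((\<lambda>\<tau>. nome \<tau> * quotient \<tau>) \<longlongrightarrow> 0 / 1 ^ r) at_im_infty"
    by (rule Lim_transform_eventually)
  hence lim: "((\<lambda>\<tau>. nome \<tau> * quotient \<tau>) \<longlongrightarrow> 0) at_im_infty" by simp
  obtain \<Phi> where \<Phi>: "\<Phi> holomorphic_on ball 0 1" "\<And>\<tau>. \<tau> \<in> upper_half \<Longrightarrow> quotient \<tau> = \<Phi> (nome \<tau>)"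
    using periodic_eq_function_of_nome[OF quotient_holomorphic quotient_T lim] by blast
  have "isCont \<Phi> 0"
    using \<Phi>(1) by (meson centre_in_ball continuous_on_eq_continuous_at holomorphic_on_imp_continuous_on
        open_ball zero_less_one)
  moreover have "(nome \<longlongrightarrow> 0) at_im_infty" using nome_tendsto_0 by (simp add: filterlim_at)
  ultimately have "((\<lambda>\<tau>. \<Phi> (nome \<tau>)) \<longlongrightarrow> \<Phi> 0) at_im_infty" by (rule isCont_tendsto_compose)
  moreover have "\<forall>\<^sub>F \<tau> in at_im_infty. \<Phi> (nome \<tau>) = quotient \<tau>"
    using eventually_upper_half by eventually_elim (simp add: \<Phi>(2))
  ultimately have "(quotient \<longlongrightarrow> \<Phi> 0) at_im_infty" by (rule Lim_transform_eventually)
  from tendstoD[OF this zero_less_one] have "\<forall>\<^sub>F \<tau> in at_im_infty. dist (quotient \<tau>) (\<Phi> 0) \<le> 1"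
    by eventually_elim simp
  thus ?thesis unfolding Bfun_metric_def by (intro exI[of _ "\<Phi> 0"] exI[of _ 1]) simp
qed

lemma quotient_modular: "quotient \<in> modular_forms s"
proof -
  have "quotient (mobius a b c d \<tau>) = (of_int c * \<tau> + of_int d) ^ s * quotient \<tau>"
    if "a * d - b * c = 1" "\<tau> \<in> upper_half" for a b c d \<tau>
    by (rule modular_from_S_T[OF even_s]) (use quotient_T quotient_S that in auto)
  thus ?thesis
    using quotient_holomorphic quotient_bounded
    by (auto simp: modular_forms_def holomorphic_upper_half_def quotient_def)
qed

subsection \<open>Fourier coefficients of the image\<close>

definition "F = (\<lambda>\<tau>. h (24 * \<tau>))"

abbreviation "a \<equiv> fourier_coeffs F"

lemma F_sums: "\<tau> \<in> upper_half \<Longrightarrow> (\<lambda>n. a n * nome \<tau> ^ n) sums F \<tau>" and a_0: "a 0 = 0"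
proof -
  have hol: "F holomorphic_on upper_half"
    unfolding F_def by (rule holomorphic_upper_half_dilate[OF h_holomorphic])
  have per: "F (\<tau> + 1) = F \<tau>" if "\<tau> \<in> upper_half" for \<tau>
    using h_add_24[of "24 * \<tau>" 1] that by (simp add: F_def ring_distribs)
  have "filterlim (\<lambda>\<tau>. 24 * \<tau>) at_im_infty at_im_infty"
    by (rule filterlim_at_im_inftyI)
       (use filterlim_tendsto_pos_mult_at_top[OF tendsto_const _ filterlim_Im_at_im_infty, of 24] in simp)
  hence lim: "(F \<longlongrightarrow> 0) at_im_infty"
    unfolding F_def by (rule filterlim_compose[OF h_tendsto_0])
  show "\<tau> \<in> upper_half \<Longrightarrow> (\<lambda>n. a n * nome \<tau> ^ n) sums F \<tau>"
    by (rule fourier_coeffs_sums(1)[OF hol per lim])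
  show "a 0 = 0" by (rule fourier_coeffs_sums(2)[OF hol per lim])
qed

lemma subsequence_series_sums:
  assumes \<tau>: "\<tau> \<in> upper_half"
  shows "(\<lambda>n. a (l ^ 2 * n) * nome \<tau> ^ n) sums ((\<Sum>b<l ^ 2. A (24 * \<tau>) (int b)) / of_nat l ^ 2)"
proof -
  have l2: "l ^ 2 > 0" using l_pos by simp
  define x where "x = nome (\<tau> / of_nat l ^ 2)"
  have "(\<lambda>n. \<Sum>b<l ^ 2. a n * nome ((\<tau> + of_int (int b)) / of_nat l ^ 2) ^ n)
          sums (\<Sum>b<l ^ 2. F ((\<tau> + of_int (int b)) / of_nat l ^ 2))"
    by (intro sums_sum F_sums divide_upper_half \<tau>)
  also have "(\<Sum>b<l ^ 2. F ((\<tau> + of_int (int b)) / of_nat l ^ 2)) = (\<Sum>b<l ^ 2. A (24 * \<tau>) (int b))"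
    by (intro sum.cong refl) (simp add: F_def A_def ring_distribs)
  also have "(\<lambda>n. \<Sum>b<l ^ 2. a n * nome ((\<tau> + of_int (int b)) / of_nat l ^ 2) ^ n)
      = (\<lambda>n. a n * x ^ n * (if l ^ 2 dvd n then of_nat l ^ 2 else 0))"
  proof
    fix n
    have "nome ((\<tau> + of_int (int b)) / of_nat l ^ 2) ^ n = x ^ n * nome (of_int (int n) * of_nat b / of_nat (l ^ 2))" for b
      unfolding x_def nome_power nome_add[symmetric] by (rule arg_cong[of _ _ nome]) (simp add: field_simps add_divide_distrib)
    hence "(\<Sum>b<l ^ 2. a n * nome ((\<tau> + of_int (int b)) / of_nat l ^ 2) ^ n)
        = a n * x ^ n * (\<Sum>b<l ^ 2. nome (of_int (int n) * of_nat b / of_nat (l ^ 2)))"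
      by (simp only: sum_distrib_left mult.assoc)
    also have "\<dots> = a n * x ^ n * (if int (l ^ 2) dvd int n then of_nat (l ^ 2) else 0)"
      by (simp only: sum_nome_root_of_unity[OF l2])
    also have "\<dots> = a n * x ^ n * (if l ^ 2 dvd n then of_nat l ^ 2 else 0)"
      by (simp only: of_nat_dvd_iff) simp
    finally show "(\<Sum>b<l ^ 2. a n * nome ((\<tau> + of_int (int b)) / of_nat l ^ 2) ^ n)
        = a n * x ^ n * (if l ^ 2 dvd n then of_nat l ^ 2 else 0)" .
  qed
  finally have "(\<lambda>n. a n * x ^ n * (if l ^ 2 dvd n then of_nat l ^ 2 else 0)) sums (\<Sum>b<l ^ 2. A (24 * \<tau>) (int b))" .
  hence "(\<lambda>n. a (l ^ 2 * n) * x ^ (l ^ 2 * n) * (if l ^ 2 dvd l ^ 2 * n then of_nat l ^ 2 else 0))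
      sums (\<Sum>b<l ^ 2. A (24 * \<tau>) (int b))"
    by (subst sums_mono_reindex[of "\<lambda>n. l ^ 2 * n"])
       (use l2 in \<open>auto simp: strict_mono_def dvd_def\<close>)
  from sums_divide[OF this, of "of_nat l ^ 2"]
  have "(\<lambda>n. a (l ^ 2 * n) * x ^ (l ^ 2 * n)) sums ((\<Sum>b<l ^ 2. A (24 * \<tau>) (int b)) / of_nat l ^ 2)"
    using l_pos by simp
  moreover have "x ^ (l ^ 2 * n) = nome \<tau> ^ n" for n
    using l_pos by (simp add: x_def nome_power)
  ultimately show ?thesis by simp
qed

lemma twisted_series_sums:
  assumes \<tau>: "\<tau> \<in> upper_half"
  shows "(\<lambda>n. legendre_gauss_sum l * leg (int n) * a n * nome \<tau> ^ n) sums (\<Sum>b<l. leg (int b) * B (24 * \<tau>) (int b))"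
proof -
  have "(\<lambda>n. \<Sum>b<l. leg (int b) * (a n * nome (\<tau> + of_int (int b) / of_nat l) ^ n))
          sums (\<Sum>b<l. leg (int b) * F (\<tau> + of_int (int b) / of_nat l))"
    by (intro sums_sum sums_mult F_sums translate_upper_half \<tau>)
  also have "(\<Sum>b<l. leg (int b) * F (\<tau> + of_int (int b) / of_nat l)) = (\<Sum>b<l. leg (int b) * B (24 * \<tau>) (int b))"
    by (intro sum.cong refl) (simp add: F_def B_def ring_distribs)
  also have "(\<lambda>n. \<Sum>b<l. leg (int b) * (a n * nome (\<tau> + of_int (int b) / of_nat l) ^ n))
      = (\<lambda>n. legendre_gauss_sum l * leg (int n) * a n * nome \<tau> ^ n)"
  proof
    fix n
    have "nome (\<tau> + of_int (int b) / of_nat l) ^ n = nome \<tau> ^ n * nome (of_int (int n * int b) / of_nat l)" for b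
      unfolding nome_power nome_add[symmetric] by (rule arg_cong[of _ _ nome]) (simp add: field_simps)
    hence "(\<Sum>b<l. leg (int b) * (a n * nome (\<tau> + of_int (int b) / of_nat l) ^ n))
      = a n * nome \<tau> ^ n * (\<Sum>b<l. leg (int b) * nome (of_int (int n * int b) / of_nat l))"
      unfolding sum_distrib_left by (intro sum.cong refl) (simp only: mult_ac)
    thus "(\<Sum>b<l. leg (int b) * (a n * nome (\<tau> + of_int (int b) / of_nat l) ^ n))
      = legendre_gauss_sum l * leg (int n) * a n * nome \<tau> ^ n"
      unfolding Legendre_fourier by (simp only: mult_ac)
  qed
  finally show ?thesis .
qed

lemma dilated_series_sums:
  assumes \<tau>: "\<tau> \<in> upper_half"
  shows "(\<lambda>n. (if l ^ 2 dvd n then a (n div l ^ 2) else 0) * nome \<tau> ^ n) sums h (of_nat l ^ 2 * (24 * \<tau>))"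
proof -
  have l2: "l ^ 2 > 0" using l_pos by simp
  have "of_nat l ^ 2 * \<tau> \<in> upper_half"
  proof -
    have "Im (of_real (real l ^ 2) * \<tau>) > 0" using \<tau> l_pos by (simp add: upper_half_def)
    thus ?thesis by (simp add: upper_half_def)
  qed
  from F_sums[OF this] have "(\<lambda>n. a n * nome (of_nat l ^ 2 * \<tau>) ^ n) sums h (of_nat l ^ 2 * (24 * \<tau>))"
    by (simp add: F_def mult_ac)
  also have "(\<lambda>n. a n * nome (of_nat l ^ 2 * \<tau>) ^ n)
      = (\<lambda>n. (if l ^ 2 dvd l ^ 2 * n then a (l ^ 2 * n div l ^ 2) else 0) * nome \<tau> ^ (l ^ 2 * n))"
    using l2 by (simp add: nome_power mult_ac)
  finally show ?thesis
    by (subst (asm) sums_mono_reindex[of "\<lambda>n. l ^ 2 * n"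
          "\<lambda>n. (if l ^ 2 dvd n then a (n div l ^ 2) else 0) * nome \<tau> ^ n"])
       (use l2 in \<open>auto simp: strict_mono_def dvd_def\<close>)
qed

text \<open>Only the square of the Gauss sum enters, so its sign is irrelevant.\<close>

lemma twist_const_gauss_sum: "twist_const * legendre_gauss_sum l = chi12 (int l) * leg ((- 1) ^ k) * (of_nat l ^ k / of_nat l)"
proof -
  obtain j where j: "r = 2 * j + 1" using odd_r by (auto elim: oddE)
  obtain i where i: "s = 2 * i" using even_s by auto
  define g where "g = legendre_gauss_sum l"
  define e where "e = leg (- 1)"
  have "\<not> int l dvd - 1" using l_gt_2 by auto
  from Legendre_self_square[OF this] have ee: "e * e = 1"
    unfolding e_def of_int_mult[symmetric] by simp
  have gg: "g ^ 2 = e * of_nat l" unfolding g_def e_def by (rule legendre_gauss_sum_square)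
  have L0: "(of_nat l :: complex) \<noteq> 0" using l_pos by simp
  have k: "k = 2 * i + j" unfolding k_def by (simp add: j i)
  have chi: "chi12 (int l) ^ r = chi12 (int l)"
    using chi12_l_square by (simp add: j power_mult power2_eq_square)
  have "leg ((- 1) ^ k) = e ^ k"
    by (simp add: e_def Legendre_power[OF prime_l l_gt_2])
  also have "e ^ k = e ^ j" using ee by (simp add: k power_add power_mult power2_eq_square)
  finally have lk: "leg ((- 1) ^ k) = e ^ j" .
  have "g ^ r * g = (g ^ 2) ^ (j + 1)"
    unfolding j by (simp add: power_add power_mult power2_eq_square)
  also have "\<dots> = e ^ j * e * of_nat l ^ j * of_nat l" by (simp add: gg power_mult_distrib)
  finally have gr: "g ^ r * g = e ^ j * e * of_nat l ^ j * of_nat l" .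
  have "twist_const * g = chi12 (int l) * (g ^ r * g) * of_nat l ^ s * e / of_nat l ^ 2"
    by (simp add: twist_const_def nonunit_const_def g_def e_def power_mult_distrib chi)
  also have "\<dots> = chi12 (int l) * e ^ j * (e * e) * (of_nat l ^ (s + j) * of_nat l / of_nat l ^ 2)"
    unfolding gr by (simp add: power_add)
  also have "of_nat l ^ (s + j) * of_nat l / of_nat l ^ 2 = of_nat l ^ k / (of_nat l :: complex)"
    unfolding k unfolding i using L0 by (simp add: power2_eq_square)
  finally show ?thesis by (simp add: ee lk g_def)
qed

lemma hecke_coeff_sums:
  assumes \<tau>: "\<tau> \<in> upper_half"
  shows "(\<lambda>n. hecke_coeff k chi12 l a n * nome \<tau> ^ n) sums hecke_h (24 * \<tau>)"
proof -
  have L0: "(of_nat l :: complex) \<noteq> 0" using l_pos by simp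
  have "(\<lambda>n. a (l ^ 2 * n) * nome \<tau> ^ n
          + twist_const * (legendre_gauss_sum l * leg (int n) * a n * nome \<tau> ^ n)
          + of_nat l ^ (2 * k) / of_nat l * ((if l ^ 2 dvd n then a (n div l ^ 2) else 0) * nome \<tau> ^ n))
        sums hecke_h (24 * \<tau>)"
    unfolding hecke_h_def by (intro sums_add sums_mult subsequence_series_sums twisted_series_sums dilated_series_sums \<tau>)
  also have "(\<lambda>n. a (l ^ 2 * n) * nome \<tau> ^ n
          + twist_const * (legendre_gauss_sum l * leg (int n) * a n * nome \<tau> ^ n)
          + of_nat l ^ (2 * k) / of_nat l * ((if l ^ 2 dvd n then a (n div l ^ 2) else 0) * nome \<tau> ^ n))
      = (\<lambda>n. hecke_coeff k chi12 l a n * nome \<tau> ^ n)"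
  proof
    fix n
    have p1: "(of_nat l :: complex) powi (int k - 1) = of_nat l ^ k / of_nat l"
      using L0 by (simp add: power_int_diff)
    have p2: "(of_nat l :: complex) powi (2 * int k - 1) = of_nat l ^ (2 * k) / of_nat l"
    proof -
      have "(of_nat l :: complex) powi (2 * int k) = of_nat l ^ (2 * k)"
        using power_int_of_nat[of "of_nat l :: complex" "2 * k"] by simp
      thus ?thesis using L0 by (simp add: power_int_diff)
    qed
    have chi: "chi12 (int l ^ 2) = 1" using chi12_l_square by (simp add: power2_eq_square chi12_mult)
    have "leg ((- 1) ^ k * int n) = leg ((- 1) ^ k) * leg (int n)"
      by (simp add: Legendre_mult[OF prime_l l_gt_2])
    hence "hecke_coeff k chi12 l a n = a (l ^ 2 * n)
       + (chi12 (int l) * leg ((- 1) ^ k) * (of_nat l ^ k / of_nat l)) * leg (int n) * a n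
       + of_nat l ^ (2 * k) / of_nat l * (if l ^ 2 dvd n then a (n div l ^ 2) else 0)"
      unfolding hecke_coeff_def p1 p2 chi by (simp only: mult_ac mult_1_left)
    thus "a (l ^ 2 * n) * nome \<tau> ^ n
          + twist_const * (legendre_gauss_sum l * leg (int n) * a n * nome \<tau> ^ n)
          + of_nat l ^ (2 * k) / of_nat l * ((if l ^ 2 dvd n then a (n div l ^ 2) else 0) * nome \<tau> ^ n)
        = hecke_coeff k chi12 l a n * nome \<tau> ^ n"
      unfolding twist_const_gauss_sum[symmetric] by (simp only: ring_distribs mult_ac)
  qed
  finally show ?thesis .
qed

theorem hecke_operator_eta_multiple:
  "hecke_operator k chi12 l F = (\<lambda>\<tau>. dedekind_eta (24 * \<tau>) ^ r * quotient (24 * \<tau>))"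
proof
  fix \<tau>
  show "hecke_operator k chi12 l F \<tau> = dedekind_eta (24 * \<tau>) ^ r * quotient (24 * \<tau>)"
  proof (cases "\<tau> \<in> upper_half")
    case False
    thus ?thesis by (simp add: hecke_operator_def quotient_def)
  next
    case True
    have "hecke_coeff k chi12 l a 0 = 0" by (simp add: hecke_coeff_def a_0)
    with hecke_coeff_sums[OF True]
    have "(\<lambda>n. hecke_coeff k chi12 l a (Suc n) * nome \<tau> ^ Suc n) sums hecke_h (24 * \<tau>)"
      by (subst sums_Suc_iff) simp
    hence "hecke_operator k chi12 l F \<tau> = hecke_h (24 * \<tau>)"
      using True by (simp only: hecke_operator_def sums_unique[symmetric] if_True)
    also have "\<dots> = dedekind_eta (24 * \<tau>) ^ r * quotient (24 * \<tau>)"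
      using True by (intro quotient_mult[symmetric]) simp
    finally show ?thesis .
  qed
qed

end

theorem hecke_operator_eta_space:
  assumes "odd r" "r < 24" "even s" "prime l" "l \<noteq> 2" "l \<noteq> 3" "g \<in> eta_space r s"
  shows "hecke_operator (s + (r - 1) div 2) chi12 l g \<in> eta_space r s"
proof -
  obtain f where f: "f \<in> modular_forms s" and g: "g = (\<lambda>\<tau>. dedekind_eta (24 * \<tau>) ^ r * f (24 * \<tau>))"
    using assms(7) by (auto simp: eta_space_def)
  have "2 < l" using prime_ge_2_nat[OF assms(4)] assms(5) by simp
  interpret eta_multiple l r s f
    by unfold_locales (use assms f \<open>2 < l\<close> in auto)
  have "hecke_operator (s + (r - 1) div 2) chi12 l g = (\<lambda>\<tau>. dedekind_eta (24 * \<tau>) ^ r * quotient (24 * \<tau>))"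
    using hecke_operator_eta_multiple by (simp add: F_def h_def g k_def)
  thus ?thesis
    unfolding eta_space_def using quotient_modular by blast
qed

theorem theorem2:
  fixes r s :: nat
  assumes "odd r" and "0 < r" and "r < 24" and "even s"
  shows "eta_space r s \<subseteq> half_integral_cusp_forms (s + (r - 1) div 2) 576 chi12
    \<and> cfun.subspace (eta_space r s)
    \<and> (\<forall>l::nat. \<forall>f \<in> eta_space r s. prime l \<and> l \<noteq> 2 \<and> l \<noteq> 3
          \<longrightarrow> hecke_operator (s + (r - 1) div 2) chi12 l f \<in> eta_space r s)"
  using eta_space_subset_cusp_forms[OF assms(1,4)] eta_space_subspace
    hecke_operator_eta_space[OF assms(1,3,4)] by blast

end
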